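(* Let $\mathsf{G}=(\mathsf{V},\mathsf{E})$, $W$, $V$, $\alpha$, $\theta$, $q$ be as in the context (in particular $\mathit{\Theta}(\alpha,\theta)<\infty$, $|W(u,v)|\le [I_W+J_W(u^2+v^2)]/2$, $V(u)\ge a_V|u|^q-c_V$ with $q>2+2/\theta$), let $p=2+2/\theta$ and let $\mathit{\Omega}^{\rm t}=L^p(\mathsf{V},w_\alpha)$. Then the set $\mathcal{G}^{\rm t}=\{\mu\in\mathcal{G}\ :\ \mu(\mathit{\Omega}^{\rm t})=1\}$ of tempered Gibbs measures is non-void and compact in the weak topology of $\mathcal{P}(\mathit{\Omega})$. Moreover, for every $\lambda>0$ and $x\in\mathsf{V}$ there exists $C(\lambda,x)>0$ such that for all $\mu\in\mathcal{G}^{\rm t}$, $$\int_{\mathit{\Omega}}\exp\left(\lambda|\omega(x)|^p\right)\mu(d\omega)\le C(\lambda,x),$$ and for every $\lambda>0$ there exists $C(\lambda)>0$ such that for all $\mu\in\mathcal{G}^{\rm t}$, $$\int_{\mathit{\Omega}}\exp\left(\lambda\|\omega\|_{p,\alpha}^p\right)\mu(d\omega)\le C(\lambda).$$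
   Context: $\mathsf{G}=(\mathsf{V},\mathsf{E})$ is a countable, connected, locally finite undirected graph; $x\sim y$ denotes adjacency, $n(x)$ the degree of $x$, $\rho(x,y)$ the path distance (length of a shortest path joining $x$ and $y$). A root $o\in\mathsf{V}$ is fixed; for $\alpha>0$, $w_\alpha(x)=\exp[-\alpha\rho(o,x)]$. For $\theta>0$, $m_\theta(x)=\sum_{y\sim x}[n(x)n(y)]^\theta$ and $\mathit{\Theta}(\alpha,\theta)=\sum_{x\in\mathsf{V}}m_\theta(x)w_\alpha(x)$. Standing assumptions: (i) $\mathit{\Theta}(\alpha,\theta)<\infty$ for the fixed $\alpha,\theta>0$; (ii) $W:\mathbb{R}^2\to\mathbb{R}$ is continuous, symmetric, and $|W(u,v)|\le[I_W+J_W(u^2+v^2)]/2$ for some $I_W,J_W>0$; (iii) $V:\mathbb{R}\to\mathbb{R}$ is continuous and $V(u)\ge a_V|u|^q-c_V$ for some $a_V,c_V>0$ and $q>2+2/\theta$. $\mathit{\Omega}=\mathbb{R}^{\mathsf{V}}$ carries the product topology and its Borel $\sigma$-field; $\mathcal{P}(\mathit{\Omega})$ is the set of Borel probability measures with the weak topology (generated by bounded continuous functions). For $p,\alpha>0$, $\|\omega\|_{p,\alpha}=[\sum_x|\omega(x)|^pw_\alpha(x)]^{1/p}$ and $L^p(\mathsf{V},w_\alpha)=\{\omega\in\mathit{\Omega}:\|\omega\|_{p,\alpha}<\infty\}$. For finite non-void $\mathit{\Lambda}\subset\mathsf{V}$, $\xi\in\mathit{\Omega}$, write $\omega=\omega_{\mathit{\Lambda}}\times\omega_{\mathit{\Lambda}^c}$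 and set $H_{\mathit{\Lambda}}(\omega_{\mathit{\Lambda}}|\xi)=\sum_{\langle x,y\rangle\in\mathsf{E}:x,y\in\mathit{\Lambda}}W(\omega(x),\omega(y))+\sum_{\langle x,y\rangle\in\mathsf{E}:x\in\mathit{\Lambda},y\notin\mathit{\Lambda}}W(\omega(x),\xi(y))+\sum_{x\in\mathit{\Lambda}}V(\omega(x))$, and $\pi_{\mathit{\Lambda}}(A|\xi)=Z_{\mathit{\Lambda}}(\xi)^{-1}\int_{\mathbb{R}^{\mathit{\Lambda}}}\mathbb{I}_A(\omega_{\mathit{\Lambda}}\times\xi_{\mathit{\Lambda}^c})\exp[-H_{\mathit{\Lambda}}(\omega_{\mathit{\Lambda}}|\xi)]d\omega_{\mathit{\Lambda}}$ (Lebesgue measure, $Z_{\mathit{\Lambda}}(\xi)$ normalizing). $\mathcal{G}$ is the set of $\mu\in\mathcal{P}(\mathit{\Omega})$ with $\mu(A)=\int\pi_{\mathit{\Lambda}}(A|\omega)\mu(d\omega)$ for all Borel $A$ and all finite non-void $\mathit{\Lambda}\subset\mathsf{V}$ (Gibbs measures). *)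

theory Defs
  imports "HOL-Analysis.Analysis" "HOL-Probability.Probability"
begin

definition graph_walk :: "('v \<Rightarrow> 'v \<Rightarrow> bool) \<Rightarrow> 'v \<Rightarrow> 'v \<Rightarrow> nat \<Rightarrow> bool" where
  "graph_walk adj x y n \<longleftrightarrow>
     (\<exists>p :: nat \<Rightarrow> 'v. p 0 = x \<and> p n = y \<and> (\<forall>i<n. adj (p i) (p (Suc i))))"

definition connected_graph :: "('v \<Rightarrow> 'v \<Rightarrow> bool) \<Rightarrow> bool" where
  "connected_graph adj \<longleftrightarrow> (\<forall>x y. \<exists>n. graph_walk adj x y n)"

definition locally_finite_graph :: "('v \<Rightarrow> 'v \<Rightarrow> bool) \<Rightarrow> bool" where
  "locally_finite_graph adj \<longleftrightarrow> (\<forall>x. finite {y. adj x y})"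

definition undirected_graph :: "('v \<Rightarrow> 'v \<Rightarrow> bool) \<Rightarrow> bool" where
  "undirected_graph adj \<longleftrightarrow> (\<forall>x y. adj x y \<longleftrightarrow> adj y x) \<and> (\<forall>x. \<not> adj x x)"

definition degree :: "('v \<Rightarrow> 'v \<Rightarrow> bool) \<Rightarrow> 'v \<Rightarrow> nat" where
  "degree adj x = card {y. adj x y}"

definition path_dist :: "('v \<Rightarrow> 'v \<Rightarrow> bool) \<Rightarrow> 'v \<Rightarrow> 'v \<Rightarrow> nat" where
  "path_dist adj x y = (LEAST n. graph_walk adj x y n)"

definition weight :: "('v \<Rightarrow> 'v \<Rightarrow> bool) \<Rightarrow> 'v \<Rightarrow> real \<Rightarrow> 'v \<Rightarrow> real" where
  "weight adj o\<^sub>r \<alpha> x = exp (- \<alpha> * real (path_dist adj o\<^sub>r x))"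

definition m_theta :: "('v \<Rightarrow> 'v \<Rightarrow> bool) \<Rightarrow> real \<Rightarrow> 'v \<Rightarrow> real" where
  "m_theta adj \<theta> x = (\<Sum>y\<in>{y. adj x y}. (real (degree adj x * degree adj y)) powr \<theta>)"

definition Theta_finite :: "('v \<Rightarrow> 'v \<Rightarrow> bool) \<Rightarrow> 'v \<Rightarrow> real \<Rightarrow> real \<Rightarrow> bool" where
  "Theta_finite adj o\<^sub>r \<alpha> \<theta> \<longleftrightarrow>
     (\<lambda>x. m_theta adj \<theta> x * weight adj o\<^sub>r \<alpha> x) summable_on UNIV"

definition wnorm_pow :: "('v \<Rightarrow> 'v \<Rightarrow> bool) \<Rightarrow> 'v \<Rightarrow> real \<Rightarrow> real \<Rightarrow> ('v \<Rightarrow> real) \<Rightarrow> real" where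
  "wnorm_pow adj o\<^sub>r \<alpha> p \<omega> = (\<Sum>\<^sub>\<infinity>x. \<bar>\<omega> x\<bar> powr p * weight adj o\<^sub>r \<alpha> x)"

definition Lp_w :: "('v \<Rightarrow> 'v \<Rightarrow> bool) \<Rightarrow> 'v \<Rightarrow> real \<Rightarrow> real \<Rightarrow> ('v \<Rightarrow> real) set" where
  "Lp_w adj o\<^sub>r \<alpha> p = {\<omega>. (\<lambda>x. \<bar>\<omega> x\<bar> powr p * weight adj o\<^sub>r \<alpha> x) summable_on UNIV}"

definition prob_measures :: "('v \<Rightarrow> real) measure set" where
  "prob_measures = {\<mu>. sets \<mu> = sets borel \<and> prob_space \<mu>}"

definition weak_topology :: "('v \<Rightarrow> real) measure topology" where
  "weak_topology = topology_generated_by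
     {{\<mu> \<in> prob_measures. (\<integral>\<omega>. f \<omega> \<partial>\<mu>) \<in> U} | f U.
        continuous_on UNIV f \<and> bounded (range f) \<and> open (U :: real set)}"

definition merge_conf :: "'v set \<Rightarrow> ('v \<Rightarrow> real) \<Rightarrow> ('v \<Rightarrow> real) \<Rightarrow> ('v \<Rightarrow> real)" where
  "merge_conf \<Lambda> \<omega> \<xi> = (\<lambda>x. if x \<in> \<Lambda> then \<omega> x else \<xi> x)"

text \<open>H_Lambda(omega_Lambda | xi). Each inner edge is counted once: the sum over ordered
  pairs of inner neighbours is halved (W is symmetric).\<close>
definition hamiltonian ::
  "('v \<Rightarrow> 'v \<Rightarrow> bool) \<Rightarrow> (real \<Rightarrow> real \<Rightarrow> real) \<Rightarrow> (real \<Rightarrow> real) \<Rightarrow>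
   'v set \<Rightarrow> ('v \<Rightarrow> real) \<Rightarrow> ('v \<Rightarrow> real) \<Rightarrow> real" where
  "hamiltonian adj W V \<Lambda> \<omega> \<xi> =
     (\<Sum>(x,y)\<in>{(x,y). x \<in> \<Lambda> \<and> y \<in> \<Lambda> \<and> adj x y}. W (\<omega> x) (\<omega> y)) / 2
   + (\<Sum>(x,y)\<in>{(x,y). x \<in> \<Lambda> \<and> y \<notin> \<Lambda> \<and> adj x y}. W (\<omega> x) (\<xi> y))
   + (\<Sum>x\<in>\<Lambda>. V (\<omega> x))"

definition gibbs_kernel ::
  "('v \<Rightarrow> 'v \<Rightarrow> bool) \<Rightarrow> (real \<Rightarrow> real \<Rightarrow> real) \<Rightarrow> (real \<Rightarrow> real) \<Rightarrow>
   'v set \<Rightarrow> ('v \<Rightarrow> real) set \<Rightarrow> ('v \<Rightarrow> real) \<Rightarrow> ennreal" where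
  "gibbs_kernel adj W V \<Lambda> A \<xi> =
     (\<integral>\<^sup>+\<omega>. indicator A (merge_conf \<Lambda> \<omega> \<xi>) * ennreal (exp (- hamiltonian adj W V \<Lambda> \<omega> \<xi>))
        \<partial>(PiM \<Lambda> (\<lambda>_. lborel)))
   / (\<integral>\<^sup>+\<omega>. ennreal (exp (- hamiltonian adj W V \<Lambda> \<omega> \<xi>)) \<partial>(PiM \<Lambda> (\<lambda>_. lborel)))"

definition gibbs_measures ::
  "('v \<Rightarrow> 'v \<Rightarrow> bool) \<Rightarrow> (real \<Rightarrow> real \<Rightarrow> real) \<Rightarrow> (real \<Rightarrow> real) \<Rightarrow> ('v \<Rightarrow> real) measure set" where
  "gibbs_measures adj W V = {\<mu> \<in> prob_measures.
     \<forall>\<Lambda> A. finite \<Lambda> \<and> \<Lambda> \<noteq> {} \<and> A \<in> sets borel \<longrightarrow>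
        emeasure \<mu> A = (\<integral>\<^sup>+\<xi>. gibbs_kernel adj W V \<Lambda> A \<xi> \<partial>\<mu>)}"

definition tempered_gibbs ::
  "('v \<Rightarrow> 'v \<Rightarrow> bool) \<Rightarrow> 'v \<Rightarrow> real \<Rightarrow> real \<Rightarrow> (real \<Rightarrow> real \<Rightarrow> real) \<Rightarrow> (real \<Rightarrow> real) \<Rightarrow>
   ('v \<Rightarrow> real) measure set" where
  "tempered_gibbs adj o\<^sub>r \<alpha> p W V =
     {\<mu> \<in> gibbs_measures adj W V. emeasure \<mu> (Lp_w adj o\<^sub>r \<alpha> p) = 1}"

end

theory Submission
  imports Defs
begin

text \<open>A one-site estimate bounds the exponential moment of the spin at \<open>x\<close>, for a fixed boundary condition,
  by \<open>exp (B + D * m x + \<Sum>y\<sim>x. \<delta> / (n x * n y) * \<bar>\<xi> y\<bar> powr p)\<close>; the exponent \<open>p = 2 + 2 / \<theta>\<close> is exactly what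
  Young's inequality needs to produce \<open>m x\<close>. By consistency of the kernels and Hoelder's inequality, the
  logarithms of the exponential moments in a finite volume satisfy a linear recursive inequality that is
  contractive in the weighted \<open>l\<^sup>1\<close> norm when \<open>\<delta>\<close> is small. This gives moment bounds that are uniform up to
  a boundary term, which vanishes in the infinite-volume limit for tempered measures.

  The moment bounds dominate the marginals on a finite volume by one finite measure. Hence sequences
  have subsequences that converge setwise on events depending on finitely many coordinates, and
  Kolmogorov's theorem yields a limit measure. The DLR equations, which relate such events, pass to these
  limits, and together with tightness this mode of convergence implies weak convergence. Existence
  follows from finite-volume measures with zero boundary condition.\<close>

section \<open>Functions of finitely many coordinates and partial integration\<close>

text \<open>The coefficient \<open>\<delta> / (n x * n y)\<close> is shaped by two demands. Summed
  over y, the factor \<open>1 / n x\<close> keeps the Hoelder weights at total mass at most 1;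
  summed over x, the factor \<open>1 / n y\<close> yields the contraction. Its price in Young's
  inequality is \<open>(n x * n y) powr \<theta>\<close> per edge, which adds up to
  \<open>m x\<close>, and finiteness of Theta makes the total price summable against
  \<open>w\<close>. The gap between q and p makes all estimates available for every
  \<open>lam\<close>. Large values are really used: passing from single spins to the norm multiplies
  \<open>lam\<close> by the total weight, and the dominating measure needs a \<open>lam\<close> that
  grows with the volume. A self-bounding inequality for moments can be solved only if the moments
  are finite. This is not known beforehand for a Gibbs measure, but it is elementary for a
  finite-volume kernel; hence the recursion runs there, and measures enter only through the DLR
  equation. The weak topology is given by a subbase of integral conditions, so subsequences alone do
  not yield compactness. An injective map into a countable power of the reals translates between the
  two.\<close>

definition depends_on :: "'v set \<Rightarrow> (('v \<Rightarrow> real) \<Rightarrow> 'b) \<Rightarrow> bool" where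
  "depends_on S f \<longleftrightarrow> (\<forall>\<omega> \<omega>'. (\<forall>x\<in>S. \<omega> x = \<omega>' x) \<longrightarrow> f \<omega> = f \<omega>')"

lemma depends_onD: "depends_on S f \<Longrightarrow> (\<And>x. x \<in> S \<Longrightarrow> \<omega> x = \<omega>' x) \<Longrightarrow> f \<omega> = f \<omega>'"
  by (simp add: depends_on_def)

lemma depends_on_UNIV: "depends_on UNIV f"
  unfolding depends_on_def by (metis UNIV_I ext)

lemma depends_on_compose: "depends_on S f \<Longrightarrow> depends_on S (\<lambda>\<omega>. g (f \<omega>))"
  unfolding depends_on_def by metis

lemma depends_on_compose2:
  "depends_on S f \<Longrightarrow> depends_on S g \<Longrightarrow> depends_on S (\<lambda>\<omega>. h (f \<omega>) (g \<omega>))"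
  unfolding depends_on_def by metis

lemma depends_on_mono: "depends_on S f \<Longrightarrow> S \<subseteq> T \<Longrightarrow> depends_on T f"
  unfolding depends_on_def by blast

lemma merge_conf_simps [simp]:
  "x \<in> \<Lambda> \<Longrightarrow> merge_conf \<Lambda> \<omega> \<xi> x = \<omega> x" "x \<notin> \<Lambda> \<Longrightarrow> merge_conf \<Lambda> \<omega> \<xi> x = \<xi> x"
  by (auto simp: merge_conf_def)

text \<open>There are countably many vertices, so the Borel sets of the product topology form the
  product sigma-algebra and measurability can be tested on each coordinate.\<close>

lemma measurable_merge_conf [measurable]:
  fixes \<Lambda> :: "'v::countable set"
  shows "(\<lambda>(\<omega>, \<xi>). merge_conf \<Lambda> \<omega> \<xi>) \<in> PiM \<Lambda> (\<lambda>_. lborel) \<Otimes>\<^sub>M borel \<rightarrow>\<^sub>M borel"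
proof (rule measurable_coordinatewise_then_product)
  fix x :: 'v
  have "(\<lambda>p. snd p x) \<in> borel_measurable (PiM \<Lambda> (\<lambda>_. lborel::real measure) \<Otimes>\<^sub>M (borel :: ('v \<Rightarrow> real) measure))"
    by (rule measurable_compose[OF measurable_snd measurable_product_coordinates])
  moreover have "(\<lambda>p. fst p x) \<in> borel_measurable (PiM \<Lambda> (\<lambda>_. lborel::real measure) \<Otimes>\<^sub>M (borel :: ('v \<Rightarrow> real) measure))"
    if "x \<in> \<Lambda>"
    using measurable_compose[OF measurable_fst
        measurable_component_singleton[OF that, of "\<lambda>_. lborel :: real measure"]] by simp
  ultimately show "(\<lambda>p. (case p of (\<omega>, \<xi>) \<Rightarrow> merge_conf \<Lambda> \<omega> \<xi>) x)
      \<in> borel_measurable (PiM \<Lambda> (\<lambda>_. lborel::real measure) \<Otimes>\<^sub>M (borel :: ('v \<Rightarrow> real) measure))"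
    by (cases "x \<in> \<Lambda>") (simp_all add: case_prod_beta)
qed

lemma measurable_merge_conf1 [measurable]:
  fixes \<Lambda> :: "'v::countable set"
  shows "(\<lambda>\<omega>. merge_conf \<Lambda> \<omega> \<xi>) \<in> PiM \<Lambda> (\<lambda>_. lborel) \<rightarrow>\<^sub>M borel"
proof -
  have "(\<lambda>\<omega>. (\<omega>, \<xi>)) \<in> PiM \<Lambda> (\<lambda>_. lborel) \<rightarrow>\<^sub>M PiM \<Lambda> (\<lambda>_. lborel) \<Otimes>\<^sub>M borel"
    by simp
  from measurable_compose[OF this measurable_merge_conf] show ?thesis by simp
qed

lemma measurable_merge_conf_borel [measurable]:
  fixes \<Lambda> :: "'v::countable set"
  shows "(\<lambda>\<omega>. merge_conf \<Lambda> \<omega> \<xi>) \<in> borel \<rightarrow>\<^sub>M borel"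
proof (rule measurable_coordinatewise_then_product)
  show "(\<lambda>\<omega>. merge_conf \<Lambda> \<omega> \<xi> x) \<in> borel_measurable borel" for x
    by (cases "x \<in> \<Lambda>") auto
qed

section \<open>Integrating out the spins of a finite volume\<close>

interpretation lebesgue_product: product_sigma_finite "\<lambda>_::'v. lborel :: real measure"
  by unfold_locales

text \<open>Numerator and denominator of the Gibbs kernel are both of this form. Evaluating f at the
  glued configuration keeps all volumes on the same configuration space.\<close>

definition partial_integral ::
  "'v set \<Rightarrow> (('v \<Rightarrow> real) \<Rightarrow> ennreal) \<Rightarrow> ('v \<Rightarrow> real) \<Rightarrow> ennreal" where
  "partial_integral \<Lambda> f \<xi> = (\<integral>\<^sup>+\<omega>. f (merge_conf \<Lambda> \<omega> \<xi>) \<partial>PiM \<Lambda> (\<lambda>_. lborel))"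

lemma measurable_partial_integral [measurable]:
  fixes \<Lambda> :: "'v::countable set"
  assumes "finite \<Lambda>" and [measurable]: "f \<in> borel_measurable borel"
  shows "partial_integral \<Lambda> f \<in> borel_measurable borel"
proof -
  interpret sigma_finite_measure "PiM \<Lambda> (\<lambda>_. lborel :: real measure)"
    by (rule lebesgue_product.sigma_finite) fact
  have "(\<lambda>(\<xi>, \<omega>). f (merge_conf \<Lambda> \<omega> \<xi>)) \<in> borel_measurable (borel \<Otimes>\<^sub>M PiM \<Lambda> (\<lambda>_. lborel))"
    using measurable_compose[OF measurable_pair_swap'[of borel "PiM \<Lambda> (\<lambda>_. lborel)"]
       measurable_compose[OF measurable_merge_conf assms(2)]]
    by (simp add: case_prod_beta)
  then show ?thesis
    unfolding partial_integral_def[abs_def] by (rule borel_measurable_nn_integral)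
qed

lemma depends_on_partial_integral:
  assumes "depends_on S f"
  shows "depends_on (S - \<Lambda>) (partial_integral \<Lambda> f)"
  unfolding depends_on_def partial_integral_def
proof (intro allI impI nn_integral_cong)
  fix \<omega> \<xi> \<xi>' :: "'a \<Rightarrow> real" assume "\<forall>x\<in>S - \<Lambda>. \<xi> x = \<xi>' x"
  then show "f (merge_conf \<Lambda> \<omega> \<xi>) = f (merge_conf \<Lambda> \<omega> \<xi>')"
    by (intro depends_onD[OF assms]) (auto simp: merge_conf_def)
qed

lemma partial_integral_mult_left:
  fixes f g :: "('v::countable \<Rightarrow> real) \<Rightarrow> ennreal"
  assumes g: "depends_on (- \<Lambda>) g" and [measurable]: "f \<in> borel_measurable borel"
  shows "partial_integral \<Lambda> (\<lambda>\<omega>. g \<omega> * f \<omega>) \<xi> = g \<xi> * partial_integral \<Lambda> f \<xi>"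
proof -
  have "g (merge_conf \<Lambda> \<omega> \<xi>) = g \<xi>" for \<omega>
    by (rule depends_onD[OF g]) auto
  then show ?thesis
    unfolding partial_integral_def by (simp add: nn_integral_cmult)
qed

text \<open>Tonelli's theorem with \<Delta> integrated first; this order lets the normalisation of a
  subvolume cancel in \<open>kernel_consistent\<close>.\<close>

lemma partial_integral_union:
  fixes \<Delta> \<Gamma> :: "'v::countable set"
  assumes "\<Delta> \<inter> \<Gamma> = {}" "finite \<Delta>" "finite \<Gamma>" and [measurable]: "f \<in> borel_measurable borel"
  shows "partial_integral (\<Delta> \<union> \<Gamma>) f \<xi> = partial_integral \<Gamma> (partial_integral \<Delta> f) \<xi>"
proof -
  have *: "\<Gamma> \<inter> \<Delta> = {}" using assms by auto
  have "partial_integral (\<Gamma> \<union> \<Delta>) f \<xi> = (\<integral>\<^sup>+x. \<integral>\<^sup>+y. f (merge_conf (\<Gamma> \<union> \<Delta>) (merge \<Gamma> \<Delta> (x, y)) \<xi>)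
      \<partial>PiM \<Delta> (\<lambda>_. lborel) \<partial>PiM \<Gamma> (\<lambda>_. lborel))"
    unfolding partial_integral_def
    by (rule lebesgue_product.product_nn_integral_fold[OF * \<open>finite \<Gamma>\<close> \<open>finite \<Delta>\<close>]) measurable
  moreover have "merge_conf (\<Gamma> \<union> \<Delta>) (merge \<Gamma> \<Delta> (x, y)) \<xi> = merge_conf \<Delta> y (merge_conf \<Gamma> x \<xi>)" for x y
    using * by (auto simp: merge_conf_def merge_def fun_eq_iff)
  ultimately show ?thesis
    by (simp add: partial_integral_def Un_commute)
qed

lemma partial_integral_mono:
  "(\<And>\<omega>. f \<omega> \<le> g \<omega>) \<Longrightarrow> partial_integral \<Lambda> f \<xi> \<le> partial_integral \<Lambda> g \<xi>"
  unfolding partial_integral_def by (intro nn_integral_mono) auto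

lemma partial_integral_singleton:
  fixes f :: "('v::countable \<Rightarrow> real) \<Rightarrow> ennreal"
  assumes [measurable]: "f \<in> borel_measurable borel"
  shows "partial_integral {x} f \<xi> = (\<integral>\<^sup>+u. f (\<xi>(x := u)) \<partial>lborel)"
proof -
  have [measurable]: "(\<lambda>u. \<xi>(x := u)) \<in> borel \<rightarrow>\<^sub>M borel"
  proof (rule measurable_coordinatewise_then_product)
    show "(\<lambda>u. (\<xi>(x := u)) y) \<in> borel_measurable borel" for y
      by (cases "y = x") auto
  qed
  have "merge_conf {x} \<omega> \<xi> = \<xi>(x := \<omega> x)" for \<omega>
    by (auto simp: merge_conf_def)
  then show ?thesis
    unfolding partial_integral_def
    using lebesgue_product.product_nn_integral_singleton[of "\<lambda>u. f (\<xi>(x := u))" x]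
    by simp
qed

section \<open>The model and its energy\<close>

lemma square_le_powr_plus_const:
  fixes c d \<theta> s :: real
  assumes "c \<ge> 0" "d > 0" "\<theta> > 0"
  shows "c * s\<^sup>2 \<le> d * \<bar>s\<bar> powr (2 + 2 / \<theta>) + c * (c / d) powr \<theta>"
proof (cases "s = 0")
  case False
  have sq: "\<bar>s\<bar> powr 2 = s\<^sup>2" using False by (simp add: powr_numeral)
  have split: "\<bar>s\<bar> powr (2 + 2 / \<theta>) = s\<^sup>2 * \<bar>s\<bar> powr (2 / \<theta>)"
    by (simp add: powr_add sq)
  \<comment> \<open>Young's inequality for the conjugate exponents \<open>1 + 1 / \<theta>\<close>
    and \<open>1 + \<theta>\<close>, without optimal constants: beyond the threshold the higher
    power wins, below it \<open>s\<^sup>2\<close> is at most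
    \<open>(c / d) powr \<theta>\<close>.\<close>
  show ?thesis
  proof (cases "\<bar>s\<bar> powr (2 / \<theta>) \<ge> c / d")
    case True
    then have "c \<le> d * \<bar>s\<bar> powr (2 / \<theta>)" using \<open>d > 0\<close> by (simp add: field_simps)
    from mult_right_mono[OF this zero_le_power2[of s]] have "c * s\<^sup>2 \<le> d * \<bar>s\<bar> powr (2 + 2 / \<theta>)"
      unfolding split by (simp only: mult_ac)
    moreover have "0 \<le> c * (c / d) powr \<theta>" using assms by simp
    ultimately show ?thesis by linarith
  next
    case False
    then have "(\<bar>s\<bar> powr (2 / \<theta>)) powr \<theta> \<le> (c / d) powr \<theta>"
      using assms by (intro powr_mono2) auto
    then have "s\<^sup>2 \<le> (c / d) powr \<theta>" using \<open>\<theta> > 0\<close> by (simp add: powr_powr sq)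
    then have "c * s\<^sup>2 \<le> c * (c / d) powr \<theta>" using assms by (intro mult_left_mono) auto
    then show ?thesis using \<open>d > 0\<close> by (simp add: add_increasing)
  qed
qed (use assms in auto)

lemma powr_lower_order:
  fixes a b p q :: real
  assumes "a > 0" "b \<ge> 0" "0 \<le> p" "p < q"
  obtains C where "C \<ge> 0" "\<And>s. b * \<bar>s\<bar> powr p \<le> a * \<bar>s\<bar> powr q + C"
proof
  \<comment> \<open>The two powers balance at \<open>R\<close>: beyond it the higher one dominates,
    below it the lower one is at most its value at \<open>R\<close>.\<close>
  define R where "R = (b / a) powr (1 / (q - p))"
  show "b * R powr p \<ge> 0" using assms by simp
  show "b * \<bar>s\<bar> powr p \<le> a * \<bar>s\<bar> powr q + b * R powr p" for s
  proof (cases "\<bar>s\<bar> powr (q - p) \<ge> b / a")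
    case True
    then have "b \<le> a * \<bar>s\<bar> powr (q - p)" using assms by (simp add: field_simps)
    from mult_right_mono[OF this powr_ge_zero[of "\<bar>s\<bar>" p]]
    have "b * \<bar>s\<bar> powr p \<le> a * (\<bar>s\<bar> powr (q - p) * \<bar>s\<bar> powr p)"
      by (simp only: mult.assoc)
    also have "\<bar>s\<bar> powr (q - p) * \<bar>s\<bar> powr p = \<bar>s\<bar> powr q"
      by (simp flip: powr_add)
    finally show ?thesis using assms by (simp add: add_increasing2)
  next
    case False
    then have "(\<bar>s\<bar> powr (q - p)) powr (1 / (q - p)) \<le> R"
      unfolding R_def using assms by (intro powr_mono2) auto
    then have "\<bar>s\<bar> \<le> R" using assms by (simp add: powr_powr)
    then have "\<bar>s\<bar> powr p \<le> R powr p" using assms by (intro powr_mono2) auto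
    then have "b * \<bar>s\<bar> powr p \<le> b * R powr p" using assms by (intro mult_left_mono) auto
    then show ?thesis using assms by (simp add: add_increasing)
  qed
qed

lemma square_le_1_plus_powr:
  fixes s p :: real
  assumes "p \<ge> 2"
  shows "s\<^sup>2 \<le> 1 + \<bar>s\<bar> powr p"
proof (cases "\<bar>s\<bar> \<ge> 1")
  case True
  then have "\<bar>s\<bar> powr 2 \<le> \<bar>s\<bar> powr p" using assms by (intro powr_mono) auto
  then show ?thesis using True by (simp add: powr_numeral)
next
  case False
  then have "s\<^sup>2 \<le> 1" by (simp add: abs_square_le_1)
  then show ?thesis by (simp add: add_increasing2)
qed

text \<open>Comparison with a Gaussian density. Applying \<open>powr_lower_order\<close> to
  \<open>b + 1\<close> instead of \<open>b\<close> leaves a spare factor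
  \<open>exp (- \<bar>u\<bar> powr p)\<close>, and \<open>p \<ge> 2\<close> makes this decay at
  least as fast as a Gaussian.\<close>

lemma nn_integral_exp_powr_finite:
  fixes a b p q :: real
  assumes "a > 0" "b \<ge> 0" "2 \<le> p" "p < q"
  shows "(\<integral>\<^sup>+u. ennreal (exp (b * \<bar>u\<bar> powr p - a * \<bar>u\<bar> powr q)) \<partial>lborel) < \<infinity>"
proof -
  obtain C where C: "\<And>s. (b + 1) * \<bar>s\<bar> powr p \<le> a * \<bar>s\<bar> powr q + C"
    using powr_lower_order[of a "b + 1" p q] assms by auto
  have *: "exp (b * \<bar>u\<bar> powr p - a * \<bar>u\<bar> powr q) \<le> exp (C + 1) * sqrt (2 * pi) * std_normal_density u" for u
  proof -
    have "b * \<bar>u\<bar> powr p - a * \<bar>u\<bar> powr q \<le> C - \<bar>u\<bar> powr p"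
      using C[of u] by (simp add: algebra_simps)
    also have "\<dots> \<le> C + 1 - u\<^sup>2 / 2"
      using square_le_1_plus_powr[OF assms(3), of u] zero_le_power2[of u] by linarith
    finally have "exp (b * \<bar>u\<bar> powr p - a * \<bar>u\<bar> powr q) \<le> exp (C + 1 - u\<^sup>2 / 2)" by simp
    also have "\<dots> = exp (C + 1) * sqrt (2 * pi) * std_normal_density u"
      by (simp add: std_normal_density_def flip: exp_add)
    finally show ?thesis .
  qed
  have "integrable lborel (\<lambda>u. exp (C + 1) * sqrt (2 * pi) * std_normal_density u)"
    by (intro integrable_mult_right integrable_normal_density) auto
  then have "(\<integral>\<^sup>+u. ennreal (exp (C + 1) * sqrt (2 * pi) * std_normal_density u) \<partial>lborel) < \<infinity>"
    by (subst nn_integral_eq_integral) auto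
  moreover have "(\<integral>\<^sup>+u. ennreal (exp (b * \<bar>u\<bar> powr p - a * \<bar>u\<bar> powr q)) \<partial>lborel)
     \<le> (\<integral>\<^sup>+u. ennreal (exp (C + 1) * sqrt (2 * pi) * std_normal_density u) \<partial>lborel)"
    by (intro nn_integral_mono ennreal_leI *)
  ultimately show ?thesis by (rule le_less_trans[rotated])
qed

lemma partial_integral_prod:
  fixes \<Lambda> :: "'v::countable set"
  assumes "finite \<Lambda>" "\<And>x. x \<in> \<Lambda> \<Longrightarrow> g x \<in> borel_measurable borel"
  shows "partial_integral \<Lambda> (\<lambda>\<eta>. \<Prod>x\<in>\<Lambda>. g x (\<eta> x)) \<xi> = (\<Prod>x\<in>\<Lambda>. \<integral>\<^sup>+u. g x u \<partial>lborel)"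
proof -
  have "partial_integral \<Lambda> (\<lambda>\<eta>. \<Prod>x\<in>\<Lambda>. g x (\<eta> x)) \<xi>
      = (\<integral>\<^sup>+\<omega>. (\<Prod>x\<in>\<Lambda>. g x (\<omega> x)) \<partial>PiM \<Lambda> (\<lambda>_. lborel))"
    unfolding partial_integral_def by (intro nn_integral_cong prod.cong) auto
  also have "\<dots> = (\<Prod>x\<in>\<Lambda>. \<integral>\<^sup>+u. g x u \<partial>lborel)"
    using assms by (intro lebesgue_product.product_nn_integral_prod) auto
  finally show ?thesis .
qed

section \<open>The model and its finite-volume energy\<close>

locale gibbs_model =
  fixes adj :: "'v::countable \<Rightarrow> 'v \<Rightarrow> bool"
    and r :: 'v
    and \<alpha> \<theta> q p I J a c :: real
    and W :: "real \<Rightarrow> real \<Rightarrow> real"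
    and V :: "real \<Rightarrow> real"
  assumes undirected: "undirected_graph adj"
    and conn: "connected_graph adj"
    and locfin: "locally_finite_graph adj"
    and alpha_pos: "\<alpha> > 0" and theta_pos: "\<theta> > 0"
    and Theta: "Theta_finite adj r \<alpha> \<theta>"
    and W_cont: "continuous_on UNIV (\<lambda>(u, v). W u v)"
    and W_sym: "\<And>u v. W u v = W v u"
    and I_pos: "I > 0" and J_pos: "J > 0"
    and W_bound: "\<And>u v. \<bar>W u v\<bar> \<le> (I + J * (u\<^sup>2 + v\<^sup>2)) / 2"
    and V_cont: "continuous_on UNIV V"
    and a_pos: "a > 0" and c_pos: "c > 0"
    and q_gt: "q > 2 + 2 / \<theta>"
    and V_bound: "\<And>u. V u \<ge> a * \<bar>u\<bar> powr q - c"
    and p_def: "p = 2 + 2 / \<theta>"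
begin

lemma p_gt_2: "p > 2" and p_less_q: "p < q"
  using theta_pos q_gt by (auto simp: p_def)

lemma adj_sym: "adj x y \<longleftrightarrow> adj y x" and adj_irrefl [simp]: "\<not> adj x x"
  using undirected by (auto simp: undirected_graph_def)

lemma finite_adj [simp]: "finite {y. adj x y}"
  using locfin by (simp add: locally_finite_graph_def)

definition nbhd :: "'v set \<Rightarrow> 'v set" where
  "nbhd \<Lambda> = \<Lambda> \<union> (\<Union>x\<in>\<Lambda>. {y. adj x y})"

lemma finite_nbhd [simp]: "finite \<Lambda> \<Longrightarrow> finite (nbhd \<Lambda>)"
  by (simp add: nbhd_def)

lemma subset_nbhd: "\<Lambda> \<subseteq> nbhd \<Lambda>"
  by (simp add: nbhd_def)

lemma adj_nbhd: "x \<in> \<Lambda> \<Longrightarrow> adj x y \<Longrightarrow> y \<in> nbhd \<Lambda>"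
  by (auto simp: nbhd_def)

lemma finite_inner_edges [simp]: "finite \<Lambda> \<Longrightarrow> finite {(x, y). x \<in> \<Lambda> \<and> y \<in> A \<and> adj x y}"
  and finite_outer_edges [simp]: "finite \<Lambda> \<Longrightarrow> finite {(x, y). x \<in> \<Lambda> \<and> y \<notin> A \<and> adj x y}"
  by (rule finite_subset[of _ "\<Lambda> \<times> nbhd \<Lambda>"]; use adj_nbhd in auto)+

lemma V_measurable [measurable]: "V \<in> borel_measurable borel"
  using V_cont by (rule borel_measurable_continuous_onI)

lemma W_measurable [measurable]:
  "f \<in> borel_measurable M \<Longrightarrow> g \<in> borel_measurable M \<Longrightarrow> (\<lambda>x. W (f x) (g x)) \<in> borel_measurable M"
  using borel_measurable_continuous_Pair[of f M g "\<lambda>u v. W u v"] W_cont by (simp add: case_prod_beta')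

text \<open>One configuration supplies both the spins and the boundary condition. After gluing this
  loses nothing (\<open>hamiltonian_eq_energy\<close>), and the energies of different volumes become
  functions on one space that can be subtracted.\<close>

definition energy :: "'v set \<Rightarrow> ('v \<Rightarrow> real) \<Rightarrow> real" where
  "energy \<Lambda> \<eta> = hamiltonian adj W V \<Lambda> \<eta> \<eta>"

lemma hamiltonian_eq_energy: "hamiltonian adj W V \<Lambda> \<omega> \<xi> = energy \<Lambda> (merge_conf \<Lambda> \<omega> \<xi>)"
  unfolding energy_def hamiltonian_def by (intro arg_cong2[where f="(+)"] arg_cong2[where f="(/)"] sum.cong) auto

lemma energy_measurable [measurable]: "energy \<Lambda> \<in> borel_measurable borel"
  unfolding energy_def[abs_def] hamiltonian_def case_prod_beta by measurable

lemma depends_on_energy: "depends_on (nbhd \<Lambda>) (energy \<Lambda>)"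
  unfolding depends_on_def energy_def
proof (intro allI impI)
  fix \<omega> \<omega>' :: "'v \<Rightarrow> real" assume *: "\<forall>x\<in>nbhd \<Lambda>. \<omega> x = \<omega>' x"
  have eq: "\<omega> x = \<omega>' x" if "x \<in> \<Lambda>" for x using * that subset_nbhd by blast
  have eq': "W (\<omega> x) (\<omega> y) = W (\<omega>' x) (\<omega>' y)" if "x \<in> \<Lambda>" "adj x y" for x y
    using * that adj_nbhd[OF that] eq by simp
  show "hamiltonian adj W V \<Lambda> \<omega> \<omega> = hamiltonian adj W V \<Lambda> \<omega>' \<omega>'"
    unfolding hamiltonian_def
    by (intro arg_cong2[where f="(+)"] arg_cong2[where f="(/)"] sum.cong refl) (auto simp: eq intro: eq')
qed

text \<open>A crude quadratic bound whose constant depends on the volume. It serves finiteness and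
  domination only; the estimates uniform in the volume come from
  \<open>one_site_bound\<close>.\<close>

lemma energy_bound:
  assumes "finite \<Lambda>"
  obtains C where "C \<ge> 0"
    "\<And>\<eta>. \<bar>energy \<Lambda> \<eta> - (\<Sum>x\<in>\<Lambda>. V (\<eta> x))\<bar> \<le> C * (1 + (\<Sum>y\<in>nbhd \<Lambda>. (\<eta> y)\<^sup>2))"
proof
  define A where "A = {(x,y). x \<in> \<Lambda> \<and> y \<in> \<Lambda> \<and> adj x y}"
  define B where "B = {(x,y). x \<in> \<Lambda> \<and> y \<notin> \<Lambda> \<and> adj x y}"
  define C where "C = (real (card A) + real (card B)) * (I / 2 + J)"
  show "C \<ge> 0" unfolding C_def using I_pos J_pos by simp
  fix \<eta> :: "'v \<Rightarrow> real"
  define S where "S = (\<Sum>y\<in>nbhd \<Lambda>. (\<eta> y)\<^sup>2)"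
  have S0: "S \<ge> 0" unfolding S_def by (intro sum_nonneg) auto
  have sq: "(\<eta> y)\<^sup>2 \<le> S" if "y \<in> nbhd \<Lambda>" for y
    unfolding S_def using assms that by (intro member_le_sum) auto
  have W1: "\<bar>W (\<eta> x) (\<eta> y)\<bar> \<le> (I / 2 + J) * (1 + S)" if "x \<in> \<Lambda>" "adj x y" for x y
  proof -
    have "(\<eta> x)\<^sup>2 + (\<eta> y)\<^sup>2 \<le> 2 * S"
      using sq[of x] sq[of y] that subset_nbhd[of \<Lambda>] adj_nbhd[OF that] by auto
    then have "J * ((\<eta> x)\<^sup>2 + (\<eta> y)\<^sup>2) \<le> J * (2 * S)" using J_pos by (intro mult_left_mono) auto
    then have "J * ((\<eta> x)\<^sup>2 + (\<eta> y)\<^sup>2) \<le> 2 * (J * S)" by (simp only: mult.left_commute)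
    moreover have "0 \<le> I * S" using I_pos S0 by simp
    moreover have "(I / 2 + J) * (1 + S) = I / 2 + J + (I * S) / 2 + J * S" by (simp add: algebra_simps)
    ultimately show ?thesis
      using W_bound[of "\<eta> x" "\<eta> y"] J_pos by argo
  qed
  have sumb: "\<bar>\<Sum>(x,y)\<in>E. W (\<eta> x) (\<eta> y)\<bar> \<le> real (card E) * ((I / 2 + J) * (1 + S))"
    if "E \<subseteq> {(x,y). x \<in> \<Lambda> \<and> adj x y}" for E
  proof -
    have "\<bar>\<Sum>(x,y)\<in>E. W (\<eta> x) (\<eta> y)\<bar> \<le> (\<Sum>(x,y)\<in>E. \<bar>W (\<eta> x) (\<eta> y)\<bar>)"
      by (rule order_trans[OF sum_abs]) (simp add: case_prod_beta)
    also have "\<dots> \<le> (\<Sum>(x,y)\<in>E. (I / 2 + J) * (1 + S))"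
      using that by (intro sum_mono) (auto intro!: W1)
    finally show ?thesis by simp
  qed
  have "\<bar>energy \<Lambda> \<eta> - (\<Sum>x\<in>\<Lambda>. V (\<eta> x))\<bar>
      = \<bar>(\<Sum>(x,y)\<in>A. W (\<eta> x) (\<eta> y)) / 2 + (\<Sum>(x,y)\<in>B. W (\<eta> x) (\<eta> y))\<bar>"
    by (simp add: energy_def hamiltonian_def A_def B_def)
  also have "\<dots> \<le> \<bar>\<Sum>(x,y)\<in>A. W (\<eta> x) (\<eta> y)\<bar> + \<bar>\<Sum>(x,y)\<in>B. W (\<eta> x) (\<eta> y)\<bar>" by linarith
  also have "\<dots> \<le> real (card A) * ((I / 2 + J) * (1 + S)) + real (card B) * ((I / 2 + J) * (1 + S))"
    by (intro add_mono sumb) (auto simp: A_def B_def)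
  also have "\<dots> = C * (1 + S)" by (simp add: C_def algebra_simps)
  finally show "\<bar>energy \<Lambda> \<eta> - (\<Sum>x\<in>\<Lambda>. V (\<eta> x))\<bar> \<le> C * (1 + (\<Sum>y\<in>nbhd \<Lambda>. (\<eta> y)\<^sup>2))"
    by (simp add: S_def)
qed

text \<open>All terms containing a spin of \<Delta> occur with the same coefficient in both
  energies, so they cancel. This is the source of the consistency of the kernels.\<close>

lemma energy_diff:
  assumes "finite \<Lambda>" "\<Delta> \<subseteq> \<Lambda>"
  shows "depends_on (- \<Delta>) (\<lambda>\<eta>. energy \<Lambda> \<eta> - energy \<Delta> \<eta>)"
proof -
  define \<Gamma> where "\<Gamma> = \<Lambda> - \<Delta>"
  have fin: "finite \<Delta>" "finite \<Gamma>" using assms finite_subset by (auto simp: \<Gamma>_def)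
  define S where "S A B \<eta> = (\<Sum>(x,y)\<in>{(x,y). x \<in> A \<and> y \<in> B \<and> adj x y}. W (\<eta> x) (\<eta> y))"
    for A B and \<eta> :: "'v \<Rightarrow> real"
  have S_Un1: "S (A \<union> A') B \<eta> = S A B \<eta> + S A' B \<eta>" if "A \<inter> A' = {}" "finite A" "finite A'" for A A' B \<eta>
  proof -
    have "{(x,y). x \<in> A \<union> A' \<and> y \<in> B \<and> adj x y}
        = {(x,y). x \<in> A \<and> y \<in> B \<and> adj x y} \<union> {(x,y). x \<in> A' \<and> y \<in> B \<and> adj x y}" by auto
    then show ?thesis unfolding S_def using that by (auto intro!: sum.union_disjoint)
  qed
  have S_Un2: "S A (B \<union> B') \<eta> = S A B \<eta> + S A B' \<eta>" if "B \<inter> B' = {}" "finite A" for A B B' \<eta>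
  proof -
    have "{(x,y). x \<in> A \<and> y \<in> B \<union> B' \<and> adj x y}
        = {(x,y). x \<in> A \<and> y \<in> B \<and> adj x y} \<union> {(x,y). x \<in> A \<and> y \<in> B' \<and> adj x y}" by auto
    then show ?thesis unfolding S_def using that by (auto intro!: sum.union_disjoint)
  qed
  have S_sym: "S A B \<eta> = S B A \<eta>" for A B \<eta>
    unfolding S_def
    by (rule sum.reindex_bij_witness[of _ "\<lambda>(x,y). (y,x)" "\<lambda>(x,y). (y,x)"]) (auto simp: adj_sym W_sym)
  have dep: "depends_on (A \<union> B) (S A B)" for A B
    unfolding depends_on_def S_def by (auto intro!: sum.cong)
  have en: "energy \<Lambda> \<eta> = S \<Lambda> \<Lambda> \<eta> / 2 + S \<Lambda> (- \<Lambda>) \<eta> + (\<Sum>x\<in>\<Lambda>. V (\<eta> x))" for \<Lambda> \<eta>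
    by (simp add: energy_def hamiltonian_def S_def)
  have L: "\<Lambda> = \<Delta> \<union> \<Gamma>" "\<Delta> \<inter> \<Gamma> = {}" "- \<Delta> = \<Gamma> \<union> - \<Lambda>" "\<Gamma> \<inter> - \<Lambda> = {}" using assms by (auto simp: \<Gamma>_def)
  have "energy \<Lambda> \<eta> - energy \<Delta> \<eta> = S \<Gamma> \<Gamma> \<eta> / 2 + S \<Gamma> (- \<Lambda>) \<eta> + (\<Sum>x\<in>\<Gamma>. V (\<eta> x))" for \<eta>
  proof -
    \<comment> \<open>An edge between \<Delta> and \<Gamma> occurs in both orders in the inner sum
      of \<Lambda>, so after halving it equals the boundary term of \<Delta>.\<close>
    have 1: "S \<Lambda> \<Lambda> \<eta> = S \<Delta> \<Delta> \<eta> + 2 * S \<Delta> \<Gamma> \<eta> + S \<Gamma> \<Gamma> \<eta>"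
      unfolding L(1) using L(2) fin by (simp add: S_Un1 S_Un2 S_sym[of \<Gamma> \<Delta>])
    have 2: "S \<Delta> (- \<Delta>) \<eta> = S \<Delta> \<Gamma> \<eta> + S \<Delta> (- \<Lambda>) \<eta>"
      unfolding L(3) using L(4) fin by (simp add: S_Un2)
    have 3: "S \<Lambda> (- \<Lambda>) \<eta> = S \<Delta> (- \<Lambda>) \<eta> + S \<Gamma> (- \<Lambda>) \<eta>"
      using S_Un1[OF L(2) fin, of "-\<Lambda>" \<eta>] L(1) by simp
    have 4: "(\<Sum>x\<in>\<Lambda>. V (\<eta> x)) = (\<Sum>x\<in>\<Delta>. V (\<eta> x)) + (\<Sum>x\<in>\<Gamma>. V (\<eta> x))"
      unfolding L(1) using L(2) fin by (intro sum.union_disjoint) auto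
    show ?thesis unfolding en 1 2 3 4 by argo
  qed
  moreover have "depends_on (- \<Delta>) (\<lambda>\<eta>. S \<Gamma> \<Gamma> \<eta> / 2 + S \<Gamma> (- \<Lambda>) \<eta> + (\<Sum>x\<in>\<Gamma>. V (\<eta> x)))"
  proof -
    have sub: "\<Gamma> \<union> \<Gamma> \<subseteq> - \<Delta>" "\<Gamma> \<union> - \<Lambda> \<subseteq> - \<Delta>" using assms by (auto simp: \<Gamma>_def)
    have "depends_on (- \<Delta>) (\<lambda>\<eta>. \<Sum>x\<in>\<Gamma>. V (\<eta> x))"
      unfolding depends_on_def using sub by (auto intro!: sum.cong)
    then show ?thesis
      by (intro depends_on_compose2[where h="(+)"] depends_on_compose[where g="\<lambda>s. s / 2"]
          depends_on_mono[OF dep sub(1)] depends_on_mono[OF dep sub(2)])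
  qed
  ultimately show ?thesis by simp
qed

end

section \<open>Finite-volume Gibbs kernels\<close>

lemma inverse_antimono_ennreal: "x \<le> y \<Longrightarrow> inverse y \<le> inverse (x :: ennreal)"
proof (cases "x = 0 \<or> y = top")
  case False
  assume "x \<le> y"
  with False obtain s t where "x = ennreal s" "y = ennreal t" "0 < s" "s \<le> t"
    by (cases x; cases y) (auto simp: top_unique)
  then show ?thesis by (auto simp: inverse_ennreal intro!: ennreal_leI le_imp_inverse_le)
qed auto

context gibbs_model
begin

definition boltzmann :: "'v set \<Rightarrow> ('v \<Rightarrow> real) \<Rightarrow> ennreal" where
  "boltzmann \<Lambda> \<eta> = ennreal (exp (- energy \<Lambda> \<eta>))"

definition partition_fun :: "'v set \<Rightarrow> ('v \<Rightarrow> real) \<Rightarrow> ennreal" where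
  "partition_fun \<Lambda> = partial_integral \<Lambda> (boltzmann \<Lambda>)"

definition boundary_sq :: "'v set \<Rightarrow> ('v \<Rightarrow> real) \<Rightarrow> real" where
  "boundary_sq \<Lambda> \<xi> = (\<Sum>y\<in>nbhd \<Lambda> - \<Lambda>. (\<xi> y)\<^sup>2)"

text \<open>The weight of one spin once the interaction is replaced by a quadratic bound and
  \<open>V\<close> by its lower bound \<open>a * \<bar>u\<bar> powr q - c\<close>.\<close>

definition site_bound :: "real \<Rightarrow> real \<Rightarrow> ennreal" where
  "site_bound C u = ennreal (exp (C * u\<^sup>2 + c - a * \<bar>u\<bar> powr q))"

lemma boltzmann_measurable [measurable]: "boltzmann \<Lambda> \<in> borel_measurable borel"
  unfolding boltzmann_def[abs_def] by measurable

lemma site_bound_measurable [measurable]: "site_bound C \<in> borel_measurable borel"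
  unfolding site_bound_def[abs_def] by measurable

lemma partition_fun_measurable [measurable]: "finite \<Lambda> \<Longrightarrow> partition_fun \<Lambda> \<in> borel_measurable borel"
  unfolding partition_fun_def by measurable

lemma boundary_sq_measurable [measurable]: "boundary_sq \<Lambda> \<in> borel_measurable borel"
  unfolding boundary_sq_def[abs_def] by measurable

lemma boundary_sq_nonneg: "boundary_sq \<Lambda> \<xi> \<ge> 0"
  unfolding boundary_sq_def by (intro sum_nonneg) auto

lemma depends_on_boundary_sq: "depends_on (- \<Lambda>) (boundary_sq \<Lambda>)"
  unfolding depends_on_def boundary_sq_def by (auto intro!: sum.cong)

text \<open>Bounding the interaction by squares decouples the spins: what remains is a product over
  sites times a boundary factor that can be pulled out of \<open>partial_integral\<close>. The lower
  bound retains \<open>V\<close>, which has no explicit upper bound.\<close>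

lemma boltzmann_bounds:
  assumes "finite \<Lambda>"
  obtains C where "C \<ge> 0"
    "\<And>\<eta>. boltzmann \<Lambda> \<eta> \<le> ennreal (exp (C * (1 + boundary_sq \<Lambda> \<eta>))) * (\<Prod>x\<in>\<Lambda>. site_bound C (\<eta> x))"
    "\<And>\<eta>. ennreal (exp (- C * (1 + boundary_sq \<Lambda> \<eta>))) * (\<Prod>x\<in>\<Lambda>. ennreal (exp (- C * (\<eta> x)\<^sup>2 - V (\<eta> x))))
        \<le> boltzmann \<Lambda> \<eta>"
proof -
  obtain C where C: "C \<ge> 0"
    and bd: "\<And>\<eta>. \<bar>energy \<Lambda> \<eta> - (\<Sum>x\<in>\<Lambda>. V (\<eta> x))\<bar> \<le> C * (1 + (\<Sum>y\<in>nbhd \<Lambda>. (\<eta> y)\<^sup>2))"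
    using energy_bound[OF assms] by blast
  have split: "(\<Sum>y\<in>nbhd \<Lambda>. (\<eta> y)\<^sup>2) = (\<Sum>y\<in>\<Lambda>. (\<eta> y)\<^sup>2) + boundary_sq \<Lambda> \<eta>" for \<eta> :: "'v \<Rightarrow> real"
    unfolding boundary_sq_def using sum.subset_diff[OF subset_nbhd finite_nbhd[OF assms]] by (simp add: add.commute)
  show thesis
  proof (rule that[OF C])
    fix \<eta> :: "'v \<Rightarrow> real"
    have "- energy \<Lambda> \<eta> \<le> C * (1 + boundary_sq \<Lambda> \<eta>) + (\<Sum>x\<in>\<Lambda>. C * (\<eta> x)\<^sup>2 - V (\<eta> x))"
      using bd[of \<eta>] by (simp add: split sum_subtractf sum_distrib_left[symmetric] algebra_simps)
    also have "\<dots> \<le> C * (1 + boundary_sq \<Lambda> \<eta>) + (\<Sum>x\<in>\<Lambda>. C * (\<eta> x)\<^sup>2 + c - a * \<bar>\<eta> x\<bar> powr q)"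
      using V_bound by (intro add_left_mono sum_mono) (auto simp: algebra_simps)
    finally have "exp (- energy \<Lambda> \<eta>) \<le> exp (C * (1 + boundary_sq \<Lambda> \<eta>)) * (\<Prod>x\<in>\<Lambda>. exp (C * (\<eta> x)\<^sup>2 + c - a * \<bar>\<eta> x\<bar> powr q))"
      using assms by (simp flip: exp_add exp_sum)
    from ennreal_leI[OF this]
    show "boltzmann \<Lambda> \<eta> \<le> ennreal (exp (C * (1 + boundary_sq \<Lambda> \<eta>))) * (\<Prod>x\<in>\<Lambda>. site_bound C (\<eta> x))"
      by (simp add: boltzmann_def site_bound_def prod_ennreal ennreal_mult prod_nonneg)
    have "- C * (1 + boundary_sq \<Lambda> \<eta>) + (\<Sum>x\<in>\<Lambda>. - C * (\<eta> x)\<^sup>2 - V (\<eta> x)) \<le> - energy \<Lambda> \<eta>"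
      using bd[of \<eta>] by (simp add: split sum_subtractf sum_negf sum_distrib_left[symmetric] algebra_simps)
    then have "exp (- C * (1 + boundary_sq \<Lambda> \<eta>)) * (\<Prod>x\<in>\<Lambda>. exp (- C * (\<eta> x)\<^sup>2 - V (\<eta> x))) \<le> exp (- energy \<Lambda> \<eta>)"
      using assms by (simp flip: exp_add exp_sum)
    from ennreal_leI[OF this]
    show "ennreal (exp (- C * (1 + boundary_sq \<Lambda> \<eta>))) * (\<Prod>x\<in>\<Lambda>. ennreal (exp (- C * (\<eta> x)\<^sup>2 - V (\<eta> x))))
        \<le> boltzmann \<Lambda> \<eta>"
      by (simp add: boltzmann_def prod_ennreal ennreal_mult prod_nonneg)
  qed
qed

text \<open>Upper control of \<open>V\<close> near 0 is enough for bounding partition functions from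
  below: restricting each spin to a unit interval only decreases the integral.\<close>

lemma V_bounded_near_0:
  obtains v where "\<And>u. u \<in> {-1..1} \<Longrightarrow> \<bar>V u\<bar> \<le> v"
proof -
  have "compact (V ` {-1..1})"
    using V_cont by (intro compact_continuous_image) (auto intro: continuous_on_subset)
  then obtain v where "\<forall>y\<in>V ` {-1..1}. norm y \<le> v" using compact_imp_bounded bounded_iff by metis
  then show thesis by (intro that[of v]) auto
qed

lemma site_integral_lower:
  assumes v: "\<And>u. u \<in> {-1..1} \<Longrightarrow> \<bar>V u\<bar> \<le> v" and "C \<ge> 0"
  shows "ennreal (exp (- C - v)) \<le> (\<integral>\<^sup>+u. ennreal (exp (- C * u\<^sup>2 - V u)) \<partial>lborel)"
proof -
  have "ennreal (exp (- C - v)) = (\<integral>\<^sup>+u. ennreal (exp (- C - v)) * indicator {0..1::real} u \<partial>lborel)"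
    by (simp add: nn_integral_cmult_indicator)
  also have "\<dots> \<le> (\<integral>\<^sup>+u. ennreal (exp (- C * u\<^sup>2 - V u)) \<partial>lborel)"
  proof (intro nn_integral_mono)
    fix u :: real
    show "ennreal (exp (- C - v)) * indicator {0..1} u \<le> ennreal (exp (- C * u\<^sup>2 - V u))"
    proof (cases "u \<in> {0..1}")
      case True
      then have "u\<^sup>2 \<le> 1" by (auto intro: power_le_one)
      then have "C * u\<^sup>2 \<le> C * 1" using \<open>C \<ge> 0\<close> by (intro mult_left_mono) auto
      moreover have "V u \<le> v" using v[of u] True by auto
      ultimately show ?thesis using True by (auto intro!: ennreal_leI)
    qed simp
  qed
  finally show ?thesis .
qed

lemma site_bound_integral_finite:
  assumes "C \<ge> 0" "b \<ge> 0"
  shows "(\<integral>\<^sup>+u. ennreal (exp (b * \<bar>u\<bar> powr p)) * site_bound C u \<partial>lborel) < \<infinity>"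
proof -
  have "(\<integral>\<^sup>+u. ennreal (exp (b * \<bar>u\<bar> powr p)) * site_bound C u \<partial>lborel)
     \<le> (\<integral>\<^sup>+u. ennreal (exp (C + c)) * ennreal (exp ((b + C) * \<bar>u\<bar> powr p - a * \<bar>u\<bar> powr q)) \<partial>lborel)"
  proof (intro nn_integral_mono)
    fix u :: real
    have "C * u\<^sup>2 \<le> C * (1 + \<bar>u\<bar> powr p)"
      using square_le_1_plus_powr[of p u] p_gt_2 \<open>C \<ge> 0\<close> by (intro mult_left_mono) auto
    then have "exp (b * \<bar>u\<bar> powr p) * exp (C * u\<^sup>2 + c - a * \<bar>u\<bar> powr q)
        \<le> exp (C + c) * exp ((b + C) * \<bar>u\<bar> powr p - a * \<bar>u\<bar> powr q)"
      by (simp flip: exp_add add: algebra_simps)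
    then show "ennreal (exp (b * \<bar>u\<bar> powr p)) * site_bound C u
        \<le> ennreal (exp (C + c)) * ennreal (exp ((b + C) * \<bar>u\<bar> powr p - a * \<bar>u\<bar> powr q))"
      by (simp add: site_bound_def flip: ennreal_mult)
  qed
  also have "\<dots> = ennreal (exp (C + c)) * (\<integral>\<^sup>+u. ennreal (exp ((b + C) * \<bar>u\<bar> powr p - a * \<bar>u\<bar> powr q)) \<partial>lborel)"
    by (intro nn_integral_cmult) auto
  also have "\<dots> < \<infinity>"
    using nn_integral_exp_powr_finite[OF a_pos, of "b + C" p q] p_gt_2 p_less_q assms
    by (auto simp: ennreal_mult_less_top)
  finally show ?thesis .
qed

lemma partition_fun_lower:
  assumes fin: "finite \<Lambda>"
  obtains C where "C \<ge> 0" "\<And>\<xi>. ennreal (exp (- C * (1 + boundary_sq \<Lambda> \<xi>))) \<le> partition_fun \<Lambda> \<xi>"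
proof -
  obtain C where C: "C \<ge> 0"
    and "\<And>\<eta>. boltzmann \<Lambda> \<eta> \<le> ennreal (exp (C * (1 + boundary_sq \<Lambda> \<eta>))) * (\<Prod>x\<in>\<Lambda>. site_bound C (\<eta> x))"
    and lower: "\<And>\<eta>. ennreal (exp (- C * (1 + boundary_sq \<Lambda> \<eta>))) * (\<Prod>x\<in>\<Lambda>. ennreal (exp (- C * (\<eta> x)\<^sup>2 - V (\<eta> x))))
        \<le> boltzmann \<Lambda> \<eta>"
    using boltzmann_bounds[OF fin] by blast
  obtain v where v: "\<And>u. u \<in> {-1..1} \<Longrightarrow> \<bar>V u\<bar> \<le> v" using V_bounded_near_0 by blast
  have v0: "v \<ge> 0" using v[of 0] by auto
  \<comment> \<open>Each site contributes a factor \<open>exp (- C - v)\<close>; all of them fit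
    into one constant because \<open>1 + boundary_sq\<close> is at least 1.\<close>
  define D where "D = C + (C + v) * card \<Lambda>"
  show thesis
  proof (rule that[of D])
    show "D \<ge> 0" unfolding D_def using C v0 by simp
    fix \<xi> :: "'v \<Rightarrow> real"
    have "- D * (1 + boundary_sq \<Lambda> \<xi>) \<le> - C * (1 + boundary_sq \<Lambda> \<xi>) + - (C + v) * card \<Lambda>"
    proof -
      have "0 \<le> (C + v) * card \<Lambda> * boundary_sq \<Lambda> \<xi>" using C v0 boundary_sq_nonneg by simp
      then show ?thesis by (simp add: D_def algebra_simps)
    qed
    then have "ennreal (exp (- D * (1 + boundary_sq \<Lambda> \<xi>)))
        \<le> ennreal (exp (- C * (1 + boundary_sq \<Lambda> \<xi>)) * exp (- C - v) ^ card \<Lambda>)"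
      by (intro ennreal_leI) (simp flip: exp_add exp_of_nat_mult add: algebra_simps)
    also have "\<dots> = ennreal (exp (- C * (1 + boundary_sq \<Lambda> \<xi>))) * (\<Prod>x\<in>\<Lambda>. ennreal (exp (- C - v)))"
      by (simp add: ennreal_mult flip: ennreal_power)
    also have "\<dots> \<le> ennreal (exp (- C * (1 + boundary_sq \<Lambda> \<xi>))) *
        (\<Prod>x\<in>\<Lambda>. \<integral>\<^sup>+u. ennreal (exp (- C * u\<^sup>2 - V u)) \<partial>lborel)"
      by (intro mult_left_mono prod_mono_ennreal site_integral_lower v C) auto
    also have "\<dots> = ennreal (exp (- C * (1 + boundary_sq \<Lambda> \<xi>))) *
        partial_integral \<Lambda> (\<lambda>\<eta>. \<Prod>x\<in>\<Lambda>. ennreal (exp (- C * (\<eta> x)\<^sup>2 - V (\<eta> x)))) \<xi>"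
      by (subst partial_integral_prod[OF fin]) auto
    also have "\<dots> = partial_integral \<Lambda> (\<lambda>\<eta>. ennreal (exp (- C * (1 + boundary_sq \<Lambda> \<eta>))) *
        (\<Prod>x\<in>\<Lambda>. ennreal (exp (- C * (\<eta> x)\<^sup>2 - V (\<eta> x))))) \<xi>"
      by (rule partial_integral_mult_left[OF depends_on_compose[OF depends_on_boundary_sq,
            where g="\<lambda>b. ennreal (exp (- C * (1 + b)))"], symmetric]) measurable
    also have "\<dots> \<le> partition_fun \<Lambda> \<xi>"
      unfolding partition_fun_def by (intro partial_integral_mono lower)
    finally show "ennreal (exp (- D * (1 + boundary_sq \<Lambda> \<xi>))) \<le> partition_fun \<Lambda> \<xi>" .
  qed
qed

lemma partial_integral_site_bound_finite:
  fixes \<Lambda> :: "'v set"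
  assumes "finite \<Lambda>" "C \<ge> 0" "b \<ge> 0"
  shows "partial_integral \<Lambda> (\<lambda>\<eta>. \<Prod>x\<in>\<Lambda>. ennreal (exp (b * \<bar>\<eta> x\<bar> powr p)) * site_bound C (\<eta> x)) \<xi> < \<infinity>"
proof -
  have "(\<integral>\<^sup>+u. ennreal (exp (b * \<bar>u\<bar> powr p)) * site_bound C u \<partial>lborel) ^ card \<Lambda> < \<infinity>"
    using site_bound_integral_finite[OF assms(2,3)] by (simp add: power_less_top_ennreal)
  moreover have "partial_integral \<Lambda> (\<lambda>\<eta>. \<Prod>x\<in>\<Lambda>. ennreal (exp (b * \<bar>\<eta> x\<bar> powr p)) * site_bound C (\<eta> x)) \<xi>
      = (\<Prod>x\<in>\<Lambda>. \<integral>\<^sup>+u. ennreal (exp (b * \<bar>u\<bar> powr p)) * site_bound C u \<partial>lborel)"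
    by (rule partial_integral_prod[OF \<open>finite \<Lambda>\<close>]) measurable
  ultimately show ?thesis by simp
qed

text \<open>The upper bound on the Boltzmann factor is divided by the lower bound on the partition
  function. The boundary condition then acts on the spins inside only through one scalar factor, and
  the dominating product weight does not depend on it.\<close>

lemma kernel_domination:
  assumes fin: "finite \<Lambda>"
  obtains C where "C \<ge> 0"
    "\<And>f \<xi>. f \<in> borel_measurable borel \<Longrightarrow> partial_integral \<Lambda> (\<lambda>\<eta>. f \<eta> * boltzmann \<Lambda> \<eta>) \<xi> / partition_fun \<Lambda> \<xi>
       \<le> ennreal (exp (C * (1 + boundary_sq \<Lambda> \<xi>))) * partial_integral \<Lambda> (\<lambda>\<eta>. f \<eta> * (\<Prod>x\<in>\<Lambda>. site_bound C (\<eta> x))) \<xi>"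
proof -
  obtain C where C: "C \<ge> 0"
    and upper: "\<And>\<eta>. boltzmann \<Lambda> \<eta> \<le> ennreal (exp (C * (1 + boundary_sq \<Lambda> \<eta>))) * (\<Prod>x\<in>\<Lambda>. site_bound C (\<eta> x))"
    and "\<And>\<eta>. ennreal (exp (- C * (1 + boundary_sq \<Lambda> \<eta>))) * (\<Prod>x\<in>\<Lambda>. ennreal (exp (- C * (\<eta> x)\<^sup>2 - V (\<eta> x))))
        \<le> boltzmann \<Lambda> \<eta>"
    using boltzmann_bounds[OF fin] by blast
  obtain D where D: "D \<ge> 0" and lower: "\<And>\<xi>. ennreal (exp (- D * (1 + boundary_sq \<Lambda> \<xi>))) \<le> partition_fun \<Lambda> \<xi>"
    using partition_fun_lower[OF fin] by blast
  show thesis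
  proof (rule that[of "C + D"])
    show "C + D \<ge> 0" using C D by simp
    fix f :: "('v \<Rightarrow> real) \<Rightarrow> ennreal" and \<xi> assume [measurable]: "f \<in> borel_measurable borel"
    let ?b = "boundary_sq \<Lambda> \<xi>"
    have sb: "site_bound C u \<le> site_bound (C + D) u" for u
      unfolding site_bound_def using D by (intro ennreal_leI) (simp add: algebra_simps)
    have "partial_integral \<Lambda> (\<lambda>\<eta>. f \<eta> * boltzmann \<Lambda> \<eta>) \<xi>
      \<le> partial_integral \<Lambda> (\<lambda>\<eta>. ennreal (exp (C * (1 + boundary_sq \<Lambda> \<eta>))) * (f \<eta> * (\<Prod>x\<in>\<Lambda>. site_bound (C + D) (\<eta> x)))) \<xi>"
    proof (intro partial_integral_mono)
      fix \<eta> :: "'v \<Rightarrow> real"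
      have "f \<eta> * boltzmann \<Lambda> \<eta> \<le> f \<eta> * (ennreal (exp (C * (1 + boundary_sq \<Lambda> \<eta>))) * (\<Prod>x\<in>\<Lambda>. site_bound (C + D) (\<eta> x)))"
        by (intro mult_left_mono order_trans[OF upper] prod_mono_ennreal sb) auto
      then show "f \<eta> * boltzmann \<Lambda> \<eta> \<le> ennreal (exp (C * (1 + boundary_sq \<Lambda> \<eta>))) * (f \<eta> * (\<Prod>x\<in>\<Lambda>. site_bound (C + D) (\<eta> x)))"
        by (simp only: mult_ac)
    qed
    also have "\<dots> = ennreal (exp (C * (1 + ?b))) * partial_integral \<Lambda> (\<lambda>\<eta>. f \<eta> * (\<Prod>x\<in>\<Lambda>. site_bound (C + D) (\<eta> x))) \<xi>"
      (is "_ = _ * ?X")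
      by (rule partial_integral_mult_left[OF depends_on_compose[OF depends_on_boundary_sq,
            where g="\<lambda>b. ennreal (exp (C * (1 + b)))"]]) measurable
    finally have "partial_integral \<Lambda> (\<lambda>\<eta>. f \<eta> * boltzmann \<Lambda> \<eta>) \<xi> / partition_fun \<Lambda> \<xi>
        \<le> (ennreal (exp (C * (1 + ?b))) * ?X) / ennreal (exp (- D * (1 + ?b)))"
      unfolding divide_ennreal_def by (intro mult_mono inverse_antimono_ennreal lower) auto
    also have "\<dots> = ennreal (exp ((C + D) * (1 + ?b))) * ?X"
    proof -
      have "inverse (ennreal (exp (- D * (1 + ?b)))) = ennreal (exp (D * (1 + ?b)))"
        by (simp add: inverse_ennreal exp_minus[symmetric])
      then have "(ennreal (exp (C * (1 + ?b))) * ?X) / ennreal (exp (- D * (1 + ?b)))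
          = (ennreal (exp (C * (1 + ?b))) * ennreal (exp (D * (1 + ?b)))) * ?X"
        by (simp only: divide_ennreal_def mult_ac)
      also have "ennreal (exp (C * (1 + ?b))) * ennreal (exp (D * (1 + ?b))) = ennreal (exp ((C + D) * (1 + ?b)))"
        by (simp flip: ennreal_mult exp_add add: algebra_simps)
      finally show ?thesis .
    qed
    finally show "partial_integral \<Lambda> (\<lambda>\<eta>. f \<eta> * boltzmann \<Lambda> \<eta>) \<xi> / partition_fun \<Lambda> \<xi>
       \<le> ennreal (exp ((C + D) * (1 + ?b))) * ?X" .
  qed
qed

lemma partition_fun_pos: "finite \<Lambda> \<Longrightarrow> partition_fun \<Lambda> \<xi> > 0"
  using partition_fun_lower[of \<Lambda>] by (metis exp_gt_zero ennreal_less_zero_iff order_less_le_trans)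

lemma partition_fun_finite:
  assumes fin: "finite \<Lambda>" shows "partition_fun \<Lambda> \<xi> < \<infinity>"
proof -
  obtain C where C: "C \<ge> 0"
    and upper: "\<And>\<eta>. boltzmann \<Lambda> \<eta> \<le> ennreal (exp (C * (1 + boundary_sq \<Lambda> \<eta>))) * (\<Prod>x\<in>\<Lambda>. site_bound C (\<eta> x))"
    and "\<And>\<eta>. ennreal (exp (- C * (1 + boundary_sq \<Lambda> \<eta>))) * (\<Prod>x\<in>\<Lambda>. ennreal (exp (- C * (\<eta> x)\<^sup>2 - V (\<eta> x))))
        \<le> boltzmann \<Lambda> \<eta>"
    using boltzmann_bounds[OF fin] by blast
  have "partition_fun \<Lambda> \<xi> \<le> partial_integral \<Lambda> (\<lambda>\<eta>. ennreal (exp (C * (1 + boundary_sq \<Lambda> \<eta>))) * (\<Prod>x\<in>\<Lambda>. site_bound C (\<eta> x))) \<xi>"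
    unfolding partition_fun_def by (intro partial_integral_mono upper)
  also have "\<dots> = ennreal (exp (C * (1 + boundary_sq \<Lambda> \<xi>))) * partial_integral \<Lambda> (\<lambda>\<eta>. \<Prod>x\<in>\<Lambda>. site_bound C (\<eta> x)) \<xi>"
    by (rule partial_integral_mult_left[OF depends_on_compose[OF depends_on_boundary_sq,
          where g="\<lambda>b. ennreal (exp (C * (1 + b)))"]]) measurable
  also have "\<dots> < \<infinity>"
    using partial_integral_site_bound_finite[OF fin C, of 0 \<xi>] by (simp add: ennreal_mult_less_top)
  finally show ?thesis .
qed

section \<open>The kernels as probability measures and their consistency\<close>

definition kernel :: "'v set \<Rightarrow> ('v \<Rightarrow> real) \<Rightarrow> ('v \<Rightarrow> real) measure" where
  "kernel \<Lambda> \<xi> = distr (density (PiM \<Lambda> (\<lambda>_. lborel))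
      (\<lambda>\<omega>. boltzmann \<Lambda> (merge_conf \<Lambda> \<omega> \<xi>) / partition_fun \<Lambda> \<xi>)) borel (\<lambda>\<omega>. merge_conf \<Lambda> \<omega> \<xi>)"

lemma sets_kernel [simp, measurable_cong]: "sets (kernel \<Lambda> \<xi>) = sets borel"
  and space_kernel [simp]: "space (kernel \<Lambda> \<xi>) = UNIV"
  by (simp_all add: kernel_def)

lemma nn_integral_kernel:
  assumes [measurable]: "f \<in> borel_measurable borel"
  shows "(\<integral>\<^sup>+\<eta>. f \<eta> \<partial>kernel \<Lambda> \<xi>) = partial_integral \<Lambda> (\<lambda>\<eta>. f \<eta> * boltzmann \<Lambda> \<eta>) \<xi> / partition_fun \<Lambda> \<xi>"
proof -
  have "(\<integral>\<^sup>+\<eta>. f \<eta> \<partial>kernel \<Lambda> \<xi>) = (\<integral>\<^sup>+\<omega>. (f (merge_conf \<Lambda> \<omega> \<xi>) * boltzmann \<Lambda> (merge_conf \<Lambda> \<omega> \<xi>)) / partition_fun \<Lambda> \<xi>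
      \<partial>PiM \<Lambda> (\<lambda>_. lborel))"
    unfolding kernel_def
    by (simp add: nn_integral_distr nn_integral_density divide_ennreal_def mult_ac)
  then show ?thesis
    unfolding partial_integral_def by (subst (asm) nn_integral_divide) auto
qed

lemma emeasure_kernel:
  assumes "A \<in> sets borel"
  shows "emeasure (kernel \<Lambda> \<xi>) A = gibbs_kernel adj W V \<Lambda> A \<xi>"
  using nn_integral_kernel[of "indicator A" \<Lambda> \<xi>] assms
  by (simp add: gibbs_kernel_def partial_integral_def partition_fun_def boltzmann_def hamiltonian_eq_energy)

lemma prob_space_kernel:
  assumes "finite \<Lambda>" shows "prob_space (kernel \<Lambda> \<xi>)"
proof
  have "emeasure (kernel \<Lambda> \<xi>) (space (kernel \<Lambda> \<xi>)) = (\<integral>\<^sup>+\<eta>. 1 \<partial>kernel \<Lambda> \<xi>)" by simp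
  also have "\<dots> = partition_fun \<Lambda> \<xi> / partition_fun \<Lambda> \<xi>"
    by (subst nn_integral_kernel) (auto simp: partition_fun_def)
  also have "\<dots> = 1"
    using partition_fun_pos[OF assms, of \<xi>] partition_fun_finite[OF assms, of \<xi>] by (intro ennreal_divide_self) auto
  finally show "emeasure (kernel \<Lambda> \<xi>) (space (kernel \<Lambda> \<xi>)) = 1" .
qed

lemma nn_integral_kernel_measurable [measurable]:
  assumes [simp]: "finite \<Lambda>" and [measurable]: "f \<in> borel_measurable borel"
  shows "(\<lambda>\<xi>. \<integral>\<^sup>+\<eta>. f \<eta> \<partial>kernel \<Lambda> \<xi>) \<in> borel_measurable borel"
  by (subst nn_integral_kernel) measurable

lemma depends_on_kernel:
  assumes "depends_on S f" "f \<in> borel_measurable borel"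
  shows "depends_on (S \<union> nbhd \<Lambda>) (\<lambda>\<xi>. \<integral>\<^sup>+\<eta>. f \<eta> \<partial>kernel \<Lambda> \<xi>)"
proof -
  have B: "depends_on (nbhd \<Lambda>) (boltzmann \<Lambda>)"
    unfolding boltzmann_def[abs_def] by (rule depends_on_compose[OF depends_on_energy])
  have "depends_on (S \<union> nbhd \<Lambda>) (\<lambda>\<eta>. f \<eta> * boltzmann \<Lambda> \<eta>)"
    by (intro depends_on_compose2[where h="(*)"] depends_on_mono[OF B] depends_on_mono[OF assms(1)]) auto
  from depends_on_partial_integral[OF this, of \<Lambda>] depends_on_partial_integral[OF B, of \<Lambda>]
  have "depends_on (S \<union> nbhd \<Lambda>) (\<lambda>\<xi>. partial_integral \<Lambda> (\<lambda>\<eta>. f \<eta> * boltzmann \<Lambda> \<eta>) \<xi> / partition_fun \<Lambda> \<xi>)"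
    unfolding partition_fun_def
    by (intro depends_on_compose2[where h="(/)"]) (auto elim!: depends_on_mono)
  then show ?thesis using assms(2) by (simp add: nn_integral_kernel)
qed

text \<open>The Boltzmann factor of \<Lambda> is that of \<Delta> times a factor \<open>R\<close>
  that ignores the spins in \<Delta>. Integrating over \<Delta> first, both \<open>R\<close> and the
  inner expectation \<open>F\<close> are constants, and the partition function of \<Delta> cancels
  the denominator of \<open>F\<close>.\<close>

lemma kernel_consistent:
  assumes fin: "finite \<Lambda>" and sub: "\<Delta> \<subseteq> \<Lambda>" and [measurable]: "f \<in> borel_measurable borel"
  shows "(\<integral>\<^sup>+\<eta>. (\<integral>\<^sup>+\<zeta>. f \<zeta> \<partial>kernel \<Delta> \<eta>) \<partial>kernel \<Lambda> \<xi>) = (\<integral>\<^sup>+\<eta>. f \<eta> \<partial>kernel \<Lambda> \<xi>)"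
proof -
  define \<Gamma> where "\<Gamma> = \<Lambda> - \<Delta>"
  have finD[simp]: "finite \<Delta>" and finG[simp]: "finite \<Gamma>" using fin sub finite_subset by (auto simp: \<Gamma>_def)
  have L: "\<Lambda> = \<Delta> \<union> \<Gamma>" "\<Delta> \<inter> \<Gamma> = {}" using sub by (auto simp: \<Gamma>_def)
  define R where "R \<eta> = ennreal (exp (- (energy \<Lambda> \<eta> - energy \<Delta> \<eta>)))" for \<eta>
  have [measurable]: "R \<in> borel_measurable borel" unfolding R_def[abs_def] by measurable
  have R: "depends_on (- \<Delta>) R"
    unfolding R_def[abs_def] by (rule depends_on_compose[OF energy_diff[OF fin sub]])
  have RB: "boltzmann \<Lambda> \<eta> = R \<eta> * boltzmann \<Delta> \<eta>" for \<eta>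
    by (simp add: boltzmann_def R_def flip: ennreal_mult exp_add)
  define F where "F \<eta> = (\<integral>\<^sup>+\<zeta>. f \<zeta> \<partial>kernel \<Delta> \<eta>)" for \<eta>
  have [measurable]: "F \<in> borel_measurable borel" unfolding F_def[abs_def] by measurable
  have F: "F \<eta> = partial_integral \<Delta> (\<lambda>\<eta>. f \<eta> * boltzmann \<Delta> \<eta>) \<eta> / partition_fun \<Delta> \<eta>" for \<eta>
    unfolding F_def by (rule nn_integral_kernel) simp
  have FZ: "F \<eta> * partition_fun \<Delta> \<eta> = partial_integral \<Delta> (\<lambda>\<eta>. f \<eta> * boltzmann \<Delta> \<eta>) \<eta>" for \<eta>
    unfolding F using partition_fun_pos[OF finD, of \<eta>] partition_fun_finite[OF finD, of \<eta>]
    by (simp add: ennreal_divide_times)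
  have F_dep: "depends_on (- \<Delta>) F"
  proof -
    have "depends_on (UNIV - \<Delta>) (\<lambda>\<xi>. partial_integral \<Delta> (\<lambda>\<eta>. f \<eta> * boltzmann \<Delta> \<eta>) \<xi> / partial_integral \<Delta> (boltzmann \<Delta>) \<xi>)"
      by (intro depends_on_compose2[where h="(/)"] depends_on_partial_integral depends_on_UNIV)
    then show ?thesis unfolding F[abs_def] partition_fun_def by (simp add: Compl_eq_Diff_UNIV)
  qed
  have "partial_integral \<Lambda> (\<lambda>\<eta>. F \<eta> * boltzmann \<Lambda> \<eta>) \<xi>
      = partial_integral \<Gamma> (partial_integral \<Delta> (\<lambda>\<eta>. (R \<eta> * F \<eta>) * boltzmann \<Delta> \<eta>)) \<xi>"
    unfolding RB unfolding L(1) by (subst partial_integral_union[OF L(2)]) (auto simp: mult_ac)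
  also have "partial_integral \<Delta> (\<lambda>\<eta>. (R \<eta> * F \<eta>) * boltzmann \<Delta> \<eta>) = (\<lambda>\<eta>. (R \<eta> * F \<eta>) * partition_fun \<Delta> \<eta>)"
    unfolding partition_fun_def
    by (intro ext partial_integral_mult_left depends_on_compose2[where h="(*)"] R F_dep) measurable
  also have "\<dots> = (\<lambda>\<eta>. R \<eta> * partial_integral \<Delta> (\<lambda>\<eta>. f \<eta> * boltzmann \<Delta> \<eta>) \<eta>)"
    by (simp add: FZ[symmetric] mult.assoc)
  also have "\<dots> = partial_integral \<Delta> (\<lambda>\<eta>. R \<eta> * (f \<eta> * boltzmann \<Delta> \<eta>))"
    by (intro ext partial_integral_mult_left[symmetric] R) measurable
  also have "partial_integral \<Gamma> \<dots> \<xi> = partial_integral \<Lambda> (\<lambda>\<eta>. f \<eta> * boltzmann \<Lambda> \<eta>) \<xi>"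
    unfolding RB unfolding L(1) by (subst partial_integral_union[OF L(2)]) (auto simp: mult_ac)
  finally have "(\<integral>\<^sup>+\<eta>. F \<eta> \<partial>kernel \<Lambda> \<xi>) = (\<integral>\<^sup>+\<eta>. f \<eta> \<partial>kernel \<Lambda> \<xi>)"
    by (simp add: nn_integral_kernel)
  then show ?thesis by (simp add: F_def)
qed

end

section \<open>Exponential moments\<close>

text \<open>Hoelder's inequality for several exponentials; the slack \<open>1 - sum \<kappa> F\<close> is the weight
  of a constant function. It follows from the tangent line inequality at \<open>\<Sum>y\<in>F. \<kappa> y * t y\<close>.\<close>

lemma exp_weighted_sum_le:
  fixes \<kappa> t :: "'a \<Rightarrow> real"
  assumes "\<And>y. y \<in> F \<Longrightarrow> \<kappa> y \<ge> 0" "sum \<kappa> F \<le> 1"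
  shows "exp (\<Sum>y\<in>F. \<kappa> y * t y) \<le> (1 - sum \<kappa> F) + (\<Sum>y\<in>F. \<kappa> y * exp (t y))"
proof -
  define s where "s = (\<Sum>y\<in>F. \<kappa> y * t y)"
  have tangent: "exp s * (1 + (u - s)) \<le> exp u" for u
    using mult_left_mono[OF exp_ge_add_one_self[of "u - s"], of "exp s"] by (simp flip: exp_add)
  have "(\<Sum>y\<in>F. \<kappa> y * exp (t y)) \<ge> (\<Sum>y\<in>F. \<kappa> y * (exp s * (1 + (t y - s))))"
    using assms by (intro sum_mono mult_left_mono tangent) auto
  also have "(\<Sum>y\<in>F. \<kappa> y * (exp s * (1 + (t y - s)))) = exp s * (sum \<kappa> F + s - sum \<kappa> F * s)"
  proof -
    have "(\<Sum>y\<in>F. \<kappa> y * (exp s * (1 + (t y - s))))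
        = (\<Sum>y\<in>F. exp s * \<kappa> y + exp s * (\<kappa> y * t y) - (exp s * s) * \<kappa> y)"
      by (intro sum.cong) (auto simp: algebra_simps)
    also have "\<dots> = exp s * sum \<kappa> F + exp s * s - (exp s * s) * sum \<kappa> F"
      by (simp only: sum_subtractf sum.distrib sum_distrib_left[symmetric] s_def[symmetric])
    finally show ?thesis by (simp add: algebra_simps)
  qed
  finally have "exp s * (sum \<kappa> F + s - sum \<kappa> F * s) \<le> (\<Sum>y\<in>F. \<kappa> y * exp (t y))" .
  moreover have "(1 - sum \<kappa> F) * (exp s * (1 + (0 - s))) \<le> (1 - sum \<kappa> F) * exp 0"
    using assms by (intro mult_left_mono tangent) auto
  ultimately show ?thesis unfolding s_def[symmetric] by (simp add: algebra_simps)
qed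

text \<open>Subtracting \<open>A y\<close> from \<open>g y\<close> normalises every exponential
  moment to at most 1; the pointwise convexity inequality can then be integrated term by
  term.\<close>

lemma (in prob_space) exp_weighted_sum_nn_integral_le:
  fixes \<kappa> A :: "'i \<Rightarrow> real"
  assumes [measurable]: "\<And>y. y \<in> F \<Longrightarrow> g y \<in> borel_measurable M"
    and \<kappa>: "\<And>y. y \<in> F \<Longrightarrow> \<kappa> y \<ge> 0" "sum \<kappa> F \<le> 1"
    and A: "\<And>y. y \<in> F \<Longrightarrow> (\<integral>\<^sup>+\<omega>. ennreal (exp (g y \<omega>)) \<partial>M) \<le> ennreal (exp (A y))"
  shows "(\<integral>\<^sup>+\<omega>. ennreal (exp (\<Sum>y\<in>F. \<kappa> y * g y \<omega>)) \<partial>M) \<le> ennreal (exp (\<Sum>y\<in>F. \<kappa> y * A y))"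
proof -
  have *: "exp (\<Sum>y\<in>F. \<kappa> y * g y \<omega>) \<le> exp (\<Sum>y\<in>F. \<kappa> y * A y) *
      ((1 - sum \<kappa> F) + (\<Sum>y\<in>F. \<kappa> y * exp (- A y) * exp (g y \<omega>)))" for \<omega>
  proof -
    have "exp (\<Sum>y\<in>F. \<kappa> y * g y \<omega>) = exp (\<Sum>y\<in>F. \<kappa> y * A y) * exp (\<Sum>y\<in>F. \<kappa> y * (g y \<omega> - A y))"
      by (simp add: right_diff_distrib sum_subtractf flip: exp_add)
    also have "\<dots> \<le> exp (\<Sum>y\<in>F. \<kappa> y * A y) * ((1 - sum \<kappa> F) + (\<Sum>y\<in>F. \<kappa> y * exp (g y \<omega> - A y)))"
      using \<kappa> by (intro mult_left_mono exp_weighted_sum_le) auto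
    finally show ?thesis by (simp add: exp_diff exp_minus divide_inverse mult_ac)
  qed
  have "(\<integral>\<^sup>+\<omega>. ennreal (exp (\<Sum>y\<in>F. \<kappa> y * g y \<omega>)) \<partial>M)
      \<le> (\<integral>\<^sup>+\<omega>. ennreal (exp (\<Sum>y\<in>F. \<kappa> y * A y)) * (ennreal (1 - sum \<kappa> F) +
            (\<Sum>y\<in>F. ennreal (\<kappa> y * exp (- A y)) * ennreal (exp (g y \<omega>)))) \<partial>M)"
  proof (intro nn_integral_mono)
    fix \<omega>
    have "ennreal (exp (\<Sum>y\<in>F. \<kappa> y * A y)) * (ennreal (1 - sum \<kappa> F) +
            (\<Sum>y\<in>F. ennreal (\<kappa> y * exp (- A y)) * ennreal (exp (g y \<omega>))))
        = ennreal (exp (\<Sum>y\<in>F. \<kappa> y * A y) *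
            ((1 - sum \<kappa> F) + (\<Sum>y\<in>F. \<kappa> y * exp (- A y) * exp (g y \<omega>))))"
      using \<kappa> by (simp add: ennreal_mult ennreal_plus sum_nonneg flip: sum_ennreal)
    then show "ennreal (exp (\<Sum>y\<in>F. \<kappa> y * g y \<omega>)) \<le> ennreal (exp (\<Sum>y\<in>F. \<kappa> y * A y)) * (ennreal (1 - sum \<kappa> F) +
            (\<Sum>y\<in>F. ennreal (\<kappa> y * exp (- A y)) * ennreal (exp (g y \<omega>))))"
      using *[of \<omega>] by (simp add: ennreal_leI)
  qed
  also have "\<dots> = ennreal (exp (\<Sum>y\<in>F. \<kappa> y * A y)) * (ennreal (1 - sum \<kappa> F) +
            (\<Sum>y\<in>F. ennreal (\<kappa> y * exp (- A y)) * (\<integral>\<^sup>+\<omega>. ennreal (exp (g y \<omega>)) \<partial>M)))"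
    by (simp add: nn_integral_cmult nn_integral_add nn_integral_sum emeasure_space_1)
  also have "\<dots> \<le> ennreal (exp (\<Sum>y\<in>F. \<kappa> y * A y)) * (ennreal (1 - sum \<kappa> F) +
            (\<Sum>y\<in>F. ennreal (\<kappa> y * exp (- A y)) * ennreal (exp (A y))))"
    by (intro mult_left_mono add_left_mono sum_mono A) auto
  also have "\<dots> = ennreal (exp (\<Sum>y\<in>F. \<kappa> y * A y) * ((1 - sum \<kappa> F) + (\<Sum>y\<in>F. \<kappa> y * exp (- A y) * exp (A y))))"
    using \<kappa> by (simp add: ennreal_mult ennreal_plus sum_nonneg flip: sum_ennreal)
  also have "(\<Sum>y\<in>F. \<kappa> y * exp (- A y) * exp (A y)) = sum \<kappa> F"
    by (simp add: mult.assoc flip: exp_add)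
  finally show ?thesis by simp
qed

context gibbs_model
begin

section \<open>Weights and degree sums of the graph\<close>

abbreviation w :: "'v \<Rightarrow> real" where "w \<equiv> weight adj r \<alpha>"
abbreviation deg :: "'v \<Rightarrow> nat" where "deg \<equiv> degree adj"
abbreviation m :: "'v \<Rightarrow> real" where "m \<equiv> m_theta adj \<theta>"

lemma w_pos [simp]: "w x > 0"
  by (simp add: weight_def)

lemma w_nonneg [simp]: "w x \<ge> 0"
  by (simp add: weight_def)

lemma graph_walk_path_dist: "graph_walk adj x y (path_dist adj x y)"
  unfolding path_dist_def using conn by (auto simp: connected_graph_def intro: LeastI_ex)

lemma path_dist_step:
  assumes "adj x y" shows "path_dist adj r y \<le> Suc (path_dist adj r x)"
proof -
  let ?n = "path_dist adj r x"
  obtain \<gamma> where \<gamma>: "\<gamma> 0 = r" "\<gamma> ?n = x" "\<And>i. i < ?n \<Longrightarrow> adj (\<gamma> i) (\<gamma> (Suc i))"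
    using graph_walk_path_dist[of r x] by (auto simp: graph_walk_def)
  have "graph_walk adj r y (Suc ?n)"
    unfolding graph_walk_def using \<gamma> assms
    by (intro exI[of _ "\<lambda>i. if i \<le> ?n then \<gamma> i else y"]) (auto simp: less_Suc_eq)
  then show ?thesis unfolding path_dist_def by (rule Least_le)
qed

text \<open>Crossing an edge changes the distance from the root by at most one. The contraction
  needs no finer information about the weights.\<close>

lemma w_step:
  assumes "adj x y" shows "w x \<le> exp \<alpha> * w y"
proof -
  have "real (path_dist adj r y) \<le> 1 + real (path_dist adj r x)" using path_dist_step[OF assms] by simp
  then have "\<alpha> * real (path_dist adj r y) \<le> \<alpha> * (1 + real (path_dist adj r x))"
    using alpha_pos by (intro mult_left_mono) auto
  then show ?thesis by (simp add: weight_def algebra_simps flip: exp_add)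
qed

lemma deg_pos: assumes "adj x y" shows "deg x \<ge> 1" "deg y \<ge> 1"
proof -
  have "deg x > 0" if "adj x y" for x y
    unfolding degree_def using that by (auto simp: card_gt_0_iff)
  then show "deg x \<ge> 1" "deg y \<ge> 1" using assms adj_sym by (auto simp: Suc_le_eq)
qed

text \<open>A neighbour has degree at least 1, so \<open>m x\<close> also absorbs the power
  \<open>1 + \<theta>\<close> of the degree that Young's inequality produces for the spin at
  \<open>x\<close> itself.\<close>

lemma m_ge_deg_powr: "real (deg x) * real (deg x) powr \<theta> \<le> m x"
proof -
  have "real (deg x) * real (deg x) powr \<theta> = (\<Sum>y\<in>{y. adj x y}. real (deg x) powr \<theta>)"
    by (simp add: degree_def)
  also have "\<dots> \<le> m x"
    unfolding m_theta_def
  proof (intro sum_mono powr_mono2)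
    fix y assume "y \<in> {y. adj x y}"
    then have "deg x * 1 \<le> deg x * deg y" using deg_pos[of x y] by (intro mult_left_mono) auto
    then show "real (deg x) \<le> real (deg x * deg y)" by (simp only: of_nat_le_iff mult_1_right)
  qed (use theta_pos in auto)
  finally show ?thesis .
qed

lemma m_ge_deg: "real (deg x) \<le> m x"
proof (cases "deg x = 0")
  case True
  then show ?thesis by (simp add: m_theta_def sum_nonneg)
next
  case False
  then have "1 \<le> real (deg x) powr \<theta>" using theta_pos by (intro ge_one_powr_ge_zero) auto
  then have "real (deg x) * 1 \<le> real (deg x) * real (deg x) powr \<theta>" by (intro mult_left_mono) auto
  then show ?thesis using m_ge_deg_powr[of x] by simp
qed

lemma m_nonneg [simp]: "m x \<ge> 0"
  using m_ge_deg[of x] by simp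

lemma w_le_1: "w x \<le> 1"
  using alpha_pos by (simp add: weight_def)

lemma ex_adj: assumes "x \<noteq> r" shows "\<exists>y. adj y x"
proof -
  let ?n = "path_dist adj r x"
  obtain \<gamma> where \<gamma>: "\<gamma> 0 = r" "\<gamma> ?n = x" "\<And>i. i < ?n \<Longrightarrow> adj (\<gamma> i) (\<gamma> (Suc i))"
    using graph_walk_path_dist[of r x] by (auto simp: graph_walk_def)
  then have "?n \<noteq> 0" using assms by (metis)
  then have "adj (\<gamma> (?n - 1)) x" using \<gamma>(3)[of "?n - 1"] \<gamma>(2) by simp
  then show ?thesis by blast
qed

lemma mw_summable: "(\<lambda>x. m x * w x) summable_on UNIV"
  using Theta by (simp add: Theta_finite_def)

text \<open>A vertex with a neighbour has \<open>m x \<ge> 1\<close>, which reduces the claim to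
  summability of \<open>m x * w x\<close>. The root may have no neighbour, in the one-vertex graph,
  and is therefore given a separate term.\<close>

lemma w_summable: "w summable_on UNIV"
proof (rule summable_on_comparison_test)
  have "(\<lambda>x. if x = r then 1 else 0 :: real) summable_on UNIV"
    by (rule finite_nonzero_values_imp_summable_on) (auto intro: finite_subset[of _ "{r}"])
  then show "(\<lambda>x. m x * w x + (if x = r then 1 else 0)) summable_on UNIV"
    by (intro summable_on_add mw_summable)
  show "w x \<le> m x * w x + (if x = r then 1 else 0)" for x
  proof (cases "x = r")
    case True
    then show ?thesis using w_le_1[of x] by (simp add: add_increasing)
  next
    case False
    then obtain y where "adj y x" using ex_adj by blast
    then have "1 \<le> m x" using deg_pos[of y x] m_ge_deg[of x] by linarith
    then have "1 * w x \<le> m x * w x" by (intro mult_right_mono) auto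
    then show ?thesis using False by simp
  qed
qed auto

definition total_weight :: real where "total_weight = (\<Sum>\<^sub>\<infinity>x. w x)"

lemma sum_w_le: "finite F \<Longrightarrow> sum w F \<le> total_weight"
  unfolding total_weight_def by (intro finite_sum_le_infsum w_summable) auto

lemma total_weight_pos: "total_weight > 0"
  by (rule less_le_trans[OF w_pos[of r]]) (use sum_w_le[of "{r}"] in simp)

section \<open>The one-site estimate\<close>

lemma energy_singleton: "energy {x} \<eta> = (\<Sum>y\<in>{y. adj x y}. W (\<eta> x) (\<eta> y)) + V (\<eta> x)"
proof -
  have "{(z,y). z \<in> {x} \<and> y \<in> {x} \<and> adj z y} = {}" by auto
  moreover have "(\<Sum>(z,y)\<in>{(z,y). z \<in> {x} \<and> y \<notin> {x} \<and> adj z y}. W (\<eta> z) (\<eta> y)) = (\<Sum>y\<in>{y. adj x y}. W (\<eta> x) (\<eta> y))"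
    by (rule sum.reindex_bij_witness[of _ "\<lambda>y. (x, y)" snd]) auto
  ultimately show ?thesis unfolding energy_def hamiltonian_def by (simp only: sum.empty) simp
qed

text \<open>The numerator is integrable because \<open>a * \<bar>u\<bar> powr q\<close> beats every
  multiple of \<open>\<bar>u\<bar> powr p\<close>; the partition function is bounded below by spins
  in the unit interval. Young's inequality enters twice: for the quadratic term of the spin at
  \<open>x\<close>, whose coefficient grows with the degree, and for the squares of the neighbouring
  spins.\<close>

lemma one_site_bound:
  assumes "lam \<ge> 0" "\<delta> > 0"
  obtains B D where "B \<ge> 0" "D \<ge> 0"
    "\<And>x \<xi>. (\<integral>\<^sup>+\<eta>. ennreal (exp (lam * \<bar>\<eta> x\<bar> powr p)) \<partial>kernel {x} \<xi>)
       \<le> ennreal (exp (B + D * m x + (\<Sum>y\<in>{y. adj x y}. \<delta> / (real (deg x) * real (deg y)) * \<bar>\<xi> y\<bar> powr p)))"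
proof -
  obtain v where v: "\<And>u. u \<in> {-1..1} \<Longrightarrow> \<bar>V u\<bar> \<le> v" using V_bounded_near_0 by blast
  have v0: "v \<ge> 0" using v[of 0] by auto
  define E where "E = (\<integral>\<^sup>+u. ennreal (exp ((lam + 1) * \<bar>u\<bar> powr p - a * \<bar>u\<bar> powr q)) \<partial>lborel)"
  have "E < \<infinity>"
    unfolding E_def using assms p_gt_2 p_less_q a_pos by (intro nn_integral_exp_powr_finite) auto
  then obtain e where e: "E = ennreal e" "e \<ge> 0" by (cases E) auto
  \<comment> \<open>The summand 1 keeps \<open>B1\<close> nonnegative even if the integral is
    small.\<close>
  define B1 where "B1 = ln (1 + e)"
  have B1: "B1 \<ge> 0" "E \<le> ennreal (exp B1)" using e by (auto simp: B1_def intro: ennreal_leI)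
  \<comment> \<open>\<open>K1\<close> is the price of absorbing the quadratic term of the spin at
    \<open>x\<close> into one extra \<open>\<bar>u\<bar> powr p\<close>, which explains
    \<open>lam + 1\<close> in \<open>E\<close>. \<open>K2\<close> is the price of giving a
    neighbouring spin the small coefficient
    \<open>\<delta> / (real (deg x) * real (deg y))\<close>.\<close>
  define K1 where "K1 = (J / 2) * (J / 2) powr \<theta>"
  define K2 where "K2 = J * (J / \<delta>) powr \<theta>"
  have K: "K1 \<ge> 0" "K2 \<ge> 0" using J_pos by (auto simp: K1_def K2_def)
  show thesis
  proof (rule that)
    show "B1 + c + v \<ge> 0" using B1 c_pos v0 by simp
    show "I + J / 2 + K1 + K2 \<ge> 0" using I_pos J_pos K by simp
    fix x and \<xi> :: "'v \<Rightarrow> real"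
    define n where "n = real (deg x)"
    define S where "S = (\<Sum>y\<in>{y. adj x y}. (\<xi> y)\<^sup>2)"
    have Wsum: "\<bar>\<Sum>y\<in>{y. adj x y}. W u (\<xi> y)\<bar> \<le> n * (I / 2) + (J / 2) * n * u\<^sup>2 + (J / 2) * S" for u
    proof -
      have "\<bar>\<Sum>y\<in>{y. adj x y}. W u (\<xi> y)\<bar> \<le> (\<Sum>y\<in>{y. adj x y}. (I + J * (u\<^sup>2 + (\<xi> y)\<^sup>2)) / 2)"
        by (rule order_trans[OF sum_abs]) (intro sum_mono W_bound)
      also have "\<dots> = (\<Sum>y\<in>{y. adj x y}. (I / 2 + J / 2 * u\<^sup>2) + (J / 2) * (\<xi> y)\<^sup>2)"
        by (intro sum.cong) (auto simp: algebra_simps add_divide_distrib)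
      also have "\<dots> = n * (I / 2 + J / 2 * u\<^sup>2) + (J / 2) * S"
        by (simp only: sum.distrib sum_distrib_left[symmetric] S_def[symmetric]) (simp add: n_def degree_def algebra_simps)
      also have "\<dots> = n * (I / 2) + (J / 2) * n * u\<^sup>2 + (J / 2) * S" by (simp add: algebra_simps)
      finally show ?thesis .
    qed
    have en: "energy {x} (\<xi>(x := u)) = (\<Sum>y\<in>{y. adj x y}. W u (\<xi> y)) + V u" for u
      unfolding energy_singleton by (auto intro!: sum.cong)
    have n_m: "n \<le> m x" unfolding n_def by (rule m_ge_deg)
    have young: "(J / 2) * n * u\<^sup>2 \<le> \<bar>u\<bar> powr p + K1 * m x" for u
    proof -
      have "(J / 2 * n) * u\<^sup>2 \<le> 1 * \<bar>u\<bar> powr p + (J / 2 * n) * (J / 2 * n / 1) powr \<theta>"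
        unfolding p_def using J_pos theta_pos by (intro square_le_powr_plus_const) (auto simp: n_def)
      also have "(J / 2 * n) * (J / 2 * n / 1) powr \<theta> = K1 * (n * n powr \<theta>)"
        using powr_mult[of "J / 2" n \<theta>] J_pos by (simp add: K1_def n_def)
      also have "\<dots> \<le> K1 * m x"
        unfolding n_def using K by (intro mult_left_mono m_ge_deg_powr)
      finally show ?thesis by (simp add: mult_ac)
    qed
    let ?up = "n * (I / 2) + K1 * m x + (J / 2) * S + c"
    have "partial_integral {x} (\<lambda>\<eta>. ennreal (exp (lam * \<bar>\<eta> x\<bar> powr p)) * boltzmann {x} \<eta>) \<xi>
        = (\<integral>\<^sup>+u. ennreal (exp (lam * \<bar>u\<bar> powr p)) * ennreal (exp (- energy {x} (\<xi>(x := u)))) \<partial>lborel)"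
      by (subst partial_integral_singleton) (simp_all add: boltzmann_def)
    also have "\<dots> \<le> (\<integral>\<^sup>+u. ennreal (exp ?up) * ennreal (exp ((lam + 1) * \<bar>u\<bar> powr p - a * \<bar>u\<bar> powr q)) \<partial>lborel)"
    proof (intro nn_integral_mono)
      fix u :: real
      have "lam * \<bar>u\<bar> powr p - energy {x} (\<xi>(x := u)) \<le> ?up + ((lam + 1) * \<bar>u\<bar> powr p - a * \<bar>u\<bar> powr q)"
        using Wsum[of u] young[of u] V_bound[of u] unfolding en by (simp add: algebra_simps)
      then have "exp (lam * \<bar>u\<bar> powr p) * exp (- energy {x} (\<xi>(x := u)))
          \<le> exp ?up * exp ((lam + 1) * \<bar>u\<bar> powr p - a * \<bar>u\<bar> powr q)"
        by (simp flip: exp_add)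
      then show "ennreal (exp (lam * \<bar>u\<bar> powr p)) * ennreal (exp (- energy {x} (\<xi>(x := u))))
          \<le> ennreal (exp ?up) * ennreal (exp ((lam + 1) * \<bar>u\<bar> powr p - a * \<bar>u\<bar> powr q))"
        by (simp flip: ennreal_mult)
    qed
    also have "\<dots> = ennreal (exp ?up) * E" unfolding E_def by (intro nn_integral_cmult) auto
    also have "\<dots> \<le> ennreal (exp ?up) * ennreal (exp B1)" by (intro mult_left_mono B1) auto
    also have "\<dots> = ennreal (exp (?up + B1))" by (simp flip: ennreal_mult exp_add)
    finally have num: "partial_integral {x} (\<lambda>\<eta>. ennreal (exp (lam * \<bar>\<eta> x\<bar> powr p)) * boltzmann {x} \<eta>) \<xi>
        \<le> ennreal (exp (?up + B1))" .
    let ?lo = "n * (I / 2) + (J / 2) * n + (J / 2) * S + v"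
    have "ennreal (exp (- ?lo)) = (\<integral>\<^sup>+u. ennreal (exp (- ?lo)) * indicator {0..1::real} u \<partial>lborel)"
      by (simp add: nn_integral_cmult_indicator)
    also have "\<dots> \<le> (\<integral>\<^sup>+u. ennreal (exp (- energy {x} (\<xi>(x := u)))) \<partial>lborel)"
    proof (intro nn_integral_mono)
      fix u :: real
      show "ennreal (exp (- ?lo)) * indicator {0..1} u \<le> ennreal (exp (- energy {x} (\<xi>(x := u))))"
      proof (cases "u \<in> {0..1}")
        case True
        then have "u\<^sup>2 \<le> 1" by (auto intro: power_le_one)
        then have "(J / 2) * n * u\<^sup>2 \<le> (J / 2) * n * 1" using J_pos by (intro mult_left_mono) (auto simp: n_def)
        moreover have "V u \<le> v" using v[of u] True by auto
        ultimately show ?thesis using True Wsum[of u] unfolding en by (auto intro!: ennreal_leI)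
      qed simp
    qed
    also have "\<dots> = partition_fun {x} \<xi>"
      unfolding partition_fun_def by (subst partial_integral_singleton) (simp_all add: boltzmann_def)
    finally have den: "ennreal (exp (- ?lo)) \<le> partition_fun {x} \<xi>" .
    have "(\<integral>\<^sup>+\<eta>. ennreal (exp (lam * \<bar>\<eta> x\<bar> powr p)) \<partial>kernel {x} \<xi>)
        = partial_integral {x} (\<lambda>\<eta>. ennreal (exp (lam * \<bar>\<eta> x\<bar> powr p)) * boltzmann {x} \<eta>) \<xi> / partition_fun {x} \<xi>"
      by (rule nn_integral_kernel) measurable
    also have "\<dots> \<le> ennreal (exp (?up + B1)) / ennreal (exp (- ?lo))"
      unfolding divide_ennreal_def by (intro mult_mono inverse_antimono_ennreal num den) auto
    also have "\<dots> = ennreal (exp (?up + B1 + ?lo))"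
      by (simp add: divide_ennreal flip: exp_diff)
    also have "\<dots> \<le> ennreal (exp (B1 + c + v + (I + J / 2 + K1 + K2) * m x
        + (\<Sum>y\<in>{y. adj x y}. \<delta> / (real (deg x) * real (deg y)) * \<bar>\<xi> y\<bar> powr p)))"
    proof -
      \<comment> \<open>The numerator and the partition function each contribute
        \<open>(J / 2) * S\<close>, hence the full \<open>J * S\<close> here.\<close>
      have "J * S \<le> (\<Sum>y\<in>{y. adj x y}. \<delta> / (real (deg x) * real (deg y)) * \<bar>\<xi> y\<bar> powr p
          + K2 * real (deg x * deg y) powr \<theta>)"
        unfolding S_def sum_distrib_left
      proof (intro sum_mono)
        fix y assume "y \<in> {y. adj x y}"
        then have pos: "real (deg x) > 0" "real (deg y) > 0" using deg_pos[of x y] by auto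
        have "J * (\<xi> y)\<^sup>2 \<le> \<delta> / (real (deg x) * real (deg y)) * \<bar>\<xi> y\<bar> powr p
            + J * (J / (\<delta> / (real (deg x) * real (deg y)))) powr \<theta>"
          unfolding p_def using J_pos theta_pos assms pos by (intro square_le_powr_plus_const) auto
        also have "J / (\<delta> / (real (deg x) * real (deg y))) = (J / \<delta>) * real (deg x * deg y)"
          using pos assms by (simp add: field_simps)
        also have "J * ((J / \<delta>) * real (deg x * deg y)) powr \<theta> = K2 * real (deg x * deg y) powr \<theta>"
          unfolding K2_def using J_pos assms by (subst powr_mult) auto
        finally show "J * (\<xi> y)\<^sup>2 \<le> \<delta> / (real (deg x) * real (deg y)) * \<bar>\<xi> y\<bar> powr p
          + K2 * real (deg x * deg y) powr \<theta>" .
      qed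
      then have JS: "J * S \<le> (\<Sum>y\<in>{y. adj x y}. \<delta> / (real (deg x) * real (deg y)) * \<bar>\<xi> y\<bar> powr p) + K2 * m x"
        by (simp add: sum.distrib sum_distrib_left m_theta_def)
      have "I * n \<le> I * m x" "J / 2 * n \<le> J / 2 * m x"
        using n_m I_pos J_pos by (auto intro!: mult_left_mono)
      then show ?thesis using JS by (intro ennreal_leI) (simp add: algebra_simps)
    qed
    finally show "(\<integral>\<^sup>+\<eta>. ennreal (exp (lam * \<bar>\<eta> x\<bar> powr p)) \<partial>kernel {x} \<xi>)
       \<le> ennreal (exp (B1 + c + v + (I + J / 2 + K1 + K2) * m x
        + (\<Sum>y\<in>{y. adj x y}. \<delta> / (real (deg x) * real (deg y)) * \<bar>\<xi> y\<bar> powr p)))" .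
  qed
qed

section \<open>Exponential moments in a finite volume\<close>

lemma kernel_boundary_exp:
  assumes fin: "finite \<Lambda>" and "y \<notin> \<Lambda>"
  shows "(\<integral>\<^sup>+\<eta>. ennreal (exp (lam * \<bar>\<eta> y\<bar> powr p)) \<partial>kernel \<Lambda> \<xi>) = ennreal (exp (lam * \<bar>\<xi> y\<bar> powr p))"
proof -
  have "depends_on (- \<Lambda>) (\<lambda>\<eta>. ennreal (exp (lam * \<bar>\<eta> y\<bar> powr p)))"
    using \<open>y \<notin> \<Lambda>\<close> by (auto simp: depends_on_def)
  then have "partial_integral \<Lambda> (\<lambda>\<eta>. ennreal (exp (lam * \<bar>\<eta> y\<bar> powr p)) * boltzmann \<Lambda> \<eta>) \<xi>
      = ennreal (exp (lam * \<bar>\<xi> y\<bar> powr p)) * partition_fun \<Lambda> \<xi>"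
    unfolding partition_fun_def by (rule partial_integral_mult_left) measurable
  then show ?thesis
    using partition_fun_pos[OF fin, of \<xi>] partition_fun_finite[OF fin, of \<xi>]
    by (subst nn_integral_kernel) (auto simp: mult_divide_eq_ennreal)
qed

text \<open>An a priori bound that may depend on everything. Without it
  \<open>ln (enn2real (E y))\<close> would not be the logarithm of the moment, and an inequality
  bounding a sum of these by half of itself plus a constant could not be exploited.\<close>

lemma kernel_exp_finite:
  assumes fin: "finite \<Lambda>" and "y \<in> \<Lambda>" and "lam \<ge> 0"
  shows "(\<integral>\<^sup>+\<eta>. ennreal (exp (lam * \<bar>\<eta> y\<bar> powr p)) \<partial>kernel \<Lambda> \<xi>) < \<infinity>"
proof -
  obtain C where "C \<ge> 0" and C: "\<And>f \<xi>. f \<in> borel_measurable borel \<Longrightarrow>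
      partial_integral \<Lambda> (\<lambda>\<eta>. f \<eta> * boltzmann \<Lambda> \<eta>) \<xi> / partition_fun \<Lambda> \<xi>
       \<le> ennreal (exp (C * (1 + boundary_sq \<Lambda> \<xi>))) * partial_integral \<Lambda> (\<lambda>\<eta>. f \<eta> * (\<Prod>x\<in>\<Lambda>. site_bound C (\<eta> x))) \<xi>"
    using kernel_domination[OF fin] by blast
  have "(\<integral>\<^sup>+\<eta>. ennreal (exp (lam * \<bar>\<eta> y\<bar> powr p)) \<partial>kernel \<Lambda> \<xi>)
      \<le> ennreal (exp (C * (1 + boundary_sq \<Lambda> \<xi>))) *
        partial_integral \<Lambda> (\<lambda>\<eta>. ennreal (exp (lam * \<bar>\<eta> y\<bar> powr p)) * (\<Prod>x\<in>\<Lambda>. site_bound C (\<eta> x))) \<xi>"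
    by (subst nn_integral_kernel) (auto intro!: C)
  also have "\<dots> \<le> ennreal (exp (C * (1 + boundary_sq \<Lambda> \<xi>))) *
        partial_integral \<Lambda> (\<lambda>\<eta>. \<Prod>x\<in>\<Lambda>. ennreal (exp (lam * \<bar>\<eta> x\<bar> powr p)) * site_bound C (\<eta> x)) \<xi>"
  proof (intro mult_left_mono partial_integral_mono)
    fix \<eta> :: "'v \<Rightarrow> real"
    have "exp (lam * \<bar>\<eta> y\<bar> powr p) \<le> (\<Prod>x\<in>\<Lambda>. exp (lam * \<bar>\<eta> x\<bar> powr p))"
      using fin \<open>y \<in> \<Lambda>\<close> \<open>lam \<ge> 0\<close>
      by (simp flip: exp_sum) (intro member_le_sum[where f="\<lambda>x. lam * \<bar>\<eta> x\<bar> powr p"], auto)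
    from ennreal_leI[OF this]
    show "ennreal (exp (lam * \<bar>\<eta> y\<bar> powr p)) * (\<Prod>x\<in>\<Lambda>. site_bound C (\<eta> x))
        \<le> (\<Prod>x\<in>\<Lambda>. ennreal (exp (lam * \<bar>\<eta> x\<bar> powr p)) * site_bound C (\<eta> x))"
      by (simp add: prod.distrib prod_ennreal mult_right_mono)
  qed simp
  also have "\<dots> < \<infinity>"
    using partial_integral_site_bound_finite[OF fin \<open>C \<ge> 0\<close> \<open>lam \<ge> 0\<close>, of \<xi>] by (simp add: ennreal_mult_less_top)
  finally show ?thesis .
qed

definition boundary_norm :: "'v set \<Rightarrow> ('v \<Rightarrow> real) \<Rightarrow> real" where
  "boundary_norm \<Lambda> \<xi> = (\<Sum>y\<in>nbhd \<Lambda> - \<Lambda>. w y * \<bar>\<xi> y\<bar> powr p)"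

text \<open>The numbers \<open>M x\<close>, logarithms of exponential moments, satisfy a linear recursive inequality
  whose coefficients \<open>\<kappa> x y\<close> are contractive in the weighted \<open>l\<^sup>1\<close> norm by the choice of \<open>\<delta>\<close>.\<close>

lemma log_moments_bound:
  assumes lam: "lam > 0"
  obtains A where "A \<ge> 0"
    "\<And>\<Lambda> \<xi>. finite \<Lambda> \<Longrightarrow> \<exists>M. (\<forall>x\<in>\<Lambda>. M x \<ge> 0 \<and>
        (\<integral>\<^sup>+\<eta>. ennreal (exp (lam * \<bar>\<eta> x\<bar> powr p)) \<partial>kernel \<Lambda> \<xi>) \<le> ennreal (exp (M x))) \<and>
      (\<Sum>x\<in>\<Lambda>. w x * M x) \<le> A + lam * boundary_norm \<Lambda> \<xi>"
proof -
  \<comment> \<open>The factor \<open>exp (- \<alpha>)\<close> compensates the change of weight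
    across an edge, and 1/2 becomes the contraction factor. The factor \<open>lam\<close> makes the
    boundary terms multiples of the very exponents whose moments are estimated.\<close>
  define \<delta> where "\<delta> = lam * exp (- \<alpha>) / 2"
  have "\<delta> > 0" using lam by (simp add: \<delta>_def)
  obtain B D where BD: "B \<ge> 0" "D \<ge> 0" and
    site: "\<And>x \<xi>. (\<integral>\<^sup>+\<eta>. ennreal (exp (lam * \<bar>\<eta> x\<bar> powr p)) \<partial>kernel {x} \<xi>)
       \<le> ennreal (exp (B + D * m x + (\<Sum>y\<in>{y. adj x y}. \<delta> / (real (deg x) * real (deg y)) * \<bar>\<xi> y\<bar> powr p)))"
    using one_site_bound[OF less_imp_le[OF lam] \<open>\<delta> > 0\<close>] by blast
  define A where "A = B * total_weight + D * (\<Sum>\<^sub>\<infinity>x. m x * w x)"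
  have A0: "A \<ge> 0"
    unfolding A_def using BD total_weight_pos by (auto intro!: add_nonneg_nonneg mult_nonneg_nonneg infsum_nonneg)
  define \<kappa> where "\<kappa> x y = exp (- \<alpha>) / 2 / (real (deg x) * real (deg y))" for x y
  have \<kappa>: "\<kappa> x y \<ge> 0" for x y unfolding \<kappa>_def by simp
  \<comment> \<open>Row sums for Hoelder's inequality, which spend the factor
    \<open>1 / deg x\<close>; the factor \<open>1 / deg y\<close> is reserved for the column
    sums.\<close>
  have \<kappa>_sum: "(\<Sum>y\<in>{y. adj x y}. \<kappa> x y) \<le> 1" for x
  proof -
    have "(\<Sum>y\<in>{y. adj x y}. \<kappa> x y) \<le> (\<Sum>y\<in>{y. adj x y}. 1 / real (deg x))"
    proof (intro sum_mono)
      fix y assume "y \<in> {y. adj x y}"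
      then have d: "real (deg x) \<ge> 1" "real (deg y) \<ge> 1" using deg_pos[of x y] by auto
      have "\<kappa> x y \<le> 1 / (real (deg x) * real (deg y))"
        unfolding \<kappa>_def using alpha_pos d by (intro divide_right_mono) (auto simp: field_simps intro: order_trans[of _ 1])
      also have "\<dots> \<le> 1 / real (deg x)" using d by (intro divide_left_mono) auto
      finally show "\<kappa> x y \<le> 1 / real (deg x)" .
    qed
    also have "\<dots> \<le> 1" by (simp add: degree_def)
    finally show ?thesis .
  qed
  show thesis
  proof (rule that[of "2 * A"])
    show "2 * A \<ge> 0" using A0 by simp
    fix \<Lambda> :: "'v set" and \<xi> :: "'v \<Rightarrow> real" assume fin: "finite \<Lambda>"
    define E where "E y = (\<integral>\<^sup>+\<eta>. ennreal (exp (lam * \<bar>\<eta> y\<bar> powr p)) \<partial>kernel \<Lambda> \<xi>)" for y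
    interpret P: prob_space "kernel \<Lambda> \<xi>" by (rule prob_space_kernel[OF fin])
    define M where "M y = ln (enn2real (E y))" for y
    have E_fin: "E y < \<infinity>" for y
      using kernel_exp_finite[OF fin, of y lam \<xi>] kernel_boundary_exp[OF fin, of y \<xi> lam] lam
      unfolding E_def by (cases "y \<in> \<Lambda>") auto
    have E_ge: "E y \<ge> 1" for y
    proof -
      have "1 = (\<integral>\<^sup>+\<eta>. 1 \<partial>kernel \<Lambda> \<xi>)" using P.emeasure_space_1 by simp
      also have "\<dots> \<le> E y" unfolding E_def using lam by (intro nn_integral_mono) (simp add: one_le_exp_iff flip: ennreal_1)
      finally show ?thesis .
    qed
    have E_real: "enn2real (E y) \<ge> 1" for y
      using enn2real_mono[OF E_ge[of y]] E_fin[of y] by simp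
    have EM: "E y = ennreal (exp (M y))" for y
      unfolding M_def using E_real[of y] E_fin[of y] by simp
    have M0: "M y \<ge> 0" for y unfolding M_def using E_real[of y] by simp
    \<comment> \<open>Spins outside the volume are frozen at \<xi>, so here the recursion meets its
      boundary values.\<close>
    have M_out: "M y = lam * \<bar>\<xi> y\<bar> powr p" if "y \<notin> \<Lambda>" for y
      unfolding M_def E_def kernel_boundary_exp[OF fin that] by simp
    have M_in: "M x \<le> B + D * m x + (\<Sum>y\<in>{y. adj x y}. \<kappa> x y * M y)" if "x \<in> \<Lambda>" for x
    proof -
      have "E x = (\<integral>\<^sup>+\<eta>. (\<integral>\<^sup>+\<zeta>. ennreal (exp (lam * \<bar>\<zeta> x\<bar> powr p)) \<partial>kernel {x} \<eta>) \<partial>kernel \<Lambda> \<xi>)"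
        unfolding E_def using that by (intro kernel_consistent[OF fin, symmetric]) auto
      also have "\<dots> \<le> (\<integral>\<^sup>+\<eta>. ennreal (exp (B + D * m x)) *
          ennreal (exp (\<Sum>y\<in>{y. adj x y}. \<kappa> x y * (lam * \<bar>\<eta> y\<bar> powr p))) \<partial>kernel \<Lambda> \<xi>)"
      proof (intro nn_integral_mono order_trans[OF site])
        fix \<eta> :: "'v \<Rightarrow> real"
        have "(\<Sum>y\<in>{y. adj x y}. \<delta> / (real (deg x) * real (deg y)) * \<bar>\<eta> y\<bar> powr p)
            = (\<Sum>y\<in>{y. adj x y}. \<kappa> x y * (lam * \<bar>\<eta> y\<bar> powr p))"
          by (intro sum.cong) (auto simp: \<kappa>_def \<delta>_def)
        then show "ennreal (exp (B + D * m x + (\<Sum>y\<in>{y. adj x y}. \<delta> / (real (deg x) * real (deg y)) * \<bar>\<eta> y\<bar> powr p)))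
          \<le> ennreal (exp (B + D * m x)) * ennreal (exp (\<Sum>y\<in>{y. adj x y}. \<kappa> x y * (lam * \<bar>\<eta> y\<bar> powr p)))"
          by (simp add: exp_add ennreal_mult)
      qed
      also have "\<dots> = ennreal (exp (B + D * m x)) *
          (\<integral>\<^sup>+\<eta>. ennreal (exp (\<Sum>y\<in>{y. adj x y}. \<kappa> x y * (lam * \<bar>\<eta> y\<bar> powr p))) \<partial>kernel \<Lambda> \<xi>)"
        by (intro nn_integral_cmult) measurable
      also have "\<dots> \<le> ennreal (exp (B + D * m x)) * ennreal (exp (\<Sum>y\<in>{y. adj x y}. \<kappa> x y * M y))"
      proof (intro mult_left_mono P.exp_weighted_sum_nn_integral_le \<kappa> \<kappa>_sum)
        show "(\<integral>\<^sup>+\<omega>. ennreal (exp (lam * \<bar>\<omega> y\<bar> powr p)) \<partial>kernel \<Lambda> \<xi>) \<le> ennreal (exp (M y))" for y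
          unfolding EM[symmetric] E_def by simp
        show "(\<lambda>\<eta>. lam * \<bar>\<eta> y\<bar> powr p) \<in> borel_measurable (kernel \<Lambda> \<xi>)" for y
          by measurable
      qed simp
      also have "\<dots> = ennreal (exp (B + D * m x + (\<Sum>y\<in>{y. adj x y}. \<kappa> x y * M y)))"
        by (simp add: exp_add ennreal_mult)
      finally show ?thesis unfolding EM by simp
    qed
    define T where "T = (\<Sum>x\<in>\<Lambda>. w x * M x)"
    have "T \<le> (\<Sum>x\<in>\<Lambda>. w x * (B + D * m x + (\<Sum>y\<in>{y. adj x y}. \<kappa> x y * M y)))"
      unfolding T_def by (intro sum_mono mult_left_mono M_in) auto
    also have "\<dots> = (\<Sum>x\<in>\<Lambda>. B * w x + D * (m x * w x)) + (\<Sum>x\<in>\<Lambda>. \<Sum>y\<in>{y. adj x y}. w x * (\<kappa> x y * M y))"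
      unfolding sum.distrib[symmetric] by (intro sum.cong) (auto simp: algebra_simps sum_distrib_left)
    also have "(\<Sum>x\<in>\<Lambda>. B * w x + D * (m x * w x)) = B * sum w \<Lambda> + D * (\<Sum>x\<in>\<Lambda>. m x * w x)"
      by (simp add: sum.distrib sum_distrib_left)
    also have "\<dots> \<le> A"
      unfolding A_def using BD fin
      by (intro add_mono mult_left_mono sum_w_le finite_sum_le_infsum mw_summable) auto
    also have "(\<Sum>x\<in>\<Lambda>. \<Sum>y\<in>{y. adj x y}. w x * (\<kappa> x y * M y)) \<le> (\<Sum>x\<in>\<Lambda>. \<Sum>y\<in>{y. adj x y}. w y * M y / 2 / real (deg y))"
    proof (intro sum_mono)
      fix x y assume "y \<in> {y. adj x y}"
      then have xy: "adj x y" by simp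
      then have d: "real (deg x) \<ge> 1" "real (deg y) \<ge> 1" using deg_pos[of x y] by auto
      have "w x * \<kappa> x y \<le> (exp \<alpha> * w y) * \<kappa> x y" by (intro mult_right_mono w_step xy \<kappa>)
      also have "\<dots> = (w y / 2) / (real (deg x) * real (deg y))" by (simp add: \<kappa>_def exp_minus)
      also have "\<dots> \<le> (w y / 2) / real (deg y)" using d by (intro divide_left_mono) auto
      finally have "w x * \<kappa> x y * M y \<le> (w y / 2) / real (deg y) * M y" by (intro mult_right_mono M0)
      then show "w x * (\<kappa> x y * M y) \<le> w y * M y / 2 / real (deg y)" by (simp add: mult_ac)
    qed
    also have "\<dots> = (\<Sum>x\<in>\<Lambda>. \<Sum>y\<in>{y\<in>nbhd \<Lambda>. adj x y}. w y * M y / 2 / real (deg y))"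
      by (intro sum.cong refl) (auto simp: adj_nbhd)
    \<comment> \<open>After the exchange each y is counted once for every neighbour in \<Lambda>, at
      most \<open>deg y\<close> times, which cancels the division by \<open>deg y\<close>.\<close>
    also have "\<dots> = (\<Sum>y\<in>nbhd \<Lambda>. \<Sum>x\<in>{x\<in>\<Lambda>. adj x y}. w y * M y / 2 / real (deg y))"
      using fin by (intro sum.swap_restrict) auto
    also have "\<dots> \<le> (\<Sum>y\<in>nbhd \<Lambda>. w y * M y / 2)"
    proof (intro sum_mono)
      fix y
      have "card {x\<in>\<Lambda>. adj x y} \<le> deg y"
        unfolding degree_def by (intro card_mono) (auto simp: adj_sym)
      then have "real (card {x\<in>\<Lambda>. adj x y}) * (w y * M y / 2 / real (deg y)) \<le> real (deg y) * (w y * M y / 2 / real (deg y))"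
        using M0[of y] by (intro mult_right_mono) auto
      also have "\<dots> \<le> w y * M y / 2" using M0[of y] by (cases "deg y = 0") auto
      finally show "(\<Sum>x\<in>{x\<in>\<Lambda>. adj x y}. w y * M y / 2 / real (deg y)) \<le> w y * M y / 2" by simp
    qed
    also have "\<dots> = (\<Sum>y\<in>nbhd \<Lambda> - \<Lambda>. w y * M y / 2) + T / 2"
      unfolding T_def sum_divide_distrib using sum.subset_diff[OF subset_nbhd finite_nbhd[OF fin]] by blast
    also have "(\<Sum>y\<in>nbhd \<Lambda> - \<Lambda>. w y * M y / 2) = lam * boundary_norm \<Lambda> \<xi> / 2"
      unfolding boundary_norm_def sum_distrib_left sum_divide_distrib by (intro sum.cong) (auto simp: M_out)
    \<comment> \<open>The chain reads: \<open>T\<close> is at most \<open>A\<close> plus half of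
      \<open>lam * boundary_norm \<Lambda> \<xi>\<close> plus \<open>T / 2\<close>. Solving for
      \<open>T\<close> doubles the first two terms.\<close>
    finally have "T \<le> 2 * A + lam * boundary_norm \<Lambda> \<xi>" by simp
    then show "\<exists>M. (\<forall>x\<in>\<Lambda>. M x \<ge> 0 \<and>
        (\<integral>\<^sup>+\<eta>. ennreal (exp (lam * \<bar>\<eta> x\<bar> powr p)) \<partial>kernel \<Lambda> \<xi>) \<le> ennreal (exp (M x))) \<and>
      (\<Sum>x\<in>\<Lambda>. w x * M x) \<le> 2 * A + lam * boundary_norm \<Lambda> \<xi>"
      using M0 EM unfolding T_def E_def by (intro exI[of _ M]) auto
  qed
qed

definition weighted_sum :: "'v set \<Rightarrow> ('v \<Rightarrow> real) \<Rightarrow> real" where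
  "weighted_sum \<Delta> \<eta> = (\<Sum>x\<in>\<Delta>. w x * \<bar>\<eta> x\<bar> powr p)"

lemma weighted_sum_measurable [measurable]: "weighted_sum \<Delta> \<in> borel_measurable borel"
  unfolding weighted_sum_def[abs_def] by measurable

lemma weighted_sum_mono: "finite \<Gamma> \<Longrightarrow> \<Delta> \<subseteq> \<Gamma> \<Longrightarrow> weighted_sum \<Delta> \<eta> \<le> weighted_sum \<Gamma> \<eta>"
  unfolding weighted_sum_def by (intro sum_mono2) auto

lemma depends_on_weighted_sum: "depends_on \<Delta> (weighted_sum \<Delta>)"
  unfolding depends_on_def weighted_sum_def by (auto intro!: sum.cong)

text \<open>Hoelder's inequality a second time, now over the sites with weights
  \<open>w x / S\<close> of total mass at most 1. Each spin then carries the parameter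
  \<open>lam * S\<close>, and the logarithm of the bound is the weighted sum of the
  \<open>M x\<close> divided by \<open>S\<close>.\<close>

lemma kernel_exp_moment:
  assumes lam: "lam > 0"
  obtains K where "K \<ge> 0" "\<And>\<Lambda> \<Delta> \<xi>. finite \<Lambda> \<Longrightarrow> \<Delta> \<subseteq> \<Lambda> \<Longrightarrow>
    (\<integral>\<^sup>+\<eta>. ennreal (exp (lam * weighted_sum \<Delta> \<eta>)) \<partial>kernel \<Lambda> \<xi>) \<le> ennreal (exp (K + lam * boundary_norm \<Lambda> \<xi>))"
proof -
  define S where "S = total_weight"
  have S: "S > 0" unfolding S_def by (rule total_weight_pos)
  then have "lam * S > 0" using lam by simp
  then obtain A where "A \<ge> 0" and
    A: "\<And>\<Lambda> \<xi>. finite \<Lambda> \<Longrightarrow> \<exists>M. (\<forall>x\<in>\<Lambda>. M x \<ge> 0 \<and>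
        (\<integral>\<^sup>+\<eta>. ennreal (exp (lam * S * \<bar>\<eta> x\<bar> powr p)) \<partial>kernel \<Lambda> \<xi>) \<le> ennreal (exp (M x))) \<and>
      (\<Sum>x\<in>\<Lambda>. w x * M x) \<le> A + lam * S * boundary_norm \<Lambda> \<xi>"
    using log_moments_bound[of "lam * S"] by blast
  show thesis
  proof (rule that[of "A / S"])
    show "A / S \<ge> 0" using \<open>A \<ge> 0\<close> S by simp
    fix \<Lambda> \<Delta> :: "'v set" and \<xi> assume fin: "finite \<Lambda>" and sub: "\<Delta> \<subseteq> \<Lambda>"
    have finD: "finite \<Delta>" using fin sub by (rule finite_subset[rotated])
    interpret P: prob_space "kernel \<Lambda> \<xi>" by (rule prob_space_kernel[OF fin])
    obtain M where M: "\<And>x. x \<in> \<Lambda> \<Longrightarrow> M x \<ge> 0"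
      "\<And>x. x \<in> \<Lambda> \<Longrightarrow> (\<integral>\<^sup>+\<eta>. ennreal (exp (lam * S * \<bar>\<eta> x\<bar> powr p)) \<partial>kernel \<Lambda> \<xi>) \<le> ennreal (exp (M x))"
      and MA: "(\<Sum>x\<in>\<Lambda>. w x * M x) \<le> A + lam * S * boundary_norm \<Lambda> \<xi>"
      using A[OF fin, of \<xi>] by auto
    have "(\<integral>\<^sup>+\<eta>. ennreal (exp (lam * weighted_sum \<Delta> \<eta>)) \<partial>kernel \<Lambda> \<xi>)
        = (\<integral>\<^sup>+\<eta>. ennreal (exp (\<Sum>x\<in>\<Delta>. w x / S * (lam * S * \<bar>\<eta> x\<bar> powr p))) \<partial>kernel \<Lambda> \<xi>)"
      unfolding weighted_sum_def sum_distrib_left using S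
      by (intro nn_integral_cong arg_cong[where f="\<lambda>t. ennreal (exp t)"] sum.cong) auto
    also have "\<dots> \<le> ennreal (exp (\<Sum>x\<in>\<Delta>. w x / S * M x))"
    proof (rule P.exp_weighted_sum_nn_integral_le)
      show "(\<Sum>x\<in>\<Delta>. w x / S) \<le> 1"
        using sum_w_le[OF finD] S unfolding S_def by (simp flip: sum_divide_distrib)
    qed (use M sub S in \<open>auto simp: less_imp_le\<close>)
    also have "\<dots> \<le> ennreal (exp (A / S + lam * boundary_norm \<Lambda> \<xi>))"
    proof -
      have "(\<Sum>x\<in>\<Delta>. w x / S * M x) = (\<Sum>x\<in>\<Delta>. w x * M x) / S" by (simp add: sum_divide_distrib)
      also have "\<dots> \<le> (\<Sum>x\<in>\<Lambda>. w x * M x) / S"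
        using S M sub fin by (intro divide_right_mono sum_mono2) auto
      also have "\<dots> \<le> (A + lam * S * boundary_norm \<Lambda> \<xi>) / S"
        using S MA by (intro divide_right_mono) auto
      also have "\<dots> = A / S + lam * boundary_norm \<Lambda> \<xi>" using S by (simp add: field_simps)
      finally show ?thesis by (intro ennreal_leI) simp
    qed
    finally show "(\<integral>\<^sup>+\<eta>. ennreal (exp (lam * weighted_sum \<Delta> \<eta>)) \<partial>kernel \<Lambda> \<xi>)
      \<le> ennreal (exp (A / S + lam * boundary_norm \<Lambda> \<xi>))" .
  qed
qed

end

section \<open>DLR measures\<close>

text \<open>Monotone convergence. It reduces exponential moments to bounded integrands, for which
  limits may be taken inside the integral.\<close>

lemma nn_integral_le_truncated:
  fixes f :: "'a \<Rightarrow> real"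
  assumes [measurable]: "f \<in> borel_measurable M"
    and le: "\<And>n::nat. (\<integral>\<^sup>+x. ennreal (min (f x) (real n)) \<partial>M) \<le> C"
  shows "(\<integral>\<^sup>+x. ennreal (f x) \<partial>M) \<le> C"
proof -
  have "(\<lambda>n. \<integral>\<^sup>+x. ennreal (min (f x) (real n)) \<partial>M) \<longlonglongrightarrow> (\<integral>\<^sup>+x. ennreal (f x) \<partial>M)"
  proof (rule nn_integral_LIMSEQ)
    show "incseq (\<lambda>n x. ennreal (min (f x) (real n)))"
      by (auto intro!: incseq_SucI le_funI ennreal_leI)
    show "(\<lambda>n. ennreal (min (f x) (real n))) \<longlonglongrightarrow> ennreal (f x)" for x
    proof (rule tendsto_eventually)
      show "\<forall>\<^sub>F n in sequentially. ennreal (min (f x) (real n)) = ennreal (f x)"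
        using eventually_ge_at_top[of "nat \<lceil>f x\<rceil>"]
      proof eventually_elim
        case (elim n)
        then have "f x \<le> real n" by linarith
        then show ?case by (simp add: min_absorb1)
      qed
    qed
  qed measurable
  then show ?thesis by (rule LIMSEQ_le_const2) (use le in auto)
qed

context gibbs_model
begin

section \<open>The DLR equations\<close>

lemma kernel_prob_algebra: "finite \<Lambda> \<Longrightarrow> kernel \<Lambda> \<in> borel \<rightarrow>\<^sub>M prob_algebra borel"
proof (intro measurable_prob_algebraI measurable_subprob_algebra)
  fix A :: "('v \<Rightarrow> real) set" assume fin: "finite \<Lambda>" and [measurable]: "A \<in> sets borel"
  have "(\<lambda>\<xi>. \<integral>\<^sup>+\<eta>. indicator A \<eta> \<partial>kernel \<Lambda> \<xi>) \<in> borel_measurable borel"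
    using fin by measurable
  then show "(\<lambda>\<xi>. emeasure (kernel \<Lambda> \<xi>) A) \<in> borel_measurable borel" by simp
qed (auto intro: prob_space_kernel prob_space_imp_subprob_space)

lemma kernel_subprob_algebra: "finite \<Lambda> \<Longrightarrow> kernel \<Lambda> \<in> borel \<rightarrow>\<^sub>M subprob_algebra borel"
  by (intro measurable_prob_algebraD kernel_prob_algebra)

definition dlr :: "'v set \<Rightarrow> ('v \<Rightarrow> real) measure \<Rightarrow> bool" where
  "dlr \<Lambda> \<mu> \<longleftrightarrow> (\<forall>f\<in>borel_measurable borel. (\<integral>\<^sup>+\<xi>. (\<integral>\<^sup>+\<eta>. f \<eta> \<partial>kernel \<Lambda> \<xi>) \<partial>\<mu>) = (\<integral>\<^sup>+\<eta>. f \<eta> \<partial>\<mu>))"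

text \<open>Both sides are probability measures, \<open>\<mu>\<close> and its image under the
  kernel, so agreement on a generating pi-system is enough. The generator is left open because it is
  all Borel sets for Gibbs measures and the cylinders for limits.\<close>

lemma dlrI:
  assumes fin: "finite \<Lambda>" and \<mu>: "\<mu> \<in> prob_measures"
    and gen: "sets borel = sigma_sets UNIV G" "Int_stable G" "UNIV \<in> G"
    and eq: "\<And>A. A \<in> G \<Longrightarrow> emeasure \<mu> A = (\<integral>\<^sup>+\<xi>. emeasure (kernel \<Lambda> \<xi>) A \<partial>\<mu>)"
  shows "dlr \<Lambda> \<mu>"
proof -
  have sets_\<mu>[measurable_cong, simp]: "sets \<mu> = sets borel" and "prob_space \<mu>"
    using \<mu> by (auto simp: prob_measures_def)
  interpret prob_space \<mu> by fact
  have [simp]: "space \<mu> = UNIV" using sets_eq_imp_space_eq[OF sets_\<mu>] by simp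
  have ker: "kernel \<Lambda> \<in> \<mu> \<rightarrow>\<^sub>M subprob_algebra borel"
    using kernel_subprob_algebra[OF fin] measurable_cong_sets[OF sets_\<mu> refl] by blast
  have \<mu>_alg: "\<mu> \<in> space (prob_algebra borel)"
    using \<open>prob_space \<mu>\<close> by (simp add: space_prob_algebra)
  have b: "emeasure (\<mu> \<bind> kernel \<Lambda>) A = (\<integral>\<^sup>+\<xi>. emeasure (kernel \<Lambda> \<xi>) A \<partial>\<mu>)" if "A \<in> sets borel" for A
    using emeasure_bind_prob_algebra[OF \<mu>_alg kernel_prob_algebra[OF fin] that] .
  have G: "G \<subseteq> sets borel" unfolding gen(1) by auto
  have "\<mu> \<bind> kernel \<Lambda> = \<mu>"
  proof (rule measure_eqI_generator_eq[OF gen(2)])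
    show "emeasure (\<mu> \<bind> kernel \<Lambda>) A = emeasure \<mu> A" if "A \<in> G" for A
      using b[of A] eq[OF that] that G by auto
    show "sets (\<mu> \<bind> kernel \<Lambda>) = sigma_sets UNIV G"
      using sets_bind[of \<mu> "kernel \<Lambda>" borel] gen(1) by simp
    show "range (\<lambda>_::nat. UNIV) \<subseteq> G" using gen(3) by auto
    show "emeasure (\<mu> \<bind> kernel \<Lambda>) UNIV \<noteq> \<infinity>"
      using b[of UNIV] eq[OF gen(3)] emeasure_finite[of UNIV] by simp
  qed (use gen(1) in auto)
  then show ?thesis
    unfolding dlr_def using nn_integral_bind[OF _ ker] by metis
qed

lemma dlr_emeasure:
  assumes "dlr \<Lambda> \<mu>" "A \<in> sets borel" "sets \<mu> = sets borel"
  shows "emeasure \<mu> A = (\<integral>\<^sup>+\<xi>. emeasure (kernel \<Lambda> \<xi>) A \<partial>\<mu>)"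
  using assms unfolding dlr_def by (auto dest!: bspec[of _ _ "indicator A"])

lemma gibbs_iff_dlr:
  "\<mu> \<in> gibbs_measures adj W V \<longleftrightarrow> \<mu> \<in> prob_measures \<and> (\<forall>\<Lambda>. finite \<Lambda> \<longrightarrow> \<Lambda> \<noteq> {} \<longrightarrow> dlr \<Lambda> \<mu>)"
proof (intro iffI conjI allI impI)
  fix \<Lambda> :: "'v set" assume \<mu>: "\<mu> \<in> gibbs_measures adj W V" and fin: "finite \<Lambda>" "\<Lambda> \<noteq> {}"
  show "dlr \<Lambda> \<mu>"
  proof (rule dlrI[OF fin(1)])
    show "sets borel = sigma_sets UNIV (sets (borel :: ('v \<Rightarrow> real) measure))"
      using sets.sigma_sets_eq[of "borel :: ('v \<Rightarrow> real) measure"] by simp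
    show "Int_stable (sets (borel :: ('v \<Rightarrow> real) measure))" by (rule sets.Int_stable)
    show "emeasure \<mu> A = (\<integral>\<^sup>+\<xi>. emeasure (kernel \<Lambda> \<xi>) A \<partial>\<mu>)" if "A \<in> sets borel" for A
      using \<mu> fin that emeasure_kernel[OF that] by (simp add: gibbs_measures_def)
  qed (use \<mu> in \<open>auto simp: gibbs_measures_def\<close>)
next
  assume *: "\<mu> \<in> prob_measures \<and> (\<forall>\<Lambda>. finite \<Lambda> \<longrightarrow> \<Lambda> \<noteq> {} \<longrightarrow> dlr \<Lambda> \<mu>)"
  then have "sets \<mu> = sets borel" by (simp add: prob_measures_def)
  with * show "\<mu> \<in> gibbs_measures adj W V"
    by (auto simp: gibbs_measures_def dlr_emeasure emeasure_kernel[symmetric])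
qed (simp add: gibbs_measures_def)

section \<open>An exhaustion of the graph and the tempered configurations\<close>

definition exhaustion :: "nat \<Rightarrow> 'v set" where
  "exhaustion k = insert r {x. to_nat x \<le> k}"

lemma finite_exhaustion [simp]: "finite (exhaustion k)"
proof -
  have "finite (to_nat -` {..k} :: 'v set)" by (intro finite_vimageI) auto
  then show ?thesis by (simp add: exhaustion_def vimage_def)
qed

text \<open>The root is inserted for this reason: Gibbs measures satisfy the DLR equations for
  non-void volumes.\<close>

lemma exhaustion_nonempty [simp]: "exhaustion k \<noteq> {}"
  by (simp add: exhaustion_def)

lemma exhaustion_mono: "j \<le> k \<Longrightarrow> exhaustion j \<subseteq> exhaustion k"
  by (auto simp: exhaustion_def)

lemma eventually_subset_exhaustion:
  assumes "finite F" shows "\<forall>\<^sub>F k in sequentially. F \<subseteq> exhaustion k"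
proof -
  have "\<forall>\<^sub>F k in sequentially. x \<in> exhaustion k" for x
    using eventually_ge_at_top[of "to_nat x"] by eventually_elim (simp add: exhaustion_def)
  then show ?thesis using eventually_ball_finite[OF assms, of "\<lambda>k x. x \<in> exhaustion k"] by (simp add: subset_eq)
qed

lemma filterlim_exhaustion: "filterlim exhaustion (finite_subsets_at_top UNIV) sequentially"
  unfolding filterlim_finite_subsets_at_top using eventually_subset_exhaustion by simp

abbreviation \<Omega>t :: "('v \<Rightarrow> real) set" where "\<Omega>t \<equiv> Lp_w adj r \<alpha> p"

lemma weighted_sum_tendsto:
  assumes "\<omega> \<in> \<Omega>t"
  shows "(\<lambda>k. weighted_sum (exhaustion k) \<omega>) \<longlonglongrightarrow> wnorm_pow adj r \<alpha> p \<omega>"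
proof -
  have "((\<lambda>x. \<bar>\<omega> x\<bar> powr p * w x) has_sum wnorm_pow adj r \<alpha> p \<omega>) UNIV"
    unfolding wnorm_pow_def using assms by (intro has_sum_infsum) (simp add: Lp_w_def)
  then have "((\<lambda>F. weighted_sum F \<omega>) \<longlongrightarrow> wnorm_pow adj r \<alpha> p \<omega>) (finite_subsets_at_top UNIV)"
    unfolding has_sum_def weighted_sum_def by (simp add: mult.commute)
  then show ?thesis using filterlim_exhaustion by (rule filterlim_compose)
qed

lemma weighted_sum_le_wnorm:
  assumes "\<omega> \<in> \<Omega>t" "finite F"
  shows "weighted_sum F \<omega> \<le> wnorm_pow adj r \<alpha> p \<omega>"
  unfolding weighted_sum_def wnorm_pow_def mult.commute[of "w _"] using assms
  by (intro finite_sum_le_infsum) (auto simp: Lp_w_def)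

text \<open>For nonnegative terms summability is boundedness of partial sums. This expresses
  temperedness by countably many events, each in finitely many coordinates.\<close>

lemma Lp_w_eq: "\<Omega>t = (\<Union>n::nat. \<Inter>k. {\<omega>. weighted_sum (exhaustion k) \<omega> \<le> real n})"
proof (intro set_eqI iffI)
  fix \<omega> assume \<omega>: "\<omega> \<in> \<Omega>t"
  obtain n :: nat where "wnorm_pow adj r \<alpha> p \<omega> \<le> real n" using real_arch_simple by blast
  then show "\<omega> \<in> (\<Union>n::nat. \<Inter>k. {\<omega>. weighted_sum (exhaustion k) \<omega> \<le> real n})"
    using weighted_sum_le_wnorm[OF \<omega> finite_exhaustion] by (auto intro: order_trans)
next
  fix \<omega> assume "\<omega> \<in> (\<Union>n::nat. \<Inter>k. {\<omega>. weighted_sum (exhaustion k) \<omega> \<le> real n})"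
  then obtain n :: nat where n: "\<And>k. weighted_sum (exhaustion k) \<omega> \<le> real n" by auto
  have "(\<lambda>x. w x * \<bar>\<omega> x\<bar> powr p) summable_on UNIV"
  proof (rule nonneg_bdd_above_summable_on)
    show "bdd_above (sum (\<lambda>x. w x * \<bar>\<omega> x\<bar> powr p) ` {F. F \<subseteq> UNIV \<and> finite F})"
    proof (rule bdd_aboveI2)
      fix F assume "F \<in> {F :: 'v set. F \<subseteq> UNIV \<and> finite F}"
      then obtain k where "F \<subseteq> exhaustion k"
        using eventually_subset_exhaustion[of F] eventually_happens[of _ sequentially] by auto
      then have "weighted_sum F \<omega> \<le> weighted_sum (exhaustion k) \<omega>" by (intro weighted_sum_mono) auto
      then show "sum (\<lambda>x. w x * \<bar>\<omega> x\<bar> powr p) F \<le> real n"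
        using n[of k] by (simp add: weighted_sum_def)
    qed
  qed simp
  then show "\<omega> \<in> \<Omega>t" by (simp add: Lp_w_def mult.commute)
qed

lemma Lp_w_measurable [measurable]: "\<Omega>t \<in> sets borel"
  unfolding Lp_w_eq by measurable

section \<open>Boundary terms and moment bounds uniform over tempered measures\<close>

lemma boundary_norm_nonneg: "boundary_norm \<Lambda> \<xi> \<ge> 0"
  unfolding boundary_norm_def by (intro sum_nonneg) auto

lemma boundary_norm_measurable [measurable]: "boundary_norm \<Lambda> \<in> borel_measurable borel"
  unfolding boundary_norm_def[abs_def] by measurable

text \<open>The boundary lies outside the volume, so its norm is at most the tail of the convergent
  series for the norm of \<open>\<omega>\<close>.\<close>

lemma boundary_norm_tendsto:
  assumes "\<omega> \<in> \<Omega>t"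
  shows "(\<lambda>k. boundary_norm (exhaustion k) \<omega>) \<longlonglongrightarrow> 0"
proof (rule tendsto_sandwich[where f="\<lambda>_. 0"])
  show "(\<lambda>k. wnorm_pow adj r \<alpha> p \<omega> - weighted_sum (exhaustion k) \<omega>) \<longlonglongrightarrow> 0"
    using tendsto_diff[OF tendsto_const[of "wnorm_pow adj r \<alpha> p \<omega>"] weighted_sum_tendsto[OF assms]] by simp
  show "\<forall>\<^sub>F k in sequentially. boundary_norm (exhaustion k) \<omega> \<le> wnorm_pow adj r \<alpha> p \<omega> - weighted_sum (exhaustion k) \<omega>"
  proof (intro always_eventually allI)
    fix k
    have "boundary_norm (exhaustion k) \<omega> + weighted_sum (exhaustion k) \<omega> = weighted_sum (nbhd (exhaustion k)) \<omega>"
      unfolding boundary_norm_def weighted_sum_def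
      using sum.subset_diff[OF subset_nbhd finite_nbhd[OF finite_exhaustion]] by (rule sym)
    also have "\<dots> \<le> wnorm_pow adj r \<alpha> p \<omega>" by (intro weighted_sum_le_wnorm assms) simp
    finally show "boundary_norm (exhaustion k) \<omega> \<le> wnorm_pow adj r \<alpha> p \<omega> - weighted_sum (exhaustion k) \<omega>" by simp
  qed
qed (auto intro!: always_eventually boundary_norm_nonneg)

text \<open>One constant is fixed for each \<open>lam\<close>, valid for all volumes and boundary
  conditions; the bounds in \<open>moments\<close> are thereby literally the same for every measure
  and every limit.\<close>

definition moment_const :: "real \<Rightarrow> real" where
  "moment_const lam = (SOME K. K \<ge> 0 \<and> (\<forall>\<Lambda> \<Delta> \<xi>. finite \<Lambda> \<longrightarrow> \<Delta> \<subseteq> \<Lambda> \<longrightarrow>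
    (\<integral>\<^sup>+\<eta>. ennreal (exp (lam * weighted_sum \<Delta> \<eta>)) \<partial>kernel \<Lambda> \<xi>) \<le> ennreal (exp (K + lam * boundary_norm \<Lambda> \<xi>))))"

lemma moment_const:
  assumes "lam > 0"
  shows "moment_const lam \<ge> 0"
    and "finite \<Lambda> \<Longrightarrow> \<Delta> \<subseteq> \<Lambda> \<Longrightarrow> (\<integral>\<^sup>+\<eta>. ennreal (exp (lam * weighted_sum \<Delta> \<eta>)) \<partial>kernel \<Lambda> \<xi>)
        \<le> ennreal (exp (moment_const lam + lam * boundary_norm \<Lambda> \<xi>))"
proof -
  have "\<exists>K. K \<ge> 0 \<and> (\<forall>\<Lambda> \<Delta> \<xi>. finite \<Lambda> \<longrightarrow> \<Delta> \<subseteq> \<Lambda> \<longrightarrow>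
    (\<integral>\<^sup>+\<eta>. ennreal (exp (lam * weighted_sum \<Delta> \<eta>)) \<partial>kernel \<Lambda> \<xi>) \<le> ennreal (exp (K + lam * boundary_norm \<Lambda> \<xi>)))"
  proof -
    obtain K where "K \<ge> 0" "\<And>\<Lambda> \<Delta> \<xi>. finite \<Lambda> \<Longrightarrow> \<Delta> \<subseteq> \<Lambda> \<Longrightarrow>
      (\<integral>\<^sup>+\<eta>. ennreal (exp (lam * weighted_sum \<Delta> \<eta>)) \<partial>kernel \<Lambda> \<xi>) \<le> ennreal (exp (K + lam * boundary_norm \<Lambda> \<xi>))"
      using kernel_exp_moment[OF assms] by blast
    then show ?thesis by (intro exI[of _ K]) simp
  qed
  from someI_ex[OF this]
  show "moment_const lam \<ge> 0"
    and "finite \<Lambda> \<Longrightarrow> \<Delta> \<subseteq> \<Lambda> \<Longrightarrow> (\<integral>\<^sup>+\<eta>. ennreal (exp (lam * weighted_sum \<Delta> \<eta>)) \<partial>kernel \<Lambda> \<xi>)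
        \<le> ennreal (exp (moment_const lam + lam * boundary_norm \<Lambda> \<xi>))"
    unfolding moment_const_def by blast+
qed

text \<open>The boundary term is dropped, so this holds for tempered Gibbs measures and for large
  volumes with zero boundary condition alike, and it survives local limits. All \<open>lam\<close>
  are included because \<open>local_domination\<close> chooses \<open>lam\<close> by the
  volume.\<close>

definition moments :: "'v set \<Rightarrow> ('v \<Rightarrow> real) measure \<Rightarrow> bool" where
  "moments \<Delta> \<mu> \<longleftrightarrow> (\<forall>lam>0. (\<integral>\<^sup>+\<eta>. ennreal (exp (lam * weighted_sum \<Delta> \<eta>)) \<partial>\<mu>) \<le> ennreal (exp (moment_const lam)))"

lemma tempered_AE:
  assumes "\<mu> \<in> prob_measures"
  shows "emeasure \<mu> \<Omega>t = 1 \<longleftrightarrow> (AE \<omega> in \<mu>. \<omega> \<in> \<Omega>t)"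
proof -
  have sets_\<mu>[measurable_cong]: "sets \<mu> = sets borel" and "prob_space \<mu>"
    using assms by (auto simp: prob_measures_def)
  interpret prob_space \<mu> by fact
  have "space \<mu> = UNIV" using sets_eq_imp_space_eq[OF sets_\<mu>] by simp
  then show ?thesis using AE_iff_emeasure_eq_1[of "\<lambda>\<omega>. \<omega> \<in> \<Omega>t"] by simp
qed

text \<open>The boundary contribution in the finite-volume estimate vanishes as the volume
  exhausts the graph, by temperedness; truncation makes dominated convergence applicable.\<close>

lemma tempered_moments:
  assumes "\<mu> \<in> tempered_gibbs adj r \<alpha> p W V" and fin: "finite \<Delta>"
  shows "moments \<Delta> \<mu>"
  unfolding moments_def
proof (intro allI impI)
  fix lam :: real assume lam: "lam > 0"
  have \<mu>: "\<mu> \<in> gibbs_measures adj W V" "emeasure \<mu> \<Omega>t = 1" "\<mu> \<in> prob_measures"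
    using assms by (auto simp: tempered_gibbs_def gibbs_measures_def)
  then have sets_\<mu>[measurable_cong]: "sets \<mu> = sets borel" and "prob_space \<mu>"
    by (auto simp: prob_measures_def)
  interpret prob_space \<mu> by fact
  let ?K = "moment_const lam"
  show "(\<integral>\<^sup>+\<eta>. ennreal (exp (lam * weighted_sum \<Delta> \<eta>)) \<partial>\<mu>) \<le> ennreal (exp ?K)"
  proof (rule nn_integral_le_truncated)
    fix n :: nat
    define f where "f \<eta> = ennreal (min (exp (lam * weighted_sum \<Delta> \<eta>)) (real n))" for \<eta>
    have [measurable]: "f \<in> borel_measurable borel" unfolding f_def[abs_def] by measurable
    define g where "g k \<xi> = ennreal (min (exp (?K + lam * boundary_norm (exhaustion k) \<xi>)) (real n))" for k \<xi>
    have [measurable]: "g k \<in> borel_measurable borel" for k unfolding g_def[abs_def] by measurable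
    have bound: "(\<integral>\<^sup>+\<eta>. f \<eta> \<partial>\<mu>) \<le> (\<integral>\<^sup>+\<xi>. g k \<xi> \<partial>\<mu>)" if "\<Delta> \<subseteq> exhaustion k" for k
    proof -
      have "dlr (exhaustion k) \<mu>" using \<mu> gibbs_iff_dlr by simp
      then have "(\<integral>\<^sup>+\<eta>. f \<eta> \<partial>\<mu>) = (\<integral>\<^sup>+\<xi>. (\<integral>\<^sup>+\<eta>. f \<eta> \<partial>kernel (exhaustion k) \<xi>) \<partial>\<mu>)"
        unfolding dlr_def by simp
      also have "\<dots> \<le> (\<integral>\<^sup>+\<xi>. g k \<xi> \<partial>\<mu>)"
      proof (intro nn_integral_mono)
        fix \<xi>
        interpret P: prob_space "kernel (exhaustion k) \<xi>" by (rule prob_space_kernel) simp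
        have "(\<integral>\<^sup>+\<eta>. f \<eta> \<partial>kernel (exhaustion k) \<xi>) \<le> (\<integral>\<^sup>+\<eta>. ennreal (exp (lam * weighted_sum \<Delta> \<eta>)) \<partial>kernel (exhaustion k) \<xi>)"
          unfolding f_def by (intro nn_integral_mono ennreal_leI) simp
        also have "\<dots> \<le> ennreal (exp (?K + lam * boundary_norm (exhaustion k) \<xi>))"
          using moment_const(2)[OF lam finite_exhaustion that] .
        finally have 1: "(\<integral>\<^sup>+\<eta>. f \<eta> \<partial>kernel (exhaustion k) \<xi>) \<le> ennreal (exp (?K + lam * boundary_norm (exhaustion k) \<xi>))" .
        have "(\<integral>\<^sup>+\<eta>. f \<eta> \<partial>kernel (exhaustion k) \<xi>) \<le> (\<integral>\<^sup>+\<eta>. ennreal (real n) \<partial>kernel (exhaustion k) \<xi>)"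
          unfolding f_def by (intro nn_integral_mono ennreal_leI) simp
        also have "\<dots> = ennreal (real n)" using P.emeasure_space_1 by (simp del: space_kernel)
        finally show "(\<integral>\<^sup>+\<eta>. f \<eta> \<partial>kernel (exhaustion k) \<xi>) \<le> g k \<xi>"
          using 1 unfolding g_def min_def by auto
      qed
      finally show ?thesis .
    qed
    have "(\<lambda>k. \<integral>\<^sup>+\<xi>. g k \<xi> \<partial>\<mu>) \<longlonglongrightarrow> (\<integral>\<^sup>+\<xi>. ennreal (min (exp ?K) (real n)) \<partial>\<mu>)"
    proof (rule nn_integral_dominated_convergence[where w="\<lambda>_. ennreal (real n)"])
      show "AE \<xi> in \<mu>. (\<lambda>k. g k \<xi>) \<longlonglongrightarrow> ennreal (min (exp ?K) (real n))"
        using \<mu>(2) unfolding tempered_AE[OF \<mu>(3)]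
      proof eventually_elim
        fix \<xi> assume "\<xi> \<in> \<Omega>t"
        then have "(\<lambda>k. min (exp (?K + lam * boundary_norm (exhaustion k) \<xi>)) (real n)) \<longlonglongrightarrow> min (exp (?K + lam * 0)) (real n)"
          by (intro tendsto_intros boundary_norm_tendsto)
        then show "(\<lambda>k. g k \<xi>) \<longlonglongrightarrow> ennreal (min (exp ?K) (real n))"
          unfolding g_def by (intro tendsto_ennrealI) simp
      qed
    qed (auto simp: g_def emeasure_space_1 intro!: ennreal_leI)
    then have "(\<integral>\<^sup>+\<eta>. f \<eta> \<partial>\<mu>) \<le> (\<integral>\<^sup>+\<xi>. ennreal (min (exp ?K) (real n)) \<partial>\<mu>)"
    proof (rule tendsto_lowerbound)
      show "\<forall>\<^sub>F k in sequentially. (\<integral>\<^sup>+\<eta>. f \<eta> \<partial>\<mu>) \<le> (\<integral>\<^sup>+\<xi>. g k \<xi> \<partial>\<mu>)"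
        using eventually_subset_exhaustion[OF fin] by eventually_elim (rule bound)
    qed simp
    also have "\<dots> \<le> ennreal (exp ?K)" by (simp add: emeasure_space_1 ennreal_leI)
    finally show "(\<integral>\<^sup>+\<eta>. ennreal (min (exp (lam * weighted_sum \<Delta> \<eta>)) (real n)) \<partial>\<mu>) \<le> ennreal (exp ?K)"
      unfolding f_def .
  qed measurable
qed

text \<open>By \<open>kernel_domination\<close> the boundary condition enters through
  \<open>exp (C * (1 + boundary_sq \<Lambda> \<xi>))\<close>, and exponential moments with a large
  \<open>lam\<close> bound its integral. What remains is one product density on \<Lambda>,
  independent of \<open>\<mu>\<close>.\<close>

lemma local_domination:
  assumes fin: "finite \<Lambda>"
  obtains \<nu> :: "('v \<Rightarrow> real) measure" where "sets \<nu> = sets borel" "finite_measure \<nu>"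
    "\<And>\<mu> A. sets \<mu> = sets borel \<Longrightarrow> dlr \<Lambda> \<mu> \<Longrightarrow> moments (nbhd \<Lambda>) \<mu> \<Longrightarrow> A \<in> sets borel \<Longrightarrow>
      depends_on \<Lambda> (\<lambda>\<omega>. \<omega> \<in> A) \<Longrightarrow> emeasure \<mu> A \<le> emeasure \<nu> A"
proof -
  obtain C where "C \<ge> 0" and C: "\<And>f \<xi>. f \<in> borel_measurable borel \<Longrightarrow>
      partial_integral \<Lambda> (\<lambda>\<eta>. f \<eta> * boltzmann \<Lambda> \<eta>) \<xi> / partition_fun \<Lambda> \<xi>
       \<le> ennreal (exp (C * (1 + boundary_sq \<Lambda> \<xi>))) * partial_integral \<Lambda> (\<lambda>\<eta>. f \<eta> * (\<Prod>x\<in>\<Lambda>. site_bound C (\<eta> x))) \<xi>"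
    using kernel_domination[OF fin] by blast
  \<comment> \<open>Large enough for \<open>C \<le> lam * w y\<close> at every site of the
    neighbourhood, so that squares of spins are controlled by \<open>weighted_sum\<close>; the
    summand 1 guarantees positivity.\<close>
  define lam where "lam = 1 + (\<Sum>y\<in>nbhd \<Lambda>. C / w y)"
  have "lam > 0" unfolding lam_def using \<open>C \<ge> 0\<close> by (auto intro!: add_pos_nonneg sum_nonneg)
  define N where "N = real (card (nbhd \<Lambda>))"
  have bsq: "C * (1 + boundary_sq \<Lambda> \<xi>) \<le> C * (1 + N) + lam * weighted_sum (nbhd \<Lambda>) \<xi>" for \<xi>
  proof -
    have "C * boundary_sq \<Lambda> \<xi> \<le> C * (\<Sum>y\<in>nbhd \<Lambda>. (\<xi> y)\<^sup>2)"
      unfolding boundary_sq_def using fin \<open>C \<ge> 0\<close> by (intro mult_left_mono sum_mono2) auto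
    also have "\<dots> \<le> (\<Sum>y\<in>nbhd \<Lambda>. C + lam * (w y * \<bar>\<xi> y\<bar> powr p))"
      unfolding sum_distrib_left
    proof (intro sum_mono)
      fix y assume y: "y \<in> nbhd \<Lambda>"
      have "C / w y \<le> (\<Sum>y\<in>nbhd \<Lambda>. C / w y)" using y fin \<open>C \<ge> 0\<close> by (intro member_le_sum) auto
      then have "C / w y \<le> lam" unfolding lam_def by simp
      then have "C \<le> lam * w y" by (simp add: pos_divide_le_eq)
      have "C * (\<xi> y)\<^sup>2 \<le> C * (1 + \<bar>\<xi> y\<bar> powr p)"
        using \<open>C \<ge> 0\<close> p_gt_2 by (intro mult_left_mono square_le_1_plus_powr) auto
      also have "\<dots> = C + C * \<bar>\<xi> y\<bar> powr p" by (simp add: algebra_simps)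
      also have "\<dots> \<le> C + (lam * w y) * \<bar>\<xi> y\<bar> powr p"
        using \<open>C \<le> lam * w y\<close> by (intro add_left_mono mult_right_mono) auto
      finally show "C * (\<xi> y)\<^sup>2 \<le> C + lam * (w y * \<bar>\<xi> y\<bar> powr p)" by (simp add: mult.assoc)
    qed
    also have "\<dots> = C * N + lam * weighted_sum (nbhd \<Lambda>) \<xi>"
      by (simp add: sum.distrib N_def weighted_sum_def sum_distrib_left mult.commute)
    finally show ?thesis by (simp add: algebra_simps)
  qed
  define D where "D = ennreal (exp (C * (1 + N))) * ennreal (exp (moment_const lam))"
  define h where "h \<omega> = D * (\<Prod>x\<in>\<Lambda>. site_bound C (\<omega> x))" for \<omega> :: "'v \<Rightarrow> real"
  have h_meas: "h \<in> borel_measurable borel" unfolding h_def[abs_def] by measurable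
  have h_dep: "h (merge_conf \<Lambda> \<omega> \<xi>) = h \<omega>" for \<omega> \<xi>
    unfolding h_def by (auto intro!: prod.cong arg_cong[where f="\<lambda>t. D * t"])
  \<comment> \<open>The value 0 outside \<Lambda> is arbitrary: the comparison concerns events
    determined by the coordinates in \<Lambda>.\<close>
  define \<nu> where "\<nu> = distr (density (PiM \<Lambda> (\<lambda>_. lborel)) (\<lambda>\<omega>. h (merge_conf \<Lambda> \<omega> (\<lambda>_. 0)))) borel
      (\<lambda>\<omega>. merge_conf \<Lambda> \<omega> (\<lambda>_. 0))"
  have \<nu>: "emeasure \<nu> A = D * partial_integral \<Lambda> (\<lambda>\<eta>. indicator A \<eta> * (\<Prod>x\<in>\<Lambda>. site_bound C (\<eta> x))) (\<lambda>_. 0)"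
    if [measurable]: "A \<in> sets borel" for A
  proof -
    note h_meas[measurable]
    have "emeasure \<nu> A = (\<integral>\<^sup>+\<eta>. indicator A \<eta> \<partial>\<nu>)" by (simp add: \<nu>_def)
    also have "\<dots> = (\<integral>\<^sup>+\<omega>. h (merge_conf \<Lambda> \<omega> (\<lambda>_. 0)) * indicator A (merge_conf \<Lambda> \<omega> (\<lambda>_. 0)) \<partial>PiM \<Lambda> (\<lambda>_. lborel))"
      unfolding \<nu>_def by (subst nn_integral_distr, measurable, subst nn_integral_density) measurable
    also have "\<dots> = (\<integral>\<^sup>+\<omega>. D * (indicator A (merge_conf \<Lambda> \<omega> (\<lambda>_. 0)) * (\<Prod>x\<in>\<Lambda>. site_bound C (merge_conf \<Lambda> \<omega> (\<lambda>_. 0) x))) \<partial>PiM \<Lambda> (\<lambda>_. lborel))"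
      by (intro nn_integral_cong) (simp only: h_def mult_ac)
    also have "\<dots> = D * partial_integral \<Lambda> (\<lambda>\<eta>. indicator A \<eta> * (\<Prod>x\<in>\<Lambda>. site_bound C (\<eta> x))) (\<lambda>_. 0)"
      unfolding partial_integral_def
      by (intro nn_integral_cmult measurable_compose[OF measurable_merge_conf1,
            where g="\<lambda>\<eta>. indicator A \<eta> * (\<Prod>x\<in>\<Lambda>. site_bound C (\<eta> x))"]) measurable
    finally show ?thesis .
  qed
  show thesis
  proof (rule that)
    show "sets \<nu> = sets borel" by (simp add: \<nu>_def)
    have "partial_integral \<Lambda> (\<lambda>\<eta>. \<Prod>x\<in>\<Lambda>. site_bound C (\<eta> x)) (\<lambda>_. 0) < \<infinity>"
      using partial_integral_site_bound_finite[OF fin \<open>C \<ge> 0\<close>, of 0 "\<lambda>_. 0"] by simp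
    then have "emeasure \<nu> UNIV < \<infinity>"
      using \<nu>[OF sets.top[of "borel :: ('v \<Rightarrow> real) measure"]]
      by (simp add: D_def ennreal_mult_less_top)
    moreover have "space \<nu> = UNIV" by (simp add: \<nu>_def)
    ultimately show "finite_measure \<nu>" by (intro finite_measureI) simp
    fix \<mu> :: "('v \<Rightarrow> real) measure" and A
    assume sets_\<mu>[measurable_cong]: "sets \<mu> = sets borel" and dlr: "dlr \<Lambda> \<mu>" and mom: "moments (nbhd \<Lambda>) \<mu>"
      and A[measurable]: "A \<in> sets borel" and dep: "depends_on \<Lambda> (\<lambda>\<omega>. \<omega> \<in> A)"
    define G where "G \<xi> = partial_integral \<Lambda> (\<lambda>\<eta>. indicator A \<eta> * (\<Prod>x\<in>\<Lambda>. site_bound C (\<eta> x))) \<xi>" for \<xi>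
    have G_const: "G \<xi> = G (\<lambda>_. 0)" for \<xi>
    proof -
      have "depends_on \<Lambda> (\<lambda>\<eta>. indicator A \<eta> * (\<Prod>x\<in>\<Lambda>. site_bound C (\<eta> x)) :: ennreal)"
        unfolding depends_on_def
      proof (intro allI impI)
        fix \<omega> \<omega>' :: "'v \<Rightarrow> real" assume eq: "\<forall>x\<in>\<Lambda>. \<omega> x = \<omega>' x"
        then have "\<omega> \<in> A \<longleftrightarrow> \<omega>' \<in> A" using dep unfolding depends_on_def by blast
        moreover have "(\<Prod>x\<in>\<Lambda>. site_bound C (\<omega> x)) = (\<Prod>x\<in>\<Lambda>. site_bound C (\<omega>' x))"
          using eq by (intro prod.cong) auto
        ultimately show "indicator A \<omega> * (\<Prod>x\<in>\<Lambda>. site_bound C (\<omega> x))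
            = (indicator A \<omega>' * (\<Prod>x\<in>\<Lambda>. site_bound C (\<omega>' x)) :: ennreal)"
          by (simp add: indicator_def)
      qed
      from depends_onD[OF depends_on_partial_integral[OF this, of \<Lambda>]] show ?thesis unfolding G_def by auto
    qed
    have "emeasure \<mu> A = (\<integral>\<^sup>+\<xi>. emeasure (kernel \<Lambda> \<xi>) A \<partial>\<mu>)" by (rule dlr_emeasure[OF dlr A sets_\<mu>])
    also have "\<dots> \<le> (\<integral>\<^sup>+\<xi>. (ennreal (exp (C * (1 + N))) * G (\<lambda>_. 0)) * ennreal (exp (lam * weighted_sum (nbhd \<Lambda>) \<xi>)) \<partial>\<mu>)"
    proof (intro nn_integral_mono)
      fix \<xi>
      have "emeasure (kernel \<Lambda> \<xi>) A = (\<integral>\<^sup>+\<eta>. indicator A \<eta> \<partial>kernel \<Lambda> \<xi>)" by simp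
      also have "\<dots> \<le> ennreal (exp (C * (1 + boundary_sq \<Lambda> \<xi>))) * G \<xi>"
        unfolding G_def by (subst nn_integral_kernel) (auto intro!: C)
      also have "\<dots> \<le> ennreal (exp (C * (1 + N) + lam * weighted_sum (nbhd \<Lambda>) \<xi>)) * G (\<lambda>_. 0)"
        unfolding G_const[of \<xi>] by (intro mult_right_mono ennreal_leI) (auto intro: bsq)
      also have "\<dots> = (ennreal (exp (C * (1 + N))) * G (\<lambda>_. 0)) * ennreal (exp (lam * weighted_sum (nbhd \<Lambda>) \<xi>))"
        by (simp only: exp_add ennreal_mult exp_ge_zero mult_ac)
      finally show "emeasure (kernel \<Lambda> \<xi>) A \<le> (ennreal (exp (C * (1 + N))) * G (\<lambda>_. 0)) * ennreal (exp (lam * weighted_sum (nbhd \<Lambda>) \<xi>))" .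
    qed
    also have "\<dots> = (ennreal (exp (C * (1 + N))) * G (\<lambda>_. 0)) * (\<integral>\<^sup>+\<xi>. ennreal (exp (lam * weighted_sum (nbhd \<Lambda>) \<xi>)) \<partial>\<mu>)"
      by (intro nn_integral_cmult) measurable
    also have "\<dots> \<le> (ennreal (exp (C * (1 + N))) * G (\<lambda>_. 0)) * ennreal (exp (moment_const lam))"
      using mom \<open>lam > 0\<close> unfolding moments_def by (intro mult_left_mono) auto
    also have "\<dots> = emeasure \<nu> A" by (simp only: \<nu>[OF A] D_def G_def mult_ac)
    finally show "emeasure \<mu> A \<le> emeasure \<nu> A" .
  qed
qed

end

section \<open>Local convergence of measures\<close>

text \<open>Tannery's theorem, dominated convergence for series, with the summable majorant
  \<open>measure \<nu> (A i)\<close>. Exchanging the limit with a countable union is the purpose of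
  the domination.\<close>

lemma measure_disjoint_UN_tendsto:
  fixes N :: "nat \<Rightarrow> 'a measure" and B :: "'a measure"
  assumes N: "\<And>n. prob_space (N n)" "\<And>n. sets (N n) = sets B"
    and \<nu>: "finite_measure \<nu>" "sets \<nu> = sets B"
    and dom: "\<forall>\<^sub>F n in sequentially. \<forall>A\<in>sets B. measure (N n) A \<le> measure \<nu> A"
    and A: "range A \<subseteq> sets B" "disjoint_family A"
    and l: "\<And>i::nat. (\<lambda>n. measure (N n) (A i)) \<longlonglongrightarrow> l i"
  shows "summable l" "(\<lambda>n. measure (N n) (\<Union>i. A i)) \<longlonglongrightarrow> suminf l"
proof -
  interpret \<nu>: finite_measure \<nu> by fact
  have sums: "(\<lambda>i. measure (N n) (A i)) sums measure (N n) (\<Union>i. A i)" for n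
  proof -
    interpret prob_space "N n" by (rule N)
    show ?thesis using A N(2) by (intro finite_measure_UNION) auto
  qed
  have "(\<lambda>i. measure \<nu> (A i)) sums measure \<nu> (\<Union>i. A i)"
    using A \<nu>(2) by (intro \<nu>.finite_measure_UNION) auto
  then have "summable (\<lambda>i. measure \<nu> (A i))" by (rule sums_summable)
  moreover have "\<forall>\<^sub>F (i, n) in at_top \<times>\<^sub>F sequentially. norm (measure (N n) (A i)) \<le> measure \<nu> (A i)"
  proof -
    have "\<forall>\<^sub>F x in at_top \<times>\<^sub>F sequentially. True \<and> (\<forall>A\<in>sets B. measure (N (snd x)) A \<le> measure \<nu> A)"
      by (rule eventually_prodI[OF always_eventually dom]) simp
    then show ?thesis by eventually_elim (use A in auto)
  qed
  ultimately have *: "summable (\<lambda>i. norm (l i)) \<and> (\<lambda>n. \<Sum>i. measure (N n) (A i)) \<longlonglongrightarrow> suminf l"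
    using tannerys_theorem[of "\<lambda>i n. measure (N n) (A i)" l sequentially "\<lambda>i. measure \<nu> (A i)"] l by auto
  then show "summable l" using summable_norm_cancel by blast
  show "(\<lambda>n. measure (N n) (\<Union>i. A i)) \<longlonglongrightarrow> suminf l"
    using * sums by (simp add: sums_iff)
qed

text \<open>Convergence spreads from the pi-system to the sigma-algebra by Dynkin's argument, whose
  disjoint-union step is the exchange above. The same exchange makes the limit countably
  additive.\<close>

lemma setwise_limit_measure:
  fixes N :: "nat \<Rightarrow> 'a measure" and B :: "'a measure"
  assumes N: "\<And>n. prob_space (N n)" "\<And>n. sets (N n) = sets B"
    and \<nu>: "finite_measure \<nu>" "sets \<nu> = sets B"
    and dom: "\<forall>\<^sub>F n in sequentially. \<forall>A\<in>sets B. measure (N n) A \<le> measure \<nu> A"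
    and G: "sets B = sigma_sets (space B) G" "Int_stable G"
    and conv: "\<And>A. A \<in> G \<Longrightarrow> convergent (\<lambda>n. measure (N n) A)"
  obtains Q where "prob_space Q" "sets Q = sets B"
    "\<And>A. A \<in> sets B \<Longrightarrow> (\<lambda>n. measure (N n) A) \<longlonglongrightarrow> measure Q A"
proof -
  have space_N: "space (N n) = space B" for n using N(2) by (rule sets_eq_imp_space_eq)
  have conv': "convergent (\<lambda>n. measure (N n) A)" if "A \<in> sets B" for A
  proof -
    have "G \<subseteq> Pow (space B)" using G(1) sets.sets_into_space by blast
    from G(2) this that[unfolded G(1)] show ?thesis
    proof (induction rule: sigma_sets_induct_disjoint)
      case (compl A)
      have "measure (N n) (space B - A) = 1 - measure (N n) A" for n
      proof -
        interpret prob_space "N n" by (rule N)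
        show ?thesis using prob_compl[of A] compl N(2) space_N G(1) by simp
      qed
      then show ?case using compl by (simp add: convergent_diff convergent_const)
    next
      case (union A)
      then have l: "\<And>i. (\<lambda>n. measure (N n) (A i)) \<longlonglongrightarrow> lim (\<lambda>n. measure (N n) (A i))"
        by (simp add: convergent_LIMSEQ_iff)
      show ?case
        by (rule convergentI[OF measure_disjoint_UN_tendsto(2)[OF N \<nu> dom _ _ l]]) (use union G(1) in auto)
    qed (auto simp: conv convergent_const)
  qed
  define L where "L A = lim (\<lambda>n. measure (N n) A)" for A
  have L: "(\<lambda>n. measure (N n) A) \<longlonglongrightarrow> L A" if "A \<in> sets B" for A
    using conv'[OF that] unfolding L_def by (simp add: convergent_LIMSEQ_iff)
  have L0: "L A \<ge> 0" if "A \<in> sets B" for A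
    using L[OF that] by (rule LIMSEQ_le_const) auto
  define Q where "Q = measure_of (space B) (sets B) (\<lambda>A. ennreal (L A))"
  have sets_Q: "sets Q = sets B" and space_Q: "space Q = space B" by (simp_all add: Q_def)
  have Q: "emeasure Q A = ennreal (L A)" if "A \<in> sets B" for A
    unfolding Q_def
  proof (rule emeasure_measure_of_sigma[OF _ _ _ that])
    show "sigma_algebra (space B) (sets B)" by (rule sets.sigma_algebra_axioms)
    show "positive (sets B) (\<lambda>A. ennreal (L A))" by (simp add: positive_def L_def)
    show "countably_additive (sets B) (\<lambda>A. ennreal (L A))"
    proof (rule countably_additiveI)
      fix A :: "nat \<Rightarrow> 'a set" assume A: "range A \<subseteq> sets B" "disjoint_family A"
      have lA: "\<And>i. (\<lambda>n. measure (N n) (A i)) \<longlonglongrightarrow> L (A i)" using A by (intro L) auto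
      have "(\<Sum>i. ennreal (L (A i))) = ennreal (\<Sum>i. L (A i))"
        using A by (intro suminf_ennreal2 L0 measure_disjoint_UN_tendsto(1)[OF N \<nu> dom A lA]) auto
      also have "(\<Sum>i. L (A i)) = L (\<Union>i. A i)"
        using measure_disjoint_UN_tendsto(2)[OF N \<nu> dom A lA] L[of "\<Union>i. A i"] A LIMSEQ_unique by blast
      finally show "(\<Sum>i. ennreal (L (A i))) = ennreal (L (\<Union>i. A i))" .
    qed
  qed
  have mQ: "measure Q A = L A" if "A \<in> sets B" for A
    using Q[OF that] L0[OF that] by (simp add: measure_def)
  show thesis
  proof (rule that)
    show "prob_space Q"
    proof
      have "measure (N n) (space B) = 1" for n
        using prob_space.prob_space[OF N(1)[of n]] space_N by simp
      then have "L (space B) = 1" using L[of "space B"] LIMSEQ_unique[OF _ tendsto_const] by force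
      then show "emeasure Q (space Q) = 1" using Q[of "space B"] space_Q by simp
    qed
  qed (use sets_Q mQ L in auto)
qed

section \<open>A countable generator and the construction of local limits\<close>

definition cylinder :: "('v \<times> rat) set \<Rightarrow> ('v \<Rightarrow> real) set" where
  "cylinder S = {\<omega>. \<forall>(x, t)\<in>S. \<omega> x \<le> of_rat t}"

lemma cylinder_measurable [measurable]:
  fixes S :: "('v::countable \<times> rat) set"
  assumes "finite S" shows "cylinder S \<in> sets borel"
proof -
  have "cylinder S = (\<Inter>s\<in>S. {\<omega>. \<omega> (fst s) \<le> of_rat (snd s)}) \<inter> space borel"
    by (fastforce simp: cylinder_def)
  also have "\<dots> \<in> sets borel" using assms by measurable
  finally show ?thesis .
qed

lemma Int_stable_cylinder: "Int_stable (cylinder ` Collect finite :: ('v \<Rightarrow> real) set set)"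
proof (rule Int_stableI)
  fix A B :: "('v \<Rightarrow> real) set"
  assume "A \<in> cylinder ` Collect finite" "B \<in> cylinder ` Collect finite"
  then obtain S T :: "('v \<times> rat) set" where "finite S" "finite T" "A = cylinder S" "B = cylinder T" by blast
  then have "A \<inter> B = cylinder (S \<union> T)" "finite (S \<union> T)" by (auto simp: cylinder_def)
  then show "A \<inter> B \<in> cylinder ` Collect finite" by blast
qed

text \<open>Rational thresholds keep the generator countable, as subsequences and the embedding used
  for compactness require. A real threshold is recovered as the infimum of the rational ones above
  it.\<close>

lemma sets_borel_cylinder:
  "sets (borel :: ('v::countable \<Rightarrow> real) measure) = sigma_sets UNIV (cylinder ` Collect finite)"
proof
  let ?G = "cylinder ` Collect finite :: ('v \<Rightarrow> real) set set"
  have "?G \<subseteq> sets borel" by auto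
  then show "sigma_sets UNIV ?G \<subseteq> sets borel"
    using sets.sigma_sets_subset[of ?G "borel :: ('v \<Rightarrow> real) measure"] by auto
  have "(\<lambda>\<omega>. \<omega>) \<in> measurable (sigma UNIV ?G) (borel :: ('v \<Rightarrow> real) measure)"
  proof (rule measurable_coordinatewise_then_product)
    fix x :: 'v
    show "(\<lambda>\<omega>. \<omega> x) \<in> borel_measurable (sigma UNIV ?G)"
      unfolding borel_measurable_iff_le
    proof
      fix a :: real
      have "{\<omega> \<in> space (sigma UNIV ?G). \<omega> x \<le> a} = (\<Inter>t\<in>{t. a \<le> of_rat t}. cylinder {(x, t)})"
      proof (intro set_eqI iffI)
        fix \<omega> assume \<omega>: "\<omega> \<in> (\<Inter>t\<in>{t. a \<le> of_rat t}. cylinder {(x, t)})"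
        have "\<omega> x \<le> a"
        proof (rule ccontr)
          assume "\<not> \<omega> x \<le> a"
          then obtain t where "a < of_rat t" "of_rat t < \<omega> x" using of_rat_dense[of a "\<omega> x"] by auto
          moreover from this have "\<omega> x \<le> of_rat t"
            using \<omega> less_imp_le[of a "of_rat t"] by (auto simp: cylinder_def)
          ultimately show False by simp
        qed
        then show "\<omega> \<in> {\<omega> \<in> space (sigma UNIV ?G). \<omega> x \<le> a}" by (simp add: space_measure_of_conv)
      qed (auto simp: cylinder_def)
      also have "\<dots> \<in> sets (sigma UNIV ?G)"
      proof (rule sets.countable_INT')
        obtain t where "a < of_rat t" using of_rat_dense[of a "a + 1"] by auto
        then show "{t. a \<le> of_rat t} \<noteq> {}" by (auto intro: less_imp_le)
      qed auto
      finally show "{\<omega> \<in> space (sigma UNIV ?G). \<omega> x \<le> a} \<in> sets (sigma UNIV ?G)" .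
    qed
  qed
  from measurable_sets[OF this]
  show "sets borel \<subseteq> sigma_sets UNIV ?G" by (auto simp: space_measure_of_conv)
qed

text \<open>Setwise, not merely weak, convergence of the finite-dimensional marginals: bounded
  measurable functions of finitely many coordinates are admissible test functions.\<close>

definition local_convergence :: "(nat \<Rightarrow> ('v::countable \<Rightarrow> real) measure) \<Rightarrow> ('v \<Rightarrow> real) measure \<Rightarrow> bool" where
  "local_convergence \<mu> \<mu>' \<longleftrightarrow> (\<forall>\<Lambda> A. finite \<Lambda> \<longrightarrow> A \<in> sets borel \<longrightarrow> depends_on \<Lambda> (\<lambda>\<omega>. \<omega> \<in> A) \<longrightarrow>
     (\<lambda>n. measure (\<mu> n) A) \<longlonglongrightarrow> measure \<mu>' A)"

lemma depends_on_cylinder: "depends_on (fst ` S) (\<lambda>\<omega>. \<omega> \<in> cylinder S)"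
  unfolding depends_on_def cylinder_def by fastforce

text \<open>Setwise limits exist on each finite volume; Kolmogorov's theorem glues them together.\<close>

lemma local_limit_exists:
  fixes \<mu> :: "nat \<Rightarrow> ('v::countable \<Rightarrow> real) measure"
  assumes \<mu>: "\<And>n. \<mu> n \<in> prob_measures"
    and dom: "\<And>\<Lambda>. finite \<Lambda> \<Longrightarrow> \<exists>\<nu>. sets \<nu> = sets borel \<and> finite_measure \<nu> \<and>
      (\<forall>\<^sub>F n in sequentially. \<forall>A\<in>sets borel. depends_on \<Lambda> (\<lambda>\<omega>. \<omega> \<in> A) \<longrightarrow> measure (\<mu> n) A \<le> measure \<nu> A)"
    and conv: "\<And>S. finite S \<Longrightarrow> convergent (\<lambda>n. measure (\<mu> n) (cylinder S))"
  obtains \<mu>' where "\<mu>' \<in> prob_measures" "local_convergence \<mu> \<mu>'"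
proof -
  have sets_\<mu>[measurable_cong, simp]: "sets (\<mu> n) = sets borel" and prob_\<mu>: "prob_space (\<mu> n)" for n
    using \<mu>[of n] by (auto simp: prob_measures_def)
  have space_\<mu>[simp]: "space (\<mu> n) = UNIV" for n using sets_eq_imp_space_eq[OF sets_\<mu>[of n]] by simp
  \<comment> \<open>Resetting the outer coordinates to 0 realises the marginal on \<Lambda> as a
    measure on the full configuration space, where the cylinders generate.\<close>
  let ?\<rho> = "\<lambda>\<Lambda> \<omega>. merge_conf \<Lambda> \<omega> (\<lambda>_. 0) :: 'v \<Rightarrow> real"
  have "\<exists>Q. prob_space Q \<and> sets Q = sets borel \<and>
      (\<forall>A\<in>sets borel. (\<lambda>n. measure (\<mu> n) (?\<rho> \<Lambda> -` A)) \<longlonglongrightarrow> measure Q A)" if fin: "finite \<Lambda>" for \<Lambda>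
  proof -
    obtain \<nu> where \<nu>: "sets \<nu> = sets borel" "finite_measure \<nu>"
      and dom': "\<forall>\<^sub>F n in sequentially. \<forall>A\<in>sets borel. depends_on \<Lambda> (\<lambda>\<omega>. \<omega> \<in> A) \<longrightarrow> measure (\<mu> n) A \<le> measure \<nu> A"
      using dom[OF fin] by blast
    have [measurable_cong, simp]: "sets \<nu> = sets borel" by fact
    have [simp]: "space \<nu> = UNIV" using sets_eq_imp_space_eq[OF \<nu>(1)] by simp
    interpret \<nu>: finite_measure \<nu> by fact
    have md: "measure (distr M borel (?\<rho> \<Lambda>)) A = measure M (?\<rho> \<Lambda> -` A)"
      if "sets M = sets borel" "A \<in> sets borel" for M A
    proof -
      have "?\<rho> \<Lambda> \<in> M \<rightarrow>\<^sub>M borel" using measurable_cong_sets[OF that(1) refl] measurable_merge_conf_borel by blast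
      then show ?thesis using that sets_eq_imp_space_eq[OF that(1)] by (simp add: measure_distr)
    qed
    have dep: "depends_on \<Lambda> (\<lambda>\<omega>. \<omega> \<in> ?\<rho> \<Lambda> -` A)" for A
    proof -
      have "?\<rho> \<Lambda> \<omega> = ?\<rho> \<Lambda> \<omega>'" if "\<forall>x\<in>\<Lambda>. \<omega> x = \<omega>' x" for \<omega> \<omega>' :: "'v \<Rightarrow> real"
        using that by (auto simp: merge_conf_def)
      then show ?thesis unfolding depends_on_def vimage_eq by metis
    qed
    have pre: "?\<rho> \<Lambda> -` A \<in> sets borel" if "A \<in> sets borel" for A
      using measurable_sets[OF measurable_merge_conf_borel that, of \<Lambda> "\<lambda>_. 0"] by simp
    obtain Q where Q: "prob_space Q" "sets Q = sets (borel :: ('v \<Rightarrow> real) measure)"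
      "\<And>A. A \<in> sets (borel :: ('v \<Rightarrow> real) measure) \<Longrightarrow> (\<lambda>n. measure (distr (\<mu> n) borel (?\<rho> \<Lambda>)) A) \<longlonglongrightarrow> measure Q A"
    proof (rule setwise_limit_measure[where N="\<lambda>n. distr (\<mu> n) borel (?\<rho> \<Lambda>)" and B=borel
          and \<nu>="distr \<nu> borel (?\<rho> \<Lambda>)" and G="cylinder ` Collect finite"])
      show "prob_space (distr (\<mu> n) borel (?\<rho> \<Lambda>))" for n
        by (intro prob_space.prob_space_distr prob_\<mu>) measurable
      show "finite_measure (distr \<nu> borel (?\<rho> \<Lambda>))"
        by (intro \<nu>.finite_measure_distr) measurable
      show "\<forall>\<^sub>F n in sequentially. \<forall>A\<in>sets borel. measure (distr (\<mu> n) borel (?\<rho> \<Lambda>)) A \<le> measure (distr \<nu> borel (?\<rho> \<Lambda>)) A"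
        using dom' by eventually_elim (use dep pre in \<open>auto simp: md\<close>)
      show "convergent (\<lambda>n. measure (distr (\<mu> n) borel (?\<rho> \<Lambda>)) A)" if "A \<in> cylinder ` Collect finite" for A
      proof -
        obtain S where S: "finite S" "A = cylinder S" using \<open>A \<in> cylinder ` Collect finite\<close> by blast
        \<comment> \<open>Constraints at vertices outside \<Lambda> test the value 0, so each is
          void or impossible; only those collected in \<open>S'\<close> remain.\<close>
        define S' where "S' = {(x, t) \<in> S. x \<in> \<Lambda>}"
        have "finite S'" using S by (auto simp: S'_def intro: finite_subset[of _ S])
        have "?\<rho> \<Lambda> -` A = (if \<forall>(x, t)\<in>S. x \<notin> \<Lambda> \<longrightarrow> 0 \<le> (of_rat t :: real) then cylinder S' else {})"
          unfolding S S'_def cylinder_def merge_conf_def by (auto split: if_splits) force+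
        moreover have "A \<in> sets borel" using S by simp
        ultimately show ?thesis using conv[OF \<open>finite S'\<close>] by (simp add: md convergent_const)
      qed
    qed (auto simp: sets_borel_cylinder Int_stable_cylinder)
    then show ?thesis by (intro exI[of _ Q]) (auto simp: md)
  qed
  then obtain Q where Q_prob: "\<And>\<Lambda>. finite \<Lambda> \<Longrightarrow> prob_space (Q \<Lambda>)"
    and Q_sets: "\<And>\<Lambda>. finite \<Lambda> \<Longrightarrow> sets (Q \<Lambda>) = sets borel"
    and Q: "\<And>\<Lambda> A. finite \<Lambda> \<Longrightarrow> A \<in> sets borel \<Longrightarrow> (\<lambda>n. measure (\<mu> n) (?\<rho> \<Lambda> -` A)) \<longlonglongrightarrow> measure (Q \<Lambda>) A"
    by metis
  \<comment> \<open>The limits are moved to the finite products, the form of a projective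
    family.\<close>
  define P where "P \<Lambda> = distr (Q \<Lambda>) (PiM \<Lambda> (\<lambda>_. borel :: real measure)) (\<lambda>\<omega>. restrict \<omega> \<Lambda>)" for \<Lambda>
  have restr: "(\<lambda>\<omega>. restrict \<omega> \<Lambda>) \<in> borel \<rightarrow>\<^sub>M PiM \<Lambda> (\<lambda>_. borel :: real measure)" for \<Lambda> :: "'v set"
    by (intro measurable_restrict measurable_product_coordinates)
  have restr_Q: "(\<lambda>\<omega>. restrict \<omega> \<Lambda>) \<in> Q \<Lambda> \<rightarrow>\<^sub>M PiM \<Lambda> (\<lambda>_. borel :: real measure)" if "finite \<Lambda>" for \<Lambda>
    using restr measurable_cong_sets[OF Q_sets[OF that] refl] by blast
  have P_prob: "prob_space (P \<Lambda>)" if "finite \<Lambda>" for \<Lambda>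
    unfolding P_def by (intro prob_space.prob_space_distr Q_prob restr_Q that)
  have P: "(\<lambda>n. measure (\<mu> n) ((\<lambda>\<omega>. restrict \<omega> \<Lambda>) -` X)) \<longlonglongrightarrow> measure (P \<Lambda>) X"
    if fin: "finite \<Lambda>" and X: "X \<in> sets (PiM \<Lambda> (\<lambda>_. borel))" for \<Lambda> X
  proof -
    have "measure (P \<Lambda>) X = measure (Q \<Lambda>) ((\<lambda>\<omega>. restrict \<omega> \<Lambda>) -` X)"
      unfolding P_def using X sets_eq_imp_space_eq[OF Q_sets[OF fin]]
      by (subst measure_distr[OF restr_Q[OF fin]]) auto
    moreover have "(\<lambda>\<omega>. restrict \<omega> \<Lambda>) -` X \<in> sets borel" using measurable_sets[OF restr X] by simp
    moreover have "?\<rho> \<Lambda> -` ((\<lambda>\<omega>. restrict \<omega> \<Lambda>) -` X) = (\<lambda>\<omega>. restrict \<omega> \<Lambda>) -` X"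
      by (auto simp: restrict_def merge_conf_def cong: if_cong)
    ultimately show ?thesis using Q[OF fin] by metis
  qed
  have sets_P: "sets (P \<Lambda>) = sets (PiM \<Lambda> (\<lambda>_. borel))" for \<Lambda> by (simp add: P_def)
  interpret PL: polish_projective UNIV P
  proof (intro polish_projective.intro projective_family.intro)
    fix J H :: "'v set" assume JH: "J \<subseteq> H" and finH: "finite H"
    have finJ: "finite J" using JH finH by (rule finite_subset)
    interpret J: prob_space "P J" by (rule P_prob[OF finJ])
    interpret H: prob_space "P H" by (rule P_prob[OF finH])
    have rH: "(\<lambda>f. restrict f J) \<in> P H \<rightarrow>\<^sub>M PiM J (\<lambda>_. borel)"
      using measurable_restrict_subset[OF JH, of "\<lambda>_. borel :: real measure"] measurable_cong_sets[OF sets_P refl] by blast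
    show "P J = distr (P H) (PiM J (\<lambda>_. borel)) (\<lambda>f. restrict f J)"
    proof (rule measure_eqI)
      show "sets (P J) = sets (distr (P H) (PiM J (\<lambda>_. borel)) (\<lambda>f. restrict f J))" by (simp add: sets_P)
      fix X assume "X \<in> sets (P J)"
      then have X: "X \<in> sets (PiM J (\<lambda>_. borel))" by (simp add: sets_P)
      let ?Y = "(\<lambda>f. restrict f J) -` X \<inter> space (P H)"
      have Y: "?Y \<in> sets (PiM H (\<lambda>_. borel))" using measurable_sets[OF rH X] by (simp add: sets_P)
      have "(\<lambda>\<omega>. restrict \<omega> H) -` ?Y = (\<lambda>\<omega>. restrict \<omega> J) -` X"
        using JH sets_eq_imp_space_eq[OF sets_P, of H]
        by (auto simp: space_PiM Int_absorb1)
      \<comment> \<open>Consistency of the marginals is uniqueness of limits: both sides are limits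
        of the \<open>\<mu> n\<close>-measures of the same event.\<close>
      then have "measure (P J) X = measure (P H) ?Y"
        using P[OF finJ X] P[OF finH Y] LIMSEQ_unique by metis
      then show "emeasure (P J) X = emeasure (distr (P H) (PiM J (\<lambda>_. borel)) (\<lambda>f. restrict f J)) X"
        by (simp add: emeasure_distr[OF rH X] J.emeasure_eq_measure H.emeasure_eq_measure)
    qed
  qed (rule P_prob)
  define \<mu>' where "\<mu>' = PL.lim"
  have sets_\<mu>': "sets \<mu>' = sets borel"
    unfolding \<mu>'_def PL.sets_lim by (rule sets_PiM_equal_borel)
  show thesis
  proof (rule that[of \<mu>'])
    show "\<mu>' \<in> prob_measures"
      using sets_\<mu>' PL.P.prob_space_axioms unfolding prob_measures_def \<mu>'_def by simp
    show "local_convergence \<mu> \<mu>'"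
      unfolding local_convergence_def
    proof (intro allI impI)
      fix \<Lambda> :: "'v set" and A :: "('v \<Rightarrow> real) set"
      assume fin: "finite \<Lambda>" and A: "A \<in> sets borel" and dep: "depends_on \<Lambda> (\<lambda>\<omega>. \<omega> \<in> A)"
      define X where "X = ?\<rho> \<Lambda> -` A \<inter> space (PiM \<Lambda> (\<lambda>_. borel :: real measure))"
      have "?\<rho> \<Lambda> \<in> PiM \<Lambda> (\<lambda>_. borel :: real measure) \<rightarrow>\<^sub>M borel"
        using measurable_merge_conf1[of \<Lambda> "\<lambda>_. 0"] measurable_cong_sets[OF sets_PiM_cong refl, of \<Lambda> \<Lambda> "\<lambda>_. lborel" "\<lambda>_. borel"]
        by simp
      from measurable_sets[OF this A] have X: "X \<in> sets (PiM \<Lambda> (\<lambda>_. borel))" by (simp add: X_def)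
      have eq: "(\<lambda>\<omega>. restrict \<omega> \<Lambda>) -` X = A"
      proof -
        have "?\<rho> \<Lambda> (restrict \<omega> \<Lambda>) \<in> A \<longleftrightarrow> \<omega> \<in> A" for \<omega>
          by (rule depends_onD[OF dep]) auto
        then show ?thesis by (auto simp: X_def space_PiM)
      qed
      have "prod_emb UNIV (\<lambda>_. borel :: real measure) \<Lambda> X = A"
        using eq by (auto simp: prod_emb_def space_PiM vimage_def)
      then have "measure \<mu>' A = measure (P \<Lambda>) X"
        using PL.emeasure_lim_emb[OF _ fin X] by (simp add: \<mu>'_def measure_def)
      then show "(\<lambda>n. measure (\<mu> n) A) \<longlonglongrightarrow> measure \<mu>' A"
        using P[OF fin X] eq by simp
    qed
  qed
qed

text \<open>There are countably many cylinders, so their probabilities form a sequence of points in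
  a countable power of the unit interval; its compactness takes the place of a diagonal
  argument.\<close>

lemma convergent_cylinder_subsequence:
  fixes \<mu> :: "nat \<Rightarrow> ('v::countable \<Rightarrow> real) measure"
  assumes \<mu>: "\<And>n. prob_space (\<mu> n)"
  obtains s where "strict_mono s" "\<And>S. finite S \<Longrightarrow> convergent (\<lambda>n. measure (\<mu> (s n)) (cylinder S))"
proof -
  define S where "S = from_nat_into (Collect finite :: ('v \<times> rat) set set)"
  define e where "e n j = measure (\<mu> n) (cylinder (S j))" for n j
  have "compact (PiE UNIV (\<lambda>_::nat. {0..1::real}))"
    using compactin_PiE[of "\<lambda>_. euclidean" UNIV "\<lambda>_. {0..1::real}"] by (simp add: euclidean_product_topology)
  then have "seq_compact (PiE UNIV (\<lambda>_::nat. {0..1::real}))" by (rule compact_imp_seq_compact)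
  moreover have "e n \<in> PiE UNIV (\<lambda>_::nat. {0..1::real})" for n
    using prob_space.prob_le_1[OF \<mu>] by (auto simp: e_def)
  ultimately obtain l s where s: "strict_mono s" "(e \<circ> s) \<longlonglongrightarrow> l"
    unfolding seq_compact_def by metis
  show thesis
  proof (rule that[OF s(1)])
    fix T :: "('v \<times> rat) set" assume "finite T"
    have "countable (Collect finite :: ('v \<times> rat) set set)" by (rule countable_Collect_finite)
    then obtain j where j: "S j = T"
      using from_nat_into_surj[of "Collect finite" T] \<open>finite T\<close> unfolding S_def by blast
    have "(\<lambda>n. (e \<circ> s) n j) \<longlonglongrightarrow> l j"
      using continuous_on_tendsto_compose[OF continuous_on_product_coordinates s(2)] by simp
    then show "convergent (\<lambda>n. measure (\<mu> (s n)) (cylinder T))"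
      by (auto simp: e_def j intro: convergentI)
  qed
qed

text \<open>The distribution functions of \<open>f\<close> converge at every point because sublevel
  sets of \<open>f\<close> are local events. The laws of \<open>f\<close> thus converge weakly on
  the line, and the identity truncated at \<open>C\<close>, which does not change \<open>f\<close>,
  is a bounded continuous test function.\<close>

lemma local_convergence_integral:
  assumes \<mu>: "\<And>n. \<mu> n \<in> prob_measures" "\<mu>' \<in> prob_measures" and loc: "local_convergence \<mu> \<mu>'"
    and f: "f \<in> borel_measurable borel" "depends_on \<Lambda> f" "finite \<Lambda>" "\<And>\<omega>. \<bar>f \<omega>\<bar> \<le> C"
  shows "(\<lambda>n. integral\<^sup>L (\<mu> n) f) \<longlonglongrightarrow> (integral\<^sup>L \<mu>' f :: real)"
proof -
  have f_meas: "f \<in> borel_measurable M" if "M \<in> prob_measures" for M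
  proof -
    have "sets M = sets borel" using that by (simp add: prob_measures_def)
    then show ?thesis unfolding measurable_cong_sets[OF \<open>sets M = sets borel\<close> refl] by (intro f(1))
  qed
  have sp: "space M = UNIV" if "M \<in> prob_measures" for M :: "('b \<Rightarrow> real) measure"
    using that sets_eq_imp_space_eq[of M borel] by (auto simp: prob_measures_def)
  have rd: "real_distribution (distr M borel f)" if "M \<in> prob_measures" for M
    using f_meas[OF that] that by (intro prob_space.real_distribution_distr) (auto simp: prob_measures_def)
  have cdf: "cdf (distr M borel f) y = measure M {\<omega>. f \<omega> \<le> y}" if "M \<in> prob_measures" for M y
    unfolding cdf_def using f_meas[OF that] sp[OF that] by (subst measure_distr) (auto simp: vimage_def)
  have "weak_conv_m (\<lambda>n. distr (\<mu> n) borel f) (distr \<mu>' borel f)"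
    unfolding weak_conv_m_def weak_conv_def
  proof (intro allI impI)
    fix y
    have "{\<omega> \<in> space borel. f \<omega> \<le> y} \<in> sets borel" using f(1) by measurable
    moreover have "depends_on \<Lambda> (\<lambda>\<omega>. \<omega> \<in> {\<omega>. f \<omega> \<le> y})"
      using depends_on_compose[OF f(2), of "\<lambda>u. u \<le> y"] by simp
    ultimately show "(\<lambda>n. cdf (distr (\<mu> n) borel f) y) \<longlonglongrightarrow> cdf (distr \<mu>' borel f) y"
      using loc f(3) \<mu> unfolding local_convergence_def by (simp add: cdf)
  qed
  then have "(\<lambda>n. integral\<^sup>L (distr (\<mu> n) borel f) (\<lambda>u. max (- C) (min C u)))
      \<longlonglongrightarrow> integral\<^sup>L (distr \<mu>' borel f) (\<lambda>u. max (- C) (min C u))"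
    using f(4) order_trans[OF abs_ge_zero f(4)]
    by (intro weak_conv_imp_integral_bdd_continuous_conv[where B=C] rd \<mu>)
       (auto intro!: continuous_intros)
  moreover have "integral\<^sup>L (distr M borel f) (\<lambda>u. max (- C) (min C u)) = integral\<^sup>L M f" if "M \<in> prob_measures" for M
  proof -
    have "max (- C) (min C (f \<omega>)) = f \<omega>" for \<omega> using f(4)[of \<omega>] by linarith
    then show ?thesis using f_meas[OF that] by (subst integral_distr) auto
  qed
  ultimately show ?thesis using \<mu> by simp
qed

section \<open>Limits of tempered measures\<close>

lemma prob_measuresD:
  assumes "M \<in> prob_measures"
  shows "sets M = sets borel" "prob_space M" "space M = UNIV"
  using assms sets_eq_imp_space_eq[of M borel] by (auto simp: prob_measures_def)

lemma local_convergence_nn_integral: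
  assumes \<mu>: "\<And>n. \<mu> n \<in> prob_measures" "\<mu>' \<in> prob_measures" and loc: "local_convergence \<mu> \<mu>'"
    and f: "f \<in> borel_measurable borel" "depends_on \<Lambda> f" "finite \<Lambda>" "\<And>\<omega>. 0 \<le> f \<omega>" "\<And>\<omega>. f \<omega> \<le> C"
  shows "(\<lambda>n. \<integral>\<^sup>+\<omega>. ennreal (f \<omega>) \<partial>\<mu> n) \<longlonglongrightarrow> (\<integral>\<^sup>+\<omega>. ennreal (f \<omega>) \<partial>\<mu>')"
proof -
  have eq: "(\<integral>\<^sup>+\<omega>. ennreal (f \<omega>) \<partial>M) = ennreal (integral\<^sup>L M f)" if M: "M \<in> prob_measures" for M
  proof -
    interpret prob_space M by (rule prob_measuresD[OF M])
    have "f \<in> borel_measurable M"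
      unfolding measurable_cong_sets[OF prob_measuresD(1)[OF M] refl] by (rule f(1))
    then have "integrable M f" using f by (intro integrable_const_bound[of _ C]) auto
    then show ?thesis using f by (intro nn_integral_eq_integral) auto
  qed
  have "(\<lambda>n. integral\<^sup>L (\<mu> n) f) \<longlonglongrightarrow> integral\<^sup>L \<mu>' f"
    using f by (intro local_convergence_integral[OF \<mu> loc f(1-3), of C]) auto
  then show ?thesis by (simp add: eq \<mu> tendsto_ennrealI)
qed

text \<open>The metric of the product topology gives late coordinates geometrically small weight, so
  agreement on finitely many coordinates bounds the distance whatever the others are.\<close>

lemma merge_conf_uniformly_close:
  assumes "\<delta> > 0"
  obtains F :: "'v::countable set" where "finite F"
    "\<And>\<Lambda> \<omega> \<xi>. F \<subseteq> \<Lambda> \<Longrightarrow> dist (merge_conf \<Lambda> \<omega> \<xi>) (\<omega> :: 'v \<Rightarrow> real) < \<delta>"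
proof -
  obtain N :: nat where N: "(1/2) ^ N < \<delta>" using real_arch_pow_inv[OF assms, of "1/2"] by auto
  show thesis
  proof (rule that[of "from_nat ` {..N}"])
    fix \<Lambda> :: "'v set" and \<omega> \<xi> :: "'v \<Rightarrow> real" assume sub: "from_nat ` {..N} \<subseteq> \<Lambda>"
    have "{dist (merge_conf \<Lambda> \<omega> \<xi> (from_nat n)) (\<omega> (from_nat n)) | n. n \<le> N} = {0}"
    proof (intro equalityI subsetI)
      fix d assume "d \<in> {dist (merge_conf \<Lambda> \<omega> \<xi> (from_nat n)) (\<omega> (from_nat n)) | n. n \<le> N}"
      then obtain n where "n \<le> N" "d = dist (merge_conf \<Lambda> \<omega> \<xi> (from_nat n)) (\<omega> (from_nat n))" by blast
      moreover from this sub have "from_nat n \<in> \<Lambda>" by auto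
      ultimately show "d \<in> {0}" by simp
    next
      fix d :: real assume "d \<in> {0}"
      moreover have "from_nat 0 \<in> \<Lambda>" using sub by auto
      ultimately show "d \<in> {dist (merge_conf \<Lambda> \<omega> \<xi> (from_nat n)) (\<omega> (from_nat n)) | n. n \<le> N}"
        by (auto intro!: exI[of _ 0])
    qed
    then show "dist (merge_conf \<Lambda> \<omega> \<xi>) \<omega> < \<delta>"
      using dist_fun_le_dist_first_terms[of "merge_conf \<Lambda> \<omega> \<xi>" \<omega> N] N by simp
  qed simp
qed

lemma compact_box:
  fixes \<rho> :: "'v \<Rightarrow> real"
  shows "compact {\<omega> :: 'v \<Rightarrow> real. \<forall>x. \<bar>\<omega> x\<bar> \<le> \<rho> x}"
proof -
  have "{\<omega> :: 'v \<Rightarrow> real. \<forall>x. \<bar>\<omega> x\<bar> \<le> \<rho> x} = PiE UNIV (\<lambda>x. {- \<rho> x..\<rho> x})"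
    by (auto simp: PiE_def Pi_def abs_le_iff minus_le_iff)
  then show ?thesis
    using compactin_PiE[of "\<lambda>_. euclidean" UNIV "\<lambda>x. {- \<rho> x..\<rho> x}"] by (simp add: euclidean_product_topology)
qed

lemma tendsto_componentwise_fun:
  fixes f :: "nat \<Rightarrow> 'i \<Rightarrow> real"
  assumes "\<And>i. (\<lambda>n. f n i) \<longlonglongrightarrow> l i"
  shows "f \<longlonglongrightarrow> l"
proof -
  have "limitin (product_topology (\<lambda>_. euclidean) UNIV) f l sequentially"
    using assms by (simp add: limitin_componentwise)
  then show ?thesis by (simp add: euclidean_product_topology)
qed

context gibbs_model
begin

section \<open>Tightness from exponential moments\<close>

definition tail_event :: "real \<Rightarrow> nat \<Rightarrow> ('v \<Rightarrow> real) set" where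
  "tail_event R k = {\<omega>. R < weighted_sum (exhaustion k) \<omega>}"

lemma tail_event_measurable [measurable]: "tail_event R k \<in> sets borel"
proof -
  have "tail_event R k = {\<omega> \<in> space borel. R < weighted_sum (exhaustion k) \<omega>}" by (simp add: tail_event_def)
  also have "\<dots> \<in> sets borel" by measurable
  finally show ?thesis .
qed

text \<open>The exponential Chebyshev inequality with parameter 1, then continuity from below. The
  union over \<open>k\<close> is the complement of the set of tempered configurations whose p-th
  power norm is at most \<open>R\<close>.\<close>

lemma emeasure_tail_events:
  assumes M: "M \<in> prob_measures" and mom: "\<And>k. moments (exhaustion k) M"
  shows "emeasure M (\<Union>k. tail_event R k) \<le> ennreal (exp (moment_const 1 - R))"
proof -
  note sets_M[measurable_cong] = prob_measuresD(1)[OF M]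
  have "emeasure M (tail_event R k) \<le> ennreal (exp (moment_const 1 - R))" for k
  proof -
    have "emeasure M (tail_event R k) = (\<integral>\<^sup>+\<omega>. indicator (tail_event R k) \<omega> \<partial>M)"
      by (intro nn_integral_indicator[symmetric]) measurable
    also have "\<dots> \<le> (\<integral>\<^sup>+\<omega>. ennreal (exp (- R)) * ennreal (exp (1 * weighted_sum (exhaustion k) \<omega>)) \<partial>M)"
      by (intro nn_integral_mono)
         (auto simp: indicator_def tail_event_def exp_minus_inverse simp flip: ennreal_mult exp_add ennreal_1
               intro!: ennreal_leI)
    also have "\<dots> = ennreal (exp (- R)) * (\<integral>\<^sup>+\<omega>. ennreal (exp (1 * weighted_sum (exhaustion k) \<omega>)) \<partial>M)"
      by (intro nn_integral_cmult) measurable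
    also have "\<dots> \<le> ennreal (exp (- R)) * ennreal (exp (moment_const 1))"
      using mom[of k] unfolding moments_def by (intro mult_left_mono) (auto dest: spec[of _ 1])
    also have "\<dots> = ennreal (exp (moment_const 1 - R))"
      by (simp flip: ennreal_mult exp_add)
    finally show ?thesis .
  qed
  moreover have "incseq (tail_event R)"
    unfolding tail_event_def
    by (intro monoI subsetI) (auto elim!: less_le_trans intro!: weighted_sum_mono exhaustion_mono)
  moreover have "range (tail_event R) \<subseteq> sets M" unfolding sets_M by auto
  ultimately show ?thesis
    using SUP_emeasure_incseq[of "tail_event R" M] SUP_least[of UNIV "\<lambda>k. emeasure M (tail_event R k)"] by simp
qed

text \<open>A configuration that is not tempered lies in the tail events of every level, and their
  probability tends to 0. This recovers temperedness for limits, for which it is not known in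
  advance.\<close>

lemma AE_tempered_of_moments:
  assumes M: "M \<in> prob_measures" and mom: "\<And>k. moments (exhaustion k) M"
  shows "AE \<omega> in M. \<omega> \<in> \<Omega>t"
proof -
  note sets_M = prob_measuresD(1)[OF M]
  have sub: "- \<Omega>t \<subseteq> (\<Union>k. tail_event (real n) k)" for n
    unfolding Lp_w_eq tail_event_def by (auto simp: not_le)
  have "emeasure M (- \<Omega>t) \<le> ennreal (exp (moment_const 1 - real n))" for n
  proof -
    have "emeasure M (- \<Omega>t) \<le> emeasure M (\<Union>k. tail_event (real n) k)"
      using sub sets_M by (intro emeasure_mono) auto
    also have "\<dots> \<le> ennreal (exp (moment_const 1 - real n))" by (rule emeasure_tail_events[OF M mom])
    finally show ?thesis .
  qed
  moreover have "(\<lambda>n. ennreal (exp (moment_const 1 - real n))) \<longlonglongrightarrow> ennreal 0"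
  proof (intro tendsto_ennrealI)
    have "(\<lambda>n. exp (moment_const 1) * exp (- real n)) \<longlonglongrightarrow> exp (moment_const 1) * 0"
      by (intro tendsto_mult tendsto_const filterlim_compose[OF exp_at_bot]
          filterlim_compose[OF filterlim_uminus_at_bot_at_top] filterlim_real_sequentially)
    then show "(\<lambda>n. exp (moment_const 1 - real n)) \<longlonglongrightarrow> 0" by (simp flip: exp_add)
  qed
  ultimately have "emeasure M (- \<Omega>t) \<le> 0"
    using LIMSEQ_le_const[of _ "ennreal 0" "emeasure M (- \<Omega>t)"] by auto
  then show ?thesis
    using sets_M prob_measuresD(3)[OF M] by (intro AE_I[of _ _ "- \<Omega>t"]) auto
qed

text \<open>The error is at most \<open>\<epsilon>\<close> off the tail events and at most
  \<open>2 * C\<close> on them, where the probability is exponentially small in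
  \<open>R\<close>.\<close>

lemma integral_localized:
  assumes M: "M \<in> prob_measures" and mom: "\<And>k. moments (exhaustion k) M"
    and f: "f \<in> borel_measurable borel" "\<And>\<omega>. \<bar>f \<omega>\<bar> \<le> C" and "\<epsilon> \<ge> 0"
    and close: "\<And>\<omega>. \<omega> \<notin> (\<Union>k. tail_event R k) \<Longrightarrow> \<bar>f \<omega> - f (merge_conf \<Lambda> \<omega> \<xi>)\<bar> \<le> \<epsilon>"
  shows "\<bar>integral\<^sup>L M f - (\<integral>\<omega>. f (merge_conf \<Lambda> \<omega> \<xi>) \<partial>M)\<bar> \<le> \<epsilon> + 2 * C * exp (moment_const 1 - R)"
proof -
  note sets_M[measurable_cong] = prob_measuresD(1)[OF M]
  note f(1)[measurable]
  interpret prob_space M by (rule prob_measuresD[OF M])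
  let ?T = "\<Union>k. tail_event R k"
  have C: "C \<ge> 0" using f(2)[of undefined] by simp
  have T: "?T \<in> sets M" using sets_M by auto
  have int: "integrable M f" "integrable M (\<lambda>\<omega>. f (merge_conf \<Lambda> \<omega> \<xi>))"
    using f(2) by (auto intro!: integrable_const_bound[of _ C])
  have intT: "integrable M (\<lambda>\<omega>. \<epsilon> + 2 * C * indicator ?T \<omega>)"
    using T by (intro Bochner_Integration.integrable_add integrable_mult_right) (auto simp: less_top[symmetric])
  have "\<bar>integral\<^sup>L M f - (\<integral>\<omega>. f (merge_conf \<Lambda> \<omega> \<xi>) \<partial>M)\<bar> = \<bar>\<integral>\<omega>. f \<omega> - f (merge_conf \<Lambda> \<omega> \<xi>) \<partial>M\<bar>"
    using int by simp
  also have "\<dots> \<le> (\<integral>\<omega>. \<bar>f \<omega> - f (merge_conf \<Lambda> \<omega> \<xi>)\<bar> \<partial>M)"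
    by (rule integral_abs_bound)
  also have "\<dots> \<le> (\<integral>\<omega>. \<epsilon> + 2 * C * indicator ?T \<omega> \<partial>M)"
  proof (rule integral_mono)
    fix \<omega>
    show "\<bar>f \<omega> - f (merge_conf \<Lambda> \<omega> \<xi>)\<bar> \<le> \<epsilon> + 2 * C * indicator ?T \<omega>"
    proof (cases "\<omega> \<in> ?T")
      case True
      then show ?thesis using f(2)[of \<omega>] f(2)[of "merge_conf \<Lambda> \<omega> \<xi>"] \<open>\<epsilon> \<ge> 0\<close> by simp
    qed (use close in auto)
  qed (use int intT in auto)
  also have "\<dots> = \<epsilon> + 2 * C * measure M ?T"
    using T by (subst Bochner_Integration.integral_add) (auto simp: prob_space less_top[symmetric])
  also have "measure M ?T \<le> exp (moment_const 1 - R)"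
    using emeasure_tail_events[OF M mom, of R] by (simp add: emeasure_eq_measure)
  then have "\<epsilon> + 2 * C * measure M ?T \<le> \<epsilon> + 2 * C * exp (moment_const 1 - R)"
    using C by (intro add_left_mono mult_left_mono) auto
  finally show ?thesis .
qed

text \<open>A bound on the norm bounds every coordinate, so the complement of the tail events lies
  in a box that is compact by \<open>compact_box\<close>.\<close>

lemma outside_tail_events:
  assumes "\<omega> \<notin> (\<Union>k. tail_event R k)" "R \<ge> 0"
  shows "\<bar>\<omega> x\<bar> \<le> (R / w x) powr (1 / p)"
proof -
  obtain k where k: "{x} \<subseteq> exhaustion k"
    using eventually_subset_exhaustion[of "{x}"] eventually_happens[of _ sequentially] by auto
  have "w x * \<bar>\<omega> x\<bar> powr p = weighted_sum {x} \<omega>" by (simp add: weighted_sum_def)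
  also have "\<dots> \<le> weighted_sum (exhaustion k) \<omega>" using k by (intro weighted_sum_mono) auto
  also have "\<dots> \<le> R" using assms by (simp add: tail_event_def not_less)
  finally have "\<bar>\<omega> x\<bar> powr p \<le> R / w x" by (simp add: pos_le_divide_eq mult.commute)
  then have "(\<bar>\<omega> x\<bar> powr p) powr (1 / p) \<le> (R / w x) powr (1 / p)"
    using p_gt_2 by (intro powr_mono2) auto
  then show ?thesis using p_gt_2 by (simp add: powr_powr)
qed

text \<open>Uniform moments make the measures tight, and on a compact box a continuous function is
  uniformly close to a function of finitely many coordinates.\<close>

lemma local_imp_weak_convergence:
  assumes \<mu>: "\<And>n. \<mu> n \<in> prob_measures" "\<mu>' \<in> prob_measures" and loc: "local_convergence \<mu> \<mu>'"
    and mom: "\<And>n k. moments (exhaustion k) (\<mu> n)" "\<And>k. moments (exhaustion k) \<mu>'"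
    and f: "continuous_on UNIV f" "bounded (range f)"
  shows "(\<lambda>n. integral\<^sup>L (\<mu> n) f) \<longlonglongrightarrow> (integral\<^sup>L \<mu>' f :: real)"
proof (rule LIMSEQ_I)
  fix e :: real assume e: "e > 0"
  obtain C where C: "\<And>\<omega>. \<bar>f \<omega>\<bar> \<le> C" using f(2) by (auto simp: bounded_iff)
  have C0: "C \<ge> 0" using C[of undefined] by simp
  have f_meas[measurable]: "f \<in> borel_measurable borel" using f(1) by (rule borel_measurable_continuous_onI)
  \<comment> \<open>The logarithm makes the tail contribution at most \<open>e / 6\<close>;
    \<open>C + 1\<close> avoids division by zero, and the maximum ensures the sign needed in
    \<open>outside_tail_events\<close>.\<close>
  define R where "R = max 0 (moment_const 1 - ln (e / (12 * (C + 1))))"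
  have R0: "R \<ge> 0" by (simp add: R_def)
  have small: "2 * C * exp (moment_const 1 - R) \<le> e / 6"
  proof -
    have "exp (moment_const 1 - R) \<le> exp (ln (e / (12 * (C + 1))))" by (simp add: R_def)
    also have "\<dots> = e / (12 * (C + 1))" using e C0 by simp
    finally have "2 * C * exp (moment_const 1 - R) \<le> 2 * C * (e / (12 * (C + 1)))"
      using C0 by (intro mult_left_mono) auto
    also have "\<dots> \<le> e / 6" using e C0 by (simp add: field_simps)
    finally show ?thesis .
  qed
  define Box where "Box = {\<omega> :: 'v \<Rightarrow> real. \<forall>x. \<bar>\<omega> x\<bar> \<le> (R / w x) powr (1 / p)}"
  have "compact Box" unfolding Box_def by (rule compact_box)
  then have "uniformly_continuous_on Box f"
    using f(1) by (intro compact_uniformly_continuous) (auto intro: continuous_on_subset)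
  then obtain \<delta> where \<delta>: "\<delta> > 0" "\<And>\<omega> \<omega>'. \<omega> \<in> Box \<Longrightarrow> \<omega>' \<in> Box \<Longrightarrow> dist \<omega>' \<omega> < \<delta> \<Longrightarrow> dist (f \<omega>') (f \<omega>) < e / 6"
    using e unfolding uniformly_continuous_on_def by (metis zero_less_divide_iff zero_less_numeral)
  obtain \<Lambda> :: "'v set" where \<Lambda>: "finite \<Lambda>"
    "\<And>\<Lambda>' \<omega> \<xi>. \<Lambda> \<subseteq> \<Lambda>' \<Longrightarrow> dist (merge_conf \<Lambda>' \<omega> \<xi>) (\<omega> :: 'v \<Rightarrow> real) < \<delta>"
    using merge_conf_uniformly_close[OF \<delta>(1)] by blast
  let ?g = "\<lambda>\<omega>. f (merge_conf \<Lambda> \<omega> (\<lambda>_. 0))"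
  have close: "\<bar>f \<omega> - ?g \<omega>\<bar> \<le> e / 6" if "\<omega> \<notin> (\<Union>k. tail_event R k)" for \<omega>
  proof -
    have \<omega>: "\<omega> \<in> Box" unfolding Box_def using outside_tail_events[OF that R0] by simp
    \<comment> \<open>The box contains 0 in every coordinate, so resetting coordinates does not
      leave it and uniform continuity on the box applies.\<close>
    then have "merge_conf \<Lambda> \<omega> (\<lambda>_. 0) \<in> Box" by (auto simp: Box_def merge_conf_def)
    from \<delta>(2)[OF \<omega> this \<Lambda>(2)[OF subset_refl]] show ?thesis
      by (simp add: dist_real_def abs_minus_commute)
  qed
  \<comment> \<open>Here \<open>e / 6\<close> comes from the box and \<open>e / 6\<close> from the
    tail. The bound is used for \<open>\<mu> n\<close> and for \<open>\<mu>'\<close>; the last third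
    of \<open>e\<close> is left to the local limit of \<open>?g\<close>.\<close>
  have loc_f: "\<bar>integral\<^sup>L M f - integral\<^sup>L M ?g\<bar> \<le> e / 3" if "M \<in> prob_measures" "\<And>k. moments (exhaustion k) M" for M
  proof -
    have "\<bar>integral\<^sup>L M f - integral\<^sup>L M ?g\<bar> \<le> e / 6 + 2 * C * exp (moment_const 1 - R)"
    proof (rule integral_localized[OF that f_meas C])
      show "e / 6 \<ge> 0" using e by simp
    qed (rule close)
    then show ?thesis using small by simp
  qed
  have "depends_on \<Lambda> ?g"
  proof -
    have "merge_conf \<Lambda> \<omega> (\<lambda>_. 0) = merge_conf \<Lambda> \<omega>' (\<lambda>_. 0)" if "\<forall>x\<in>\<Lambda>. \<omega> x = \<omega>' x" for \<omega> \<omega>' :: "'v \<Rightarrow> real"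
      using that by (auto simp: merge_conf_def)
    then show ?thesis unfolding depends_on_def by metis
  qed
  then have "(\<lambda>n. integral\<^sup>L (\<mu> n) ?g) \<longlonglongrightarrow> integral\<^sup>L \<mu>' ?g"
    by (intro local_convergence_integral[OF \<mu> loc _ _ \<Lambda>(1) C]) measurable
  then obtain N where N: "\<And>n. n \<ge> N \<Longrightarrow> \<bar>integral\<^sup>L (\<mu> n) ?g - integral\<^sup>L \<mu>' ?g\<bar> < e / 3"
    using LIMSEQ_D[of _ _ "e / 3"] e by fastforce
  show "\<exists>N. \<forall>n\<ge>N. norm (integral\<^sup>L (\<mu> n) f - integral\<^sup>L \<mu>' f) < e"
  proof (intro exI[of _ N] allI impI)
    fix n assume "n \<ge> N"
    then show "norm (integral\<^sup>L (\<mu> n) f - integral\<^sup>L \<mu>' f) < e"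
      using N[of n] loc_f[OF \<mu>(1) mom(1), of n] loc_f[OF \<mu>(2) mom(2)] unfolding real_norm_def by linarith
  qed
qed

section \<open>Moments, DLR equations and temperedness under local limits\<close>

lemma limit_moments:
  assumes \<mu>: "\<And>n. \<mu> n \<in> prob_measures" "\<mu>' \<in> prob_measures" and loc: "local_convergence \<mu> \<mu>'"
    and fin: "finite \<Delta>" and mom: "\<forall>\<^sub>F n in sequentially. moments \<Delta> (\<mu> n)"
  shows "moments \<Delta> \<mu>'"
  unfolding moments_def
proof (intro allI impI)
  fix lam :: real assume lam: "lam > 0"
  note [measurable_cong] = prob_measuresD(1)[OF \<mu>(2)]
  show "(\<integral>\<^sup>+\<eta>. ennreal (exp (lam * weighted_sum \<Delta> \<eta>)) \<partial>\<mu>') \<le> ennreal (exp (moment_const lam))"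
  proof (rule nn_integral_le_truncated)
    fix n :: nat
    let ?f = "\<lambda>\<eta>. min (exp (lam * weighted_sum \<Delta> \<eta>)) (real n)"
    \<comment> \<open>The truncated exponential is bounded and depends on the coordinates in
      \<Delta> alone, so local convergence applies to it.\<close>
    have "(\<lambda>j. \<integral>\<^sup>+\<eta>. ennreal (?f \<eta>) \<partial>\<mu> j) \<longlonglongrightarrow> (\<integral>\<^sup>+\<eta>. ennreal (?f \<eta>) \<partial>\<mu>')"
      by (rule local_convergence_nn_integral[OF \<mu> loc _ _ fin, of _ "real n"])
         (auto intro: depends_on_compose[OF depends_on_weighted_sum, where g="\<lambda>s. min (exp (lam * s)) (real n)"])
    then show "(\<integral>\<^sup>+\<eta>. ennreal (?f \<eta>) \<partial>\<mu>') \<le> ennreal (exp (moment_const lam))"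
    proof (rule tendsto_upperbound)
      show "\<forall>\<^sub>F j in sequentially. (\<integral>\<^sup>+\<eta>. ennreal (?f \<eta>) \<partial>\<mu> j) \<le> ennreal (exp (moment_const lam))"
        using mom
      proof eventually_elim
        fix j assume "moments \<Delta> (\<mu> j)"
        then have "(\<integral>\<^sup>+\<eta>. ennreal (exp (lam * weighted_sum \<Delta> \<eta>)) \<partial>\<mu> j) \<le> ennreal (exp (moment_const lam))"
          using lam by (simp add: moments_def)
        moreover have "(\<integral>\<^sup>+\<eta>. ennreal (?f \<eta>) \<partial>\<mu> j) \<le> (\<integral>\<^sup>+\<eta>. ennreal (exp (lam * weighted_sum \<Delta> \<eta>)) \<partial>\<mu> j)"
          by (intro nn_integral_mono ennreal_leI) simp
        ultimately show "(\<integral>\<^sup>+\<eta>. ennreal (?f \<eta>) \<partial>\<mu> j) \<le> ennreal (exp (moment_const lam))" by (rule order_trans[rotated])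
      qed
    qed simp
  qed measurable
qed

text \<open>Since the kernel maps functions of finitely many coordinates to such functions, the DLR
  equation passes to limits in the sense of local convergence without any continuity.\<close>

lemma limit_dlr:
  assumes \<mu>: "\<And>n. \<mu> n \<in> prob_measures" "\<mu>' \<in> prob_measures" and loc: "local_convergence \<mu> \<mu>'"
    and fin: "finite \<Lambda>" and dlr: "\<forall>\<^sub>F n in sequentially. dlr \<Lambda> (\<mu> n)"
  shows "dlr \<Lambda> \<mu>'"
proof (rule dlrI[OF fin \<mu>(2) sets_borel_cylinder Int_stable_cylinder])
  have "UNIV = cylinder {}" by (simp add: cylinder_def)
  then show "UNIV \<in> cylinder ` Collect finite" by blast
  fix A :: "('v \<Rightarrow> real) set" assume "A \<in> cylinder ` Collect finite"
  then obtain S where S: "finite S" "A = cylinder S" by blast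
  have A[measurable]: "A \<in> sets borel" using S by simp
  have depA: "depends_on (fst ` S) (\<lambda>\<omega>. \<omega> \<in> A)" unfolding S by (rule depends_on_cylinder)
  have dep_ind: "depends_on (fst ` S) (\<lambda>\<omega>. indicator A \<omega>)"
    using depends_on_compose[OF depA, of of_bool] by (simp add: indicator_def)
  define g where "g \<xi> = measure (kernel \<Lambda> \<xi>) A" for \<xi>
  have g: "emeasure (kernel \<Lambda> \<xi>) A = ennreal (g \<xi>)" for \<xi>
  proof -
    interpret prob_space "kernel \<Lambda> \<xi>" by (rule prob_space_kernel[OF fin])
    show ?thesis by (simp add: g_def emeasure_eq_measure)
  qed
  have g_eq: "g = (\<lambda>\<xi>. enn2real (\<integral>\<^sup>+\<eta>. indicator A \<eta> \<partial>kernel \<Lambda> \<xi>))"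
    by (simp add: g_def[abs_def] measure_def)
  have lim_g: "(\<lambda>n. \<integral>\<^sup>+\<xi>. ennreal (g \<xi>) \<partial>\<mu> n) \<longlonglongrightarrow> (\<integral>\<^sup>+\<xi>. ennreal (g \<xi>) \<partial>\<mu>')"
  proof (rule local_convergence_nn_integral[OF \<mu> loc, where C=1])
    show "g \<in> borel_measurable borel" unfolding g_eq using fin by measurable
    show "depends_on (fst ` S \<union> nbhd \<Lambda>) g"
      unfolding g_eq by (intro depends_on_compose[OF depends_on_kernel] dep_ind) measurable
    show "g \<xi> \<le> 1" for \<xi>
      unfolding g_def by (rule prob_space.prob_le_1[OF prob_space_kernel[OF fin]])
  qed (use S fin in \<open>auto simp: g_def\<close>)
  have lim_A: "(\<lambda>n. \<integral>\<^sup>+\<xi>. ennreal (indicator A \<xi>) \<partial>\<mu> n) \<longlonglongrightarrow> (\<integral>\<^sup>+\<xi>. ennreal (indicator A \<xi>) \<partial>\<mu>')"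
  proof (rule local_convergence_nn_integral[OF \<mu> loc, where C=1 and \<Lambda>="fst ` S"])
    show "depends_on (fst ` S) (indicator A :: ('v \<Rightarrow> real) \<Rightarrow> real)" using dep_ind .
  qed (use S in \<open>auto simp: indicator_def\<close>)
  have ind: "(\<integral>\<^sup>+\<xi>. ennreal (indicator A \<xi>) \<partial>M) = emeasure M A" if "M \<in> prob_measures" for M
    using prob_measuresD(1)[OF that] by (simp add: ennreal_indicator)
  have "\<forall>\<^sub>F n in sequentially. (\<integral>\<^sup>+\<xi>. ennreal (indicator A \<xi>) \<partial>\<mu> n) = (\<integral>\<^sup>+\<xi>. ennreal (g \<xi>) \<partial>\<mu> n)"
    using dlr
  proof eventually_elim
    fix n assume "dlr \<Lambda> (\<mu> n)"
    from dlr_emeasure[OF this A prob_measuresD(1)[OF \<mu>(1)]]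
    show "(\<integral>\<^sup>+\<xi>. ennreal (indicator A \<xi>) \<partial>\<mu> n) = (\<integral>\<^sup>+\<xi>. ennreal (g \<xi>) \<partial>\<mu> n)"
      by (simp add: ind \<mu> g)
  qed
  from LIMSEQ_unique[OF Lim_transform_eventually[OF lim_A this] lim_g]
  have "emeasure \<mu>' A = (\<integral>\<^sup>+\<xi>. ennreal (g \<xi>) \<partial>\<mu>')"
    by (simp only: ind[OF \<mu>(2)])
  then show "emeasure \<mu>' A = (\<integral>\<^sup>+\<xi>. emeasure (kernel \<Lambda> \<xi>) A \<partial>\<mu>')" by (simp add: g)
qed

text \<open>The hypotheses are required only eventually, since a finite-volume kernel satisfies the
  DLR equation for \<Lambda> once its volume contains \<Lambda>. The same statement thus yields both
  existence and sequential compactness.\<close>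

lemma tempered_subsequence_limit:
  assumes \<mu>: "\<And>n. \<mu> n \<in> prob_measures"
    and dlr: "\<And>\<Lambda>. finite \<Lambda> \<Longrightarrow> \<Lambda> \<noteq> {} \<Longrightarrow> \<forall>\<^sub>F n in sequentially. dlr \<Lambda> (\<mu> n)"
    and mom: "\<And>\<Delta>. finite \<Delta> \<Longrightarrow> \<forall>\<^sub>F n in sequentially. moments \<Delta> (\<mu> n)"
  obtains s \<mu>' where "strict_mono s" "local_convergence (\<mu> \<circ> s) \<mu>'" "\<mu>' \<in> tempered_gibbs adj r \<alpha> p W V"
proof -
  obtain s where s: "strict_mono s" and conv: "\<And>S. finite S \<Longrightarrow> convergent (\<lambda>n. measure (\<mu> (s n)) (cylinder S))"
    using convergent_cylinder_subsequence[of \<mu>] prob_measuresD(2)[OF \<mu>] by blast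
  have \<mu>s: "(\<mu> \<circ> s) n \<in> prob_measures" for n using \<mu> by simp
  have dlr_s: "\<forall>\<^sub>F n in sequentially. dlr \<Lambda> ((\<mu> \<circ> s) n)" if "finite \<Lambda>" "\<Lambda> \<noteq> {}" for \<Lambda>
    using eventually_subseq[OF s dlr[OF that]] by simp
  have mom_s: "\<forall>\<^sub>F n in sequentially. moments \<Delta> ((\<mu> \<circ> s) n)" if "finite \<Delta>" for \<Delta>
    using eventually_subseq[OF s mom[OF that]] by simp
  obtain \<mu>' where \<mu>': "\<mu>' \<in> prob_measures" and loc: "local_convergence (\<mu> \<circ> s) \<mu>'"
  proof (rule local_limit_exists[OF \<mu>s])
    fix \<Lambda> :: "'v set" assume "finite \<Lambda>"
    \<comment> \<open>The DLR equation is available for non-void volumes; domination on the larger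
      volume includes events that depend on \<Lambda>.\<close>
    then have fin: "finite (insert r \<Lambda>)" by simp
    obtain \<nu> :: "('v \<Rightarrow> real) measure" where \<nu>: "sets \<nu> = sets borel" "finite_measure \<nu>"
      "\<And>\<mu> A. sets \<mu> = sets borel \<Longrightarrow> dlr (insert r \<Lambda>) \<mu> \<Longrightarrow> moments (nbhd (insert r \<Lambda>)) \<mu> \<Longrightarrow> A \<in> sets borel \<Longrightarrow>
        depends_on (insert r \<Lambda>) (\<lambda>\<omega>. \<omega> \<in> A) \<Longrightarrow> emeasure \<mu> A \<le> emeasure \<nu> A"
      using local_domination[OF fin] by blast
    interpret \<nu>: finite_measure \<nu> by fact
    have "\<forall>\<^sub>F n in sequentially. dlr (insert r \<Lambda>) ((\<mu> \<circ> s) n)" using dlr_s[OF fin] by simp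
    moreover have "\<forall>\<^sub>F n in sequentially. moments (nbhd (insert r \<Lambda>)) ((\<mu> \<circ> s) n)" using mom_s fin by simp
    ultimately have "\<forall>\<^sub>F n in sequentially. \<forall>A\<in>sets borel. depends_on \<Lambda> (\<lambda>\<omega>. \<omega> \<in> A) \<longrightarrow> measure ((\<mu> \<circ> s) n) A \<le> measure \<nu> A"
    proof eventually_elim
      case (elim n)
      interpret prob_space "(\<mu> \<circ> s) n" by (rule prob_measuresD[OF \<mu>s])
      show ?case
      proof (intro ballI impI)
        fix A :: "('v \<Rightarrow> real) set" assume A: "A \<in> sets borel" "depends_on \<Lambda> (\<lambda>\<omega>. \<omega> \<in> A)"
        have "emeasure ((\<mu> \<circ> s) n) A \<le> emeasure \<nu> A"
          by (rule \<nu>(3)[OF prob_measuresD(1)[OF \<mu>s] elim A(1) depends_on_mono[OF A(2)]]) auto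
        then show "measure ((\<mu> \<circ> s) n) A \<le> measure \<nu> A"
          unfolding emeasure_eq_measure \<nu>.emeasure_eq_measure by simp
      qed
    qed
    then show "\<exists>\<nu>. sets \<nu> = sets borel \<and> finite_measure \<nu> \<and>
      (\<forall>\<^sub>F n in sequentially. \<forall>A\<in>sets borel. depends_on \<Lambda> (\<lambda>\<omega>. \<omega> \<in> A) \<longrightarrow> measure ((\<mu> \<circ> s) n) A \<le> measure \<nu> A)"
      using \<nu>(1,2) by blast
  next
    show "convergent (\<lambda>n. measure ((\<mu> \<circ> s) n) (cylinder S))" if "finite S" for S
      using conv[OF that] by simp
  qed
  have "dlr \<Lambda> \<mu>'" if "finite \<Lambda>" "\<Lambda> \<noteq> {}" for \<Lambda>
    by (rule limit_dlr[OF \<mu>s \<mu>' loc that(1) dlr_s[OF that]])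
  then have "\<mu>' \<in> gibbs_measures adj W V" using gibbs_iff_dlr \<mu>' by blast
  moreover have "moments (exhaustion k) \<mu>'" for k
    by (rule limit_moments[OF \<mu>s \<mu>' loc finite_exhaustion mom_s[OF finite_exhaustion]])
  then have "emeasure \<mu>' \<Omega>t = 1"
    unfolding tempered_AE[OF \<mu>'] by (rule AE_tempered_of_moments[OF \<mu>'])
  ultimately have "\<mu>' \<in> tempered_gibbs adj r \<alpha> p W V" by (simp add: tempered_gibbs_def)
  with s loc show thesis by (rule that)
qed

text \<open>Consistency gives the DLR equation for every subvolume, and with zero boundary condition
  the boundary norm vanishes, so the kernels obey exactly the bounds in
  \<open>moments\<close>.\<close>

lemma tempered_gibbs_nonempty: "tempered_gibbs adj r \<alpha> p W V \<noteq> {}"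
proof -
  define \<mu> where "\<mu> n = kernel (exhaustion n) (\<lambda>_. 0)" for n
  have "\<mu> n \<in> prob_measures" for n
    unfolding \<mu>_def prob_measures_def by (simp add: prob_space_kernel)
  moreover have "\<forall>\<^sub>F n in sequentially. dlr \<Lambda> (\<mu> n)" if "finite \<Lambda>" for \<Lambda>
    using eventually_subset_exhaustion[OF that]
    by eventually_elim (auto simp: dlr_def \<mu>_def kernel_consistent)
  moreover have "\<forall>\<^sub>F n in sequentially. moments \<Delta> (\<mu> n)" if "finite \<Delta>" for \<Delta>
    using eventually_subset_exhaustion[OF that]
  proof eventually_elim
    case (elim n)
    have "boundary_norm \<Lambda> (\<lambda>_. 0) = 0" for \<Lambda> by (simp add: boundary_norm_def)
    then show ?case
      unfolding moments_def \<mu>_def using moment_const(2)[OF _ finite_exhaustion elim, of _ "\<lambda>_. 0"] by simp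
  qed
  ultimately show ?thesis using tempered_subsequence_limit[of \<mu>] by blast
qed

section \<open>Moment bounds and compactness for tempered Gibbs measures\<close>

lemma tempered_exp_bound_site:
  assumes "\<mu> \<in> tempered_gibbs adj r \<alpha> p W V" "lam > 0"
  shows "(\<integral>\<^sup>+\<omega>. ennreal (exp (lam * \<bar>\<omega> x\<bar> powr p)) \<partial>\<mu>) \<le> ennreal (exp (moment_const (lam / w x)))"
proof -
  \<comment> \<open>The weighted sum over one site carries the factor \<open>w x\<close>, hence the
    rescaled parameter in the constant.\<close>
  have eq: "lam / w x * weighted_sum {x} \<omega> = lam * \<bar>\<omega> x\<bar> powr p" for \<omega>
    using less_imp_neq[OF w_pos[of x]] by (simp add: weighted_sum_def)
  have "moments {x} \<mu>" by (rule tempered_moments[OF assms(1)]) simp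
  moreover have "lam / w x > 0" using assms(2) by simp
  ultimately have "(\<integral>\<^sup>+\<omega>. ennreal (exp (lam / w x * weighted_sum {x} \<omega>)) \<partial>\<mu>) \<le> ennreal (exp (moment_const (lam / w x)))"
    unfolding moments_def by blast
  then show ?thesis unfolding eq .
qed

lemma tempered_exp_bound_norm:
  assumes \<mu>: "\<mu> \<in> tempered_gibbs adj r \<alpha> p W V" and lam: "lam > 0"
  shows "(\<integral>\<^sup>+\<omega>. ennreal (exp (lam * wnorm_pow adj r \<alpha> p \<omega>)) \<partial>\<mu>) \<le> ennreal (exp (moment_const lam))"
proof -
  have P: "\<mu> \<in> prob_measures" and "emeasure \<mu> \<Omega>t = 1"
    using \<mu> by (auto simp: tempered_gibbs_def gibbs_measures_def)
  note [measurable_cong] = prob_measuresD(1)[OF P]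
  let ?f = "\<lambda>k \<omega>. ennreal (exp (lam * weighted_sum (exhaustion k) \<omega>))"
  have inc: "incseq ?f"
    using lam by (intro monoI le_funI ennreal_leI) (auto intro!: weighted_sum_mono exhaustion_mono)
  \<comment> \<open>Only on \<open>\<Omega>t\<close> is \<open>wnorm_pow\<close> the limit of the
    partial sums; elsewhere the infinite sum has the default value 0. The comparison is therefore
    made almost everywhere.\<close>
  have "AE \<omega> in \<mu>. \<omega> \<in> \<Omega>t" using tempered_AE[OF P] \<open>emeasure \<mu> \<Omega>t = 1\<close> by simp
  then have "AE \<omega> in \<mu>. ennreal (exp (lam * wnorm_pow adj r \<alpha> p \<omega>)) \<le> (SUP k. ?f k \<omega>)"
  proof eventually_elim
    fix \<omega> assume "\<omega> \<in> \<Omega>t"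
    then have "(\<lambda>k. ?f k \<omega>) \<longlonglongrightarrow> ennreal (exp (lam * wnorm_pow adj r \<alpha> p \<omega>))"
      by (intro tendsto_ennrealI tendsto_exp tendsto_mult tendsto_const weighted_sum_tendsto)
    then show "ennreal (exp (lam * wnorm_pow adj r \<alpha> p \<omega>)) \<le> (SUP k. ?f k \<omega>)"
      by (rule LIMSEQ_le_const2) (intro exI[of _ 0] allI impI SUP_upper UNIV_I)
  qed
  then have "(\<integral>\<^sup>+\<omega>. ennreal (exp (lam * wnorm_pow adj r \<alpha> p \<omega>)) \<partial>\<mu>) \<le> (\<integral>\<^sup>+\<omega>. (SUP k. ?f k \<omega>) \<partial>\<mu>)"
    by (rule nn_integral_mono_AE)
  also have "\<dots> = (SUP k. \<integral>\<^sup>+\<omega>. ?f k \<omega> \<partial>\<mu>)"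
    by (rule nn_integral_monotone_convergence_SUP[OF inc]) measurable
  also have "\<dots> \<le> ennreal (exp (moment_const lam))"
    using tempered_moments[OF \<mu> finite_exhaustion] lam by (intro SUP_least) (auto simp: moments_def)
  finally show ?thesis .
qed

text \<open>The values on the countably many rational cylinders embed the tempered Gibbs measures into
  a metrizable space; the image is sequentially compact, and the inverse of the embedding is
  continuous because preimages of closed sets are again sequentially compact.\<close>

lemma compactin_tempered_gibbs: "compactin weak_topology (tempered_gibbs adj r \<alpha> p W V)"
proof -
  let ?K = "tempered_gibbs adj r \<alpha> p W V"
  have K_prob: "\<mu> \<in> prob_measures" if "\<mu> \<in> ?K" for \<mu>
    using that by (auto simp: tempered_gibbs_def gibbs_measures_def)
  have K_dlr: "dlr \<Lambda> \<mu>" if "\<mu> \<in> ?K" "finite \<Lambda>" "\<Lambda> \<noteq> {}" for \<mu> \<Lambda>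
    using that gibbs_iff_dlr by (auto simp: tempered_gibbs_def)
  define S where "S = from_nat_into (Collect finite :: ('v \<times> rat) set set)"
  have S_fin: "finite (S j)" for j
    using from_nat_into[of "Collect finite :: ('v \<times> rat) set set" j] unfolding S_def by blast
  define E where "E \<mu> j = measure \<mu> (cylinder (S j))" for \<mu> j
  have E_inj: "inj_on E ?K"
  proof (rule inj_onI)
    fix \<mu> \<nu> assume K: "\<mu> \<in> ?K" "\<nu> \<in> ?K" and eq: "E \<mu> = E \<nu>"
    interpret \<mu>: prob_space \<mu> by (rule prob_measuresD[OF K_prob[OF K(1)]])
    interpret \<nu>: prob_space \<nu> by (rule prob_measuresD[OF K_prob[OF K(2)]])
    show "\<mu> = \<nu>"
    proof (rule measure_eqI_generator_eq[OF Int_stable_cylinder])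
      show "emeasure \<mu> A = emeasure \<nu> A" if "A \<in> cylinder ` Collect finite" for A
      proof -
        obtain T where T: "finite T" "A = cylinder T" using \<open>A \<in> cylinder ` Collect finite\<close> by blast
        have "countable (Collect finite :: ('v \<times> rat) set set)" by (rule countable_Collect_finite)
        then obtain j where "S j = T"
          using from_nat_into_surj[of "Collect finite" T] T(1) unfolding S_def by blast
        then show ?thesis
          using fun_cong[OF eq, of j] T by (simp add: E_def \<mu>.emeasure_eq_measure \<nu>.emeasure_eq_measure)
      qed
      have "UNIV = cylinder {}" by (simp add: cylinder_def)
      then show "range (\<lambda>_::nat. UNIV) \<subseteq> cylinder ` Collect finite" by blast
    qed (use prob_measuresD(1)[OF K_prob] K in \<open>simp_all add: sets_borel_cylinder\<close>)
  qed
  \<comment> \<open>The closed constraint is carried along so that one argument serves twice: with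
    \<open>C = UNIV\<close> it gives compactness of the whole image, with the complement of an open
    set it gives continuity of the inverse.\<close>
  have compact_E: "compact (E ` {\<mu> \<in> ?K. integral\<^sup>L \<mu> f \<in> C})"
    if f: "continuous_on UNIV f" "bounded (range f)" and C: "closed (C :: real set)" for f C
    unfolding seq_compact_eq_compact[symmetric] seq_compact_def
  proof (intro allI impI)
    fix e assume "\<forall>n::nat. e n \<in> E ` {\<mu> \<in> ?K. integral\<^sup>L \<mu> f \<in> C}"
    then have "\<forall>n. \<exists>\<mu>. \<mu> \<in> ?K \<and> integral\<^sup>L \<mu> f \<in> C \<and> e n = E \<mu>" by blast
    then obtain \<mu> where \<mu>: "\<And>n. \<mu> n \<in> ?K" "\<And>n. integral\<^sup>L (\<mu> n) f \<in> C" "\<And>n. e n = E (\<mu> n)" by metis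
    obtain s \<mu>' where s: "strict_mono s" and loc: "local_convergence (\<mu> \<circ> s) \<mu>'" and \<mu>': "\<mu>' \<in> ?K"
      by (rule tempered_subsequence_limit[of \<mu>])
         (use \<mu>(1) K_prob K_dlr tempered_moments in \<open>auto intro!: always_eventually\<close>)
    have \<mu>s: "(\<mu> \<circ> s) n \<in> ?K" for n using \<mu>(1) by simp
    have "(\<lambda>n. integral\<^sup>L ((\<mu> \<circ> s) n) f) \<longlonglongrightarrow> integral\<^sup>L \<mu>' f"
      by (rule local_imp_weak_convergence[OF K_prob[OF \<mu>s] K_prob[OF \<mu>'] loc
            tempered_moments[OF \<mu>s finite_exhaustion] tempered_moments[OF \<mu>' finite_exhaustion] f])
    then have "integral\<^sup>L \<mu>' f \<in> C" using \<mu>(2)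
      closed_sequentially[OF C, of "\<lambda>n. integral\<^sup>L (\<mu> (s n)) f" "integral\<^sup>L \<mu>' f"] by simp
    moreover have "(e \<circ> s) \<longlonglongrightarrow> E \<mu>'"
    proof (rule tendsto_componentwise_fun)
      show "(\<lambda>n. (e \<circ> s) n j) \<longlonglongrightarrow> E \<mu>' j" for j
        using loc[unfolded local_convergence_def, rule_format, OF _ _ depends_on_cylinder, of "S j"] S_fin[of j]
        by (simp add: E_def \<mu>(3))
    qed
    ultimately show "\<exists>l\<in>E ` {\<mu> \<in> ?K. integral\<^sup>L \<mu> f \<in> C}. \<exists>s. strict_mono s \<and> (e \<circ> s) \<longlonglongrightarrow> l"
      using \<mu>' s by (intro bexI[of _ "E \<mu>'"] exI[of _ s] conjI imageI) auto
  qed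
  have "compact (E ` ?K)" using compact_E[OF continuous_on_const _ closed_UNIV, of 0] by simp
  define g where "g = inv_into ?K E"
  have g: "g (E \<mu>) = \<mu>" if "\<mu> \<in> ?K" for \<mu>
    unfolding g_def using E_inj that by simp
  have "continuous_map (top_of_set (E ` ?K)) weak_topology g"
    unfolding weak_topology_def
  proof (rule continuous_on_generated_topo)
    fix T :: "('v \<Rightarrow> real) measure set"
    assume "T \<in> {{\<mu> \<in> prob_measures. (\<integral>\<omega>. f \<omega> \<partial>\<mu>) \<in> U} | f U.
        continuous_on UNIV f \<and> bounded (range f) \<and> open (U :: real set)}"
    then obtain f U where fU: "T = {\<mu> \<in> prob_measures. (\<integral>\<omega>. f \<omega> \<partial>\<mu>) \<in> U} \<and>
        continuous_on UNIV f \<and> bounded (range f) \<and> open (U :: real set)"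
      unfolding mem_Collect_eq by (elim exE)
    note T = fU[THEN conjunct1]
    have f: "continuous_on UNIV f" "bounded (range f)" and U: "open U"
      using fU[THEN conjunct2] by simp_all
    \<comment> \<open>By injectivity of \<open>E\<close>, the preimage of a subbasic open set is the
      image of all tempered measures minus the image of those violating the condition, and the
      latter is compact, hence closed.\<close>
    have "g -` T \<inter> topspace (top_of_set (E ` ?K)) = E ` ?K - E ` {\<mu> \<in> ?K. integral\<^sup>L \<mu> f \<in> - U}"
    proof (intro set_eqI iffI)
      fix e assume "e \<in> g -` T \<inter> topspace (top_of_set (E ` ?K))"
      then have "e \<in> E ` ?K" and geT: "g e \<in> T" by simp_all
      from \<open>e \<in> E ` ?K\<close> obtain \<mu> where \<mu>: "\<mu> \<in> ?K" "e = E \<mu>" by (rule imageE)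
      with geT have "\<mu> \<in> T" using g[OF \<mu>(1)] by simp
      have "e \<notin> E ` {\<mu> \<in> ?K. integral\<^sup>L \<mu> f \<in> - U}"
      proof
        assume "e \<in> E ` {\<mu> \<in> ?K. integral\<^sup>L \<mu> f \<in> - U}"
        then obtain \<nu> where \<nu>: "e = E \<nu>" "\<nu> \<in> {\<mu> \<in> ?K. integral\<^sup>L \<mu> f \<in> - U}" by (rule imageE)
        have "E \<nu> = E \<mu>" by (rule trans[OF \<nu>(1)[symmetric] \<mu>(2)])
        then have "\<nu> = \<mu>" using \<nu>(2) \<mu>(1) inj_onD[OF E_inj] by blast
        moreover have "integral\<^sup>L \<nu> f \<notin> U" using \<nu>(2) by simp
        moreover have "integral\<^sup>L \<mu> f \<in> U" using \<open>\<mu> \<in> T\<close> unfolding T by simp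
        ultimately show False by simp
      qed
      with \<mu> show "e \<in> E ` ?K - E ` {\<mu> \<in> ?K. integral\<^sup>L \<mu> f \<in> - U}" by simp
    next
      fix e assume e: "e \<in> E ` ?K - E ` {\<mu> \<in> ?K. integral\<^sup>L \<mu> f \<in> - U}"
      then have "e \<in> E ` ?K" by (rule DiffD1)
      then obtain \<mu> where \<mu>: "e = E \<mu>" "\<mu> \<in> ?K" by (rule imageE)
      have "integral\<^sup>L \<mu> f \<in> U"
      proof (rule ccontr)
        assume "integral\<^sup>L \<mu> f \<notin> U"
        then have "e \<in> E ` {\<mu> \<in> ?K. integral\<^sup>L \<mu> f \<in> - U}" unfolding \<mu>(1) using \<mu>(2) by (intro imageI) simp
        with e show False by simp
      qed
      then show "e \<in> g -` T \<inter> topspace (top_of_set (E ` ?K))"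
        using \<mu> g[OF \<mu>(2)] K_prob[OF \<mu>(2)] by (simp add: T)
    qed
    moreover have "closed (E ` {\<mu> \<in> ?K. integral\<^sup>L \<mu> f \<in> - U})"
      by (rule compact_imp_closed[OF compact_E[OF f closed_Compl[OF U]]])
    ultimately show "openin (top_of_set (E ` ?K)) (g -` T \<inter> topspace (top_of_set (E ` ?K)))"
      by (auto simp: Diff_eq intro!: openin_open_Int)
  next
    let ?B = "{{\<mu> \<in> prob_measures :: ('v \<Rightarrow> real) measure set. (\<integral>\<omega>. f \<omega> \<partial>\<mu>) \<in> U} | f U.
        continuous_on UNIV f \<and> bounded (range f) \<and> open (U :: real set)}"
    \<comment> \<open>The zero function with \<open>U = UNIV\<close> shows that the set of all
      probability measures is itself subbasic, so the subbase covers the range of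
      \<open>g\<close>.\<close>
    have "(prob_measures :: ('v \<Rightarrow> real) measure set) \<in> ?B"
      by (intro CollectI exI[of _ "\<lambda>_. 0"] exI[of _ UNIV]) auto
    then have "prob_measures \<subseteq> \<Union> ?B" by (rule Union_upper)
    moreover have "g ` topspace (top_of_set (E ` ?K)) \<subseteq> prob_measures"
      using g K_prob by (simp add: image_subset_iff)
    ultimately show "g ` topspace (top_of_set (E ` ?K)) \<subseteq> \<Union> ?B" by (rule order_trans[rotated])
  qed
  moreover have "compactin (top_of_set (E ` ?K)) (E ` ?K)"
    using \<open>compact (E ` ?K)\<close> by (simp add: compactin_subtopology)
  \<comment> \<open>The tempered measures are the continuous image under \<open>g\<close> of the
    compact set of their cylinder probabilities.\<close>
  ultimately have "compactin weak_topology (g ` E ` ?K)" by (rule image_compactin[rotated])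
  moreover have "g ` E ` ?K = ?K" by (simp add: image_image g)
  ultimately show ?thesis by simp
qed

end

theorem theorem2p3:
  fixes adj :: "'v::countable \<Rightarrow> 'v \<Rightarrow> bool"
    and o\<^sub>r :: 'v
    and \<alpha> \<theta> q p I\<^sub>W J\<^sub>W a\<^sub>V c\<^sub>V :: real
    and W :: "real \<Rightarrow> real \<Rightarrow> real"
    and V :: "real \<Rightarrow> real"
  assumes undirected: "undirected_graph adj"
    and conn: "connected_graph adj"
    and locfin: "locally_finite_graph adj"
    and alpha_pos: "\<alpha> > 0" and theta_pos: "\<theta> > 0"
    and Theta: "Theta_finite adj o\<^sub>r \<alpha> \<theta>"
    and W_cont: "continuous_on UNIV (\<lambda>(u, v). W u v)"
    and W_sym: "\<And>u v. W u v = W v u"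
    and IJ_pos: "I\<^sub>W > 0" "J\<^sub>W > 0"
    and W_bound: "\<And>u v. \<bar>W u v\<bar> \<le> (I\<^sub>W + J\<^sub>W * (u\<^sup>2 + v\<^sup>2)) / 2"
    and V_cont: "continuous_on UNIV V"
    and ac_pos: "a\<^sub>V > 0" "c\<^sub>V > 0"
    and q_gt: "q > 2 + 2 / \<theta>"
    and V_bound: "\<And>u. V u \<ge> a\<^sub>V * \<bar>u\<bar> powr q - c\<^sub>V"
    and p_def: "p = 2 + 2 / \<theta>"
  shows "tempered_gibbs adj o\<^sub>r \<alpha> p W V \<noteq> {}
       \<and> compactin weak_topology (tempered_gibbs adj o\<^sub>r \<alpha> p W V)
       \<and> (\<forall>lam>0. \<forall>x. \<exists>C>0. \<forall>\<mu>\<in>tempered_gibbs adj o\<^sub>r \<alpha> p W V.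
            (\<integral>\<^sup>+\<omega>. ennreal (exp (lam * \<bar>\<omega> x\<bar> powr p)) \<partial>\<mu>) \<le> ennreal C)
       \<and> (\<forall>lam>0. \<exists>C>0. \<forall>\<mu>\<in>tempered_gibbs adj o\<^sub>r \<alpha> p W V.
            (\<integral>\<^sup>+\<omega>. ennreal (exp (lam * wnorm_pow adj o\<^sub>r \<alpha> p \<omega>)) \<partial>\<mu>) \<le> ennreal C)"
proof -
  interpret gibbs_model adj o\<^sub>r \<alpha> \<theta> q p I\<^sub>W J\<^sub>W a\<^sub>V c\<^sub>V W V
    using assms by unfold_locales auto
  show ?thesis
  proof (intro conjI allI impI)
    fix lam :: real and x :: 'v assume "lam > 0"
    then show "\<exists>C>0. \<forall>\<mu>\<in>tempered_gibbs adj o\<^sub>r \<alpha> p W V.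
        (\<integral>\<^sup>+\<omega>. ennreal (exp (lam * \<bar>\<omega> x\<bar> powr p)) \<partial>\<mu>) \<le> ennreal C"
      by (intro exI[of _ "exp (moment_const (lam / w x))"] conjI exp_gt_zero ballI tempered_exp_bound_site)
  next
    fix lam :: real assume "lam > 0"
    then show "\<exists>C>0. \<forall>\<mu>\<in>tempered_gibbs adj o\<^sub>r \<alpha> p W V.
        (\<integral>\<^sup>+\<omega>. ennreal (exp (lam * wnorm_pow adj o\<^sub>r \<alpha> p \<omega>)) \<partial>\<mu>) \<le> ennreal C"
      by (intro exI[of _ "exp (moment_const lam)"] conjI exp_gt_zero ballI tempered_exp_bound_norm)
  qed (rule tempered_gibbs_nonempty compactin_tempered_gibbs)+
qed

end
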